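(* Let $N\ge6$. For each $(b_1,\dots,b_{N+1})\in(0,\infty)^N\times\mathbb{R}$ with $\sum_{j=1}^{N-1}b_j=\tfrac12$ there is $(a_1,\dots,a_N)\in(0,\infty)^{N-1}\times\mathbb{R}$ such that $$V_{P_{\mathbf a}}(x)=-\sum_{j=1}^{N-1}b_jx_j^2+b_Nx_N+b_{N+1}\quad\text{for all }x\in P_{\mathbf a},$$ where $P_{\mathbf a}:=\{(x',x_N)\in\mathbb{R}^N: x_N\ge-a_N,\ x'\in\sqrt{x_N+a_N}\,E'_{\mathbf a'}\}$ and $E'_{\mathbf a'}:=\{x'\in\mathbb{R}^{N-1}:\sum_{j=1}^{N-1}x_j^2/a_j^2\le1\}$. Furthermore, with $p_{\mathbf b}(x'):=\sum_{j=1}^{N-1}b_jx_j^2$, the function $$u_{P_{\mathbf a}}(x):=p_{\mathbf b}(x')-b_Nx_N-b_{N+1}+V_{P_{\mathbf a}}(x)$$ satisfies $u_{P_{\mathbf a}}\ge0$ in $\mathbb{R}^N$, $\Delta u_{P_{\mathbf a}}=\chi_{\{u_{P_{\mathbf a}}>0\}}$ in $\mathbb{R}^N$, $\{u_{P_{\mathbf a}}=0\}=P_{\mathbf a}$, and $u_{P_{\mathbf a}}(rx)/r^2\to p_{\mathbf b}(x')$ uniformly on $\partial B_1$ as $r\to\infty$. Moreover $E'_{\mathbf a'}$ is, up to scaling, the unique ellipsoid corresponding to $p_{\mathbf b}$, in the sense that there is $\lambda>0$ with $V'_{\lambda E'_{\mathbf a'}}(x')=1-p_{\mathbf b}(x')$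 for all $x'\in\lambda E'_{\mathbf a'}$.
   Context: For a measurable $M\subset\mathbb{R}^m$ ($m\ge3$), the Newtonian potential is $V_M(x):=\alpha_m\int_M|x-y|^{2-m}\,dy\in[0,\infty]$ with $\alpha_m:=\frac{1}{m(m-2)|B_1|}$ ($B_1$ the unit ball of $\mathbb{R}^m$). $V$ denotes this potential in $\mathbb{R}^N$ and $V'$ the potential in $\mathbb{R}^{N-1}$. $x=(x',x_N)\in\mathbb{R}^{N-1}\times\mathbb{R}$. *)

theory Defs
  imports "HOL-Analysis.Analysis"
begin

definition newton_alpha :: "'a::euclidean_space itself \<Rightarrow> real" where
  "newton_alpha _ = 1 / (real DIM('a) * (real DIM('a) - 2) * measure lebesgue (ball (0::'a) 1))"

definition newton_pot :: "'a::euclidean_space set \<Rightarrow> 'a \<Rightarrow> ennreal" where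
  "newton_pot M x = ennreal (newton_alpha TYPE('a)) *
     (\<integral>\<^sup>+ y. indicator M y * ennreal (norm (x - y) powr (2 - real DIM('a))) \<partial>lebesgue)"

fun dd :: "'a::euclidean_space list \<Rightarrow> ('a \<Rightarrow> real) \<Rightarrow> 'a \<Rightarrow> real" where
  "dd [] f = f"
| "dd (v # vs) f = (\<lambda>x. frechet_derivative (dd vs f) (at x) v)"

definition test_fun :: "('a::euclidean_space \<Rightarrow> real) \<Rightarrow> bool" where
  "test_fun \<phi> \<longleftrightarrow> compact (closure {x. \<phi> x \<noteq> 0}) \<and>
     (\<forall>vs. continuous_on UNIV (dd vs \<phi>) \<and> (\<forall>x. dd vs \<phi> differentiable (at x)))"

definition laplacian :: "('a::euclidean_space \<Rightarrow> real) \<Rightarrow> 'a \<Rightarrow> real" where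
  "laplacian f x = (\<Sum>i\<in>Basis. dd [i, i] f x)"

definition weak_laplace_eq :: "('a::euclidean_space \<Rightarrow> real) \<Rightarrow> ('a \<Rightarrow> real) \<Rightarrow> bool" where
  "weak_laplace_eq u g \<longleftrightarrow>
     (\<forall>K. compact K \<longrightarrow> set_integrable lebesgue K u \<and> set_integrable lebesgue K g) \<and>
     (\<forall>\<phi>. test_fun \<phi> \<longrightarrow>
        (\<integral>x. u x * laplacian \<phi> x \<partial>lebesgue) = (\<integral>x. g x * \<phi> x \<partial>lebesgue))"

text \<open>R^N is modelled as (real^'n) \<times> real with N - 1 = CARD('n).\<close>
definition ellE :: "('n::finite \<Rightarrow> real) \<Rightarrow> (real^'n) set" where
  "ellE a = {x. (\<Sum>j\<in>UNIV. (x $ j)\<^sup>2 / (a j)\<^sup>2) \<le> 1}"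

definition parabP :: "('n::finite \<Rightarrow> real) \<Rightarrow> real \<Rightarrow> ((real^'n) \<times> real) set" where
  "parabP a aN = {(x', xN). xN \<ge> - aN \<and> x' \<in> (\<lambda>y. sqrt (xN + aN) *\<^sub>R y) ` ellE a}"

definition pb :: "('n::finite \<Rightarrow> real) \<Rightarrow> real^'n \<Rightarrow> real" where
  "pb b x = (\<Sum>j\<in>UNIV. b j * (x $ j)\<^sup>2)"

end

theory Submission
  imports Defs "HOL-Real_Asymp.Real_Asymp"
begin

text \<open>
  Along the confocal family \<open>E\<^sub>s = {q\<^sub>s \<ge> 0}\<close>, \<open>q\<^sub>s(x) = 1 - (\<Sum>i. x\<^sub>i\<^sup>2 / (A\<^sub>i + s))\<close>, with weight
  \<open>w(s) = (\<Prod>i. (A\<^sub>i + s) powr (-1/2))\<close>, one has \<open>|\<nabla>q\<^sub>s|\<^sup>2 = 4 \<partial>\<^sub>s q\<^sub>s\<close> and \<open>w \<Delta>q\<^sub>s = 4 w'\<close>, so that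
  \<open>w \<Delta>(max 0 q\<^sub>s) = 4 \<partial>\<^sub>s (w \<chi>(E\<^sub>s))\<close> in the sense of distributions. Integration over \<open>s \<ge> 0\<close> shows that
  \<open>G = (\<integral> w max 0 q\<^sub>s ds) / (4 w(0))\<close> satisfies \<open>-\<Delta>G = \<chi>(E\<^sub>0)\<close>. Testing with the regularised
  Newton kernels \<open>(\<epsilon>\<^sup>2 + |x - y|\<^sup>2) powr ((2 - m)/2)\<close>, whose Laplacians form an approximate identity, identifies
  \<open>G\<close> with the Newtonian potential everywhere, inside and outside the ellipsoid.

  The paraboloid is, up to a null set, the increasing union of the ellipsoids
  \<open>(\<Sum>j. x\<^sub>j\<^sup>2 / \<alpha>\<^sub>j) \<le> z - z\<^sup>2 / L\<close>. As \<open>L\<close> tends to infinity their potentials converge to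
  \<open>(\<integral> w(s) max 0 (z + s/4 - (\<Sum>j. x\<^sub>j\<^sup>2 / (\<alpha>\<^sub>j + s))) ds) / (4 w(0))\<close>; this integral converges
  because there are at least five variables \<open>x\<^sub>j\<close>. Without the positive part it is the required quadratic polynomial,
  hence \<open>u\<close> is the integral of the negative part, which is nonnegative and vanishes exactly on the paraboloid.
  Its quadratic coefficients are those of the ellipsoid with the same \<open>\<alpha>\<close>, and they are prescribed by minimising
  \<open>\<integral> w ds + 2 (\<Sum>j. b\<^sub>j \<alpha>\<^sub>j)\<close>; scaling \<open>\<alpha>\<close> and shifting \<open>z\<close> adjust the linear and the constant term.
\<close>

section \<open>Integration by parts by translation\<close>

text \<open>The distributional identity for E_s is never proved on a moving domain, and no surface
  measure occurs. Everything is pulled back to the unit ball by \<open>conf_map\<close>; there z_i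
  times the indicator of the ball is -1/2 times the i-th derivative of the Lipschitz profile
  \<open>max 0 (1 - (norm z)\<^sup>2)\<close>, so integration by parts along lines is the only form
  of the divergence theorem that is required. No derivative of G is ever taken: in the
  identification with the Newtonian potential G has merely to be continuous and bounded.

  The cut z - z^2/L makes the ellipsoids touch the paraboloid at its vertex. Completing the square
  gives squared semi-axes L \<alpha>_j / 4 and L^2 / 4, and s = (L / 4) u is the scale on which the
  integrand converges.

  The functional is minimised without a constraint. Its critical equations are
  \<open>wt_div_int \<alpha> j = 4 * b j\<close>; as these integrals always add up to 2 w(0), the
  condition that the b_j add up to 1/2 forces w(0) = 1, which is exactly the normalisation in
  \<open>ell_coeff\<close>.\<close>

lemma integrable_continuous_mult_bounded_support:
  fixes g \<rho> :: "'a::euclidean_space \<Rightarrow> real"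
  assumes "continuous_on UNIV g" and [measurable]: "\<rho> \<in> borel_measurable borel"
    and "\<And>x. norm x > R \<Longrightarrow> \<rho> x = 0" and "\<And>x. \<bar>\<rho> x\<bar> \<le> M"
  shows "integrable lborel (\<lambda>x. g x * \<rho> x)"
proof -
  have gm[measurable]: "g \<in> borel_measurable borel"
    using assms(1) by (rule borel_measurable_continuous_onI)
  have "integrable lborel (\<lambda>x. indicator (cball 0 R) x *\<^sub>R g x)"
    by (rule borel_integrable_compact) (auto intro: continuous_on_subset[OF assms(1)])
  then have "integrable lborel (\<lambda>x. M * (indicator (cball 0 R) x *\<^sub>R g x))"
    by simp
  then show ?thesis
  proof (rule Bochner_Integration.integrable_bound)
    show "AE x in lborel. norm (g x * \<rho> x) \<le> norm (M * (indicator (cball 0 R) x *\<^sub>R g x))"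
    proof (rule AE_I2)
      fix x :: 'a
      have "M \<ge> 0" using assms(4)[of 0] by linarith
      show "norm (g x * \<rho> x) \<le> norm (M * (indicator (cball 0 R) x *\<^sub>R g x))"
      proof (cases "norm x \<le> R")
        case True
        have "\<bar>g x\<bar> * \<bar>\<rho> x\<bar> \<le> \<bar>g x\<bar> * M"
          using assms(4) by (intro mult_left_mono) auto
        then show ?thesis using True \<open>M \<ge> 0\<close>
          by (simp add: abs_mult mult.commute)
      next
        case False then show ?thesis using assms(3)[of x] by simp
      qed
    qed
  qed measurable
qed

lemma lborel_integral_translate:
  fixes h :: "'a::euclidean_space \<Rightarrow> real"
  assumes [measurable]: "h \<in> borel_measurable borel"
  shows "(\<integral>x. h (x + a) \<partial>lborel) = (\<integral>x. h x \<partial>lborel)"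
proof -
  have "(\<integral>x. h x \<partial>lborel) = (\<integral>x. h x \<partial>(distr lborel borel ((+) a)))"
    by (simp add: lborel_distr_plus)
  also have "\<dots> = (\<integral>x. h (a + x) \<partial>lborel)"
    by (rule integral_distr) measurable
  finally show ?thesis by (simp add: add.commute)
qed

text \<open>The difference quotient is moved from one factor to the other by translation invariance.\<close>

lemma integral_by_parts_direction:
  fixes f \<rho> :: "'a::euclidean_space \<Rightarrow> real"
  assumes contf: "continuous_on UNIV f" and contf': "continuous_on UNIV f'"
    and df: "\<And>x t. ((\<lambda>t. f (x + t *\<^sub>R v)) has_real_derivative f' (x + t *\<^sub>R v)) (at t)"
    and [measurable]: "\<rho> \<in> borel_measurable borel" "\<rho>' \<in> borel_measurable borel"
    and supp: "\<And>x. norm x > R \<Longrightarrow> \<rho> x = 0" and bdd: "\<And>x. \<bar>\<rho> x\<bar> \<le> M"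
    and lip: "\<And>x t. \<bar>\<rho> (x + t *\<^sub>R v) - \<rho> x\<bar> \<le> K * \<bar>t\<bar>"
    and d\<rho>: "AE x in lborel. ((\<lambda>t. \<rho> (x + t *\<^sub>R v)) has_real_derivative \<rho>' x) (at 0)"
  shows "(\<integral>x. f' x * \<rho> x \<partial>lborel) = - (\<integral>x. f x * \<rho>' x \<partial>lborel)"
proof -
  have [measurable]: "f \<in> borel_measurable borel" "f' \<in> borel_measurable borel"
    using contf contf' by (auto intro: borel_measurable_continuous_onI)
  define t where "t n = inverse (real (Suc n))" for n
  have tpos: "t n > 0" and tle: "t n \<le> 1" for n
    by (auto simp: t_def field_simps)
  have t0: "t \<longlonglongrightarrow> 0" unfolding t_def by (rule LIMSEQ_inverse_real_of_nat)
  \<comment> \<open>Since \<open>t n \<le> 1\<close>, a segment that starts in the ball of radius R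
    and runs along \<open>t n *\<^sub>R v\<close> stays in this larger ball; the bound of f' there
    dominates all difference quotients of f.\<close>
  have "bounded (f' ` cball 0 (R + norm v))"
    by (intro compact_imp_bounded compact_continuous_image continuous_on_subset[OF contf']) auto
  then obtain L where L: "\<And>x. norm x \<le> R + norm v \<Longrightarrow> \<bar>f' x\<bar> \<le> L"
    unfolding bounded_iff by (metis image_eqI mem_cball_0 real_norm_def)
  have L2: "\<bar>f (x + t n *\<^sub>R v) - f x\<bar> \<le> L * t n" if "norm x \<le> R" for x n
  proof -
    obtain z where z: "0 < z" "z < t n"
      "f (x + t n *\<^sub>R v) - f (x + 0 *\<^sub>R v) = (t n - 0) * f' (x + z *\<^sub>R v)"
      using MVT2[OF tpos[of n], of "\<lambda>t. f (x + t *\<^sub>R v)" "\<lambda>t. f' (x + t *\<^sub>R v)"] df by blast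
    have "norm (x + z *\<^sub>R v) \<le> norm x + z * norm v"
      using norm_triangle_ineq[of x "z *\<^sub>R v"] z(1) by simp
    also have "\<dots> \<le> R + norm v"
      using that z tle[of n] mult_right_mono[of z 1 "norm v"] by auto
    finally have "\<bar>f' (x + z *\<^sub>R v)\<bar> \<le> L" by (rule L)
    then show ?thesis using z(3) tpos[of n] by (simp add: abs_mult)
  qed
  let ?A = "\<lambda>n x. (f (x + t n *\<^sub>R v) - f x) / t n * \<rho> x"
  let ?B = "\<lambda>n x. f x * ((\<rho> (x - t n *\<^sub>R v) - \<rho> x) / t n)"
  have eqn: "(\<integral>x. ?A n x \<partial>lborel) = (\<integral>x. ?B n x \<partial>lborel)" for n
  proof -
    have c1: "continuous_on UNIV (\<lambda>x. f (x + t n *\<^sub>R v))"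
      by (rule continuous_on_compose2[OF contf]) (auto intro!: continuous_intros)
    have i1: "integrable lborel (\<lambda>x. f (x + t n *\<^sub>R v) * \<rho> x)"
      by (rule integrable_continuous_mult_bounded_support[OF c1 _ supp bdd]) auto
    have i2: "integrable lborel (\<lambda>x. f x * \<rho> x)"
      by (rule integrable_continuous_mult_bounded_support[OF contf _ supp bdd]) auto
    have i3: "integrable lborel (\<lambda>x. f x * \<rho> (x - t n *\<^sub>R v))"
    proof (rule integrable_continuous_mult_bounded_support[OF contf _ _ bdd, where R = "R + norm v"])
      fix x :: 'a assume "norm x > R + norm v"
      then have "norm (x - t n *\<^sub>R v) > R"
        using norm_triangle_ineq2[of x "t n *\<^sub>R v"] tpos[of n] tle[of n]
          mult_right_mono[of "t n" 1 "norm v"] by auto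
      then show "\<rho> (x - t n *\<^sub>R v) = 0" by (rule supp)
    qed measurable
    have e: "(\<integral>x. f (x + t n *\<^sub>R v) * \<rho> x \<partial>lborel) = (\<integral>x. f x * \<rho> (x - t n *\<^sub>R v) \<partial>lborel)"
      using lborel_integral_translate[of "\<lambda>x. f x * \<rho> (x - t n *\<^sub>R v)" "t n *\<^sub>R v"] by simp
    have "(\<integral>x. ?A n x \<partial>lborel) = (\<integral>x. (f (x + t n *\<^sub>R v) * \<rho> x - f x * \<rho> x) / t n \<partial>lborel)"
      by (simp add: algebra_simps diff_divide_distrib)
    also have "\<dots> = ((\<integral>x. f (x + t n *\<^sub>R v) * \<rho> x \<partial>lborel) - (\<integral>x. f x * \<rho> x \<partial>lborel)) / t n"
      using i1 i2 by simp
    also have "\<dots> = ((\<integral>x. f x * \<rho> (x - t n *\<^sub>R v) \<partial>lborel) - (\<integral>x. f x * \<rho> x \<partial>lborel)) / t n"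
      by (simp add: e)
    also have "\<dots> = (\<integral>x. (f x * \<rho> (x - t n *\<^sub>R v) - f x * \<rho> x) / t n \<partial>lborel)"
      using i3 i2 by simp
    also have "\<dots> = (\<integral>x. ?B n x \<partial>lborel)"
      by (simp add: algebra_simps diff_divide_distrib)
    finally show ?thesis .
  qed
  have lim1: "(\<lambda>n. \<integral>x. ?A n x \<partial>lborel) \<longlonglongrightarrow> (\<integral>x. f' x * \<rho> x \<partial>lborel)"
  proof (rule integral_dominated_convergence[where w = "\<lambda>x. L * (M * indicator (cball 0 R) x)"])
    show "integrable lborel (\<lambda>x::'a. L * (M * indicator (cball 0 R) x))"
      by (intro integrable_mult_right integrable_real_indicator) (use emeasure_lborel_cball_finite[of "0::'a" R] in auto)
    show "AE x in lborel. (\<lambda>n. ?A n x) \<longlonglongrightarrow> f' x * \<rho> x"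
    proof (rule AE_I2)
      fix x
      have "((\<lambda>h. (f (x + (0 + h) *\<^sub>R v) - f (x + 0 *\<^sub>R v)) / h) \<longlongrightarrow> f' (x + 0 *\<^sub>R v)) (at 0)"
        using df[of x 0] unfolding DERIV_def .
      then have "((\<lambda>h. (f (x + h *\<^sub>R v) - f x) / h) \<longlongrightarrow> f' x) (at 0)" by simp
      then have "(\<lambda>n. (f (x + t n *\<^sub>R v) - f x) / t n) \<longlonglongrightarrow> f' x"
        by (rule tendsto_compose_eventually[OF _ t0]) (use tpos in \<open>auto intro!: always_eventually less_imp_neq[THEN not_sym]\<close>)
      then show "(\<lambda>n. ?A n x) \<longlonglongrightarrow> f' x * \<rho> x" by (intro tendsto_intros)
    qed
    fix n
    show "AE x in lborel. norm (?A n x) \<le> L * (M * indicator (cball 0 R) x)"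
    proof (rule AE_I2)
      fix x
      show "norm (?A n x) \<le> L * (M * indicator (cball 0 R) x)"
      proof (cases "norm x \<le> R")
        case True
        have q: "\<bar>(f (x + t n *\<^sub>R v) - f x) / t n\<bar> \<le> L"
          using L2[OF True, of n] tpos[of n] by (simp add: field_simps)
        have "\<bar>(f (x + t n *\<^sub>R v) - f x) / t n\<bar> * \<bar>\<rho> x\<bar> \<le> L * M"
          using q bdd order_trans[OF abs_ge_zero q] by (intro mult_mono) auto
        then show ?thesis using True by (simp add: abs_mult)
      next
        case False then show ?thesis using supp[of x] by simp
      qed
    qed
  qed measurable
  \<comment> \<open>The Lipschitz bound dominates the quotients of \<rho>, so \<rho> needs a
    derivative only almost everywhere. This admits profiles with a kink.\<close>
  have lim2: "(\<lambda>n. \<integral>x. ?B n x \<partial>lborel) \<longlonglongrightarrow> (\<integral>x. f x * (- \<rho>' x) \<partial>lborel)"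
  proof (rule integral_dominated_convergence[where w = "\<lambda>x. K * (indicator (cball 0 (R + norm v)) x *\<^sub>R \<bar>f x\<bar>)"])
    show "integrable lborel (\<lambda>x::'a. K * (indicator (cball 0 (R + norm v)) x *\<^sub>R \<bar>f x\<bar>))"
      by (intro integrable_mult_right borel_integrable_compact continuous_intros continuous_on_subset[OF contf]) auto
    show "AE x in lborel. (\<lambda>n. ?B n x) \<longlonglongrightarrow> f x * (- \<rho>' x)"
      using d\<rho>
    proof eventually_elim
      fix x
      assume "((\<lambda>t. \<rho> (x + t *\<^sub>R v)) has_real_derivative \<rho>' x) (at 0)"
      then have "((\<lambda>h. (\<rho> (x + h *\<^sub>R v) - \<rho> x) / h) \<longlongrightarrow> \<rho>' x) (at 0)"
        by (simp add: DERIV_def)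
      then have "(\<lambda>n. (\<rho> (x + (- t n) *\<^sub>R v) - \<rho> x) / (- t n)) \<longlonglongrightarrow> \<rho>' x"
        by (rule tendsto_compose_eventually)
          (use tpos t0 in \<open>auto intro!: always_eventually less_imp_neq[THEN not_sym] tendsto_eq_intros\<close>)
      then have "(\<lambda>n. - ((\<rho> (x + (- t n) *\<^sub>R v) - \<rho> x) / (- t n))) \<longlonglongrightarrow> - \<rho>' x"
        by (rule tendsto_minus)
      then have "(\<lambda>n. (\<rho> (x - t n *\<^sub>R v) - \<rho> x) / t n) \<longlonglongrightarrow> - \<rho>' x" by simp
      then show "(\<lambda>n. ?B n x) \<longlonglongrightarrow> f x * (- \<rho>' x)" by (intro tendsto_intros)
    qed
    fix n
    show "AE x in lborel. norm (?B n x) \<le> K * (indicator (cball 0 (R + norm v)) x *\<^sub>R \<bar>f x\<bar>)"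
    proof (rule AE_I2)
      fix x
      show "norm (?B n x) \<le> K * (indicator (cball 0 (R + norm v)) x *\<^sub>R \<bar>f x\<bar>)"
      proof (cases "norm x \<le> R + norm v")
        case True
        have "\<bar>(\<rho> (x - t n *\<^sub>R v) - \<rho> x) / t n\<bar> \<le> K"
          using lip[of x "- t n"] tpos[of n] by (simp add: field_simps)
        then have "\<bar>f x\<bar> * \<bar>(\<rho> (x - t n *\<^sub>R v) - \<rho> x) / t n\<bar> \<le> \<bar>f x\<bar> * K"
          by (intro mult_left_mono) auto
        then show ?thesis using True by (simp add: abs_mult mult.commute)
      next
        case False
        then have "norm (x - t n *\<^sub>R v) > R"
          using norm_triangle_ineq2[of x "t n *\<^sub>R v"] tpos[of n] tle[of n]
            mult_right_mono[of "t n" 1 "norm v"] by auto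
        moreover have "norm x > R" using False by (smt (verit) norm_ge_zero)
        ultimately show ?thesis using supp False by simp
      qed
    qed
  qed measurable
  show ?thesis
    using LIMSEQ_unique[OF lim1[unfolded eqn] lim2] by simp
qed

section \<open>The weights of the confocal family\<close>

text \<open>The index set is a parameter so that the same weight serves the basis of a Euclidean
  space and the index type of the horizontal coordinates.\<close>

definition wt :: "'i set \<Rightarrow> ('i \<Rightarrow> real) \<Rightarrow> real \<Rightarrow> real" where
  "wt I A s = (\<Prod>i\<in>I. 1 / sqrt (A i + s))"

lemma wt_pos:
  assumes "\<forall>i\<in>I. A i > 0" "s \<ge> 0"
  shows "wt I A s > 0"
  unfolding wt_def using assms by (intro prod_pos) (auto simp: add_pos_nonneg)

lemma wt_measurable[measurable]: "wt I A \<in> borel_measurable borel"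
  unfolding wt_def[abs_def] by measurable

text \<open>Each factor is at most a constant times 1 / sqrt (1 + s), and this quantity is at most
  1, so surplus factors may be dropped.\<close>

lemma wt_le_power:
  assumes "finite I" "\<forall>i\<in>I. A i > 0" "k \<le> card I"
  shows "\<exists>C>0. \<forall>s\<ge>0. wt I A s \<le> C * (1 / sqrt (1 + s)) ^ k"
proof -
  \<comment> \<open>Inserting 1 gives \<open>a \<le> 1\<close>, which is what a (1 + s) \<le> A_i +
    s requires.\<close>
  define a where "a = Min (insert 1 (A ` I))"
  have a: "a > 0" "a \<le> 1" "\<And>i. i \<in> I \<Longrightarrow> a \<le> A i"
    using assms(1,2) by (auto simp: a_def)
  have "wt I A s \<le> (1 / sqrt a) ^ card I * (1 / sqrt (1 + s)) ^ k" if s: "s \<ge> 0" for s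
  proof -
    have "wt I A s \<le> (\<Prod>i\<in>I. (1 / sqrt a) * (1 / sqrt (1 + s)))"
      unfolding wt_def
    proof (rule prod_mono)
      fix i assume i: "i \<in> I"
      have "a * (1 + s) \<le> A i + s"
        using a(2) a(3)[OF i] s mult_right_mono[of a 1 s] by (simp add: algebra_simps)
      then have "sqrt (a * (1 + s)) \<le> sqrt (A i + s)" by simp
      moreover have "sqrt (a * (1 + s)) > 0" using a s by simp
      ultimately have "1 / sqrt (A i + s) \<le> 1 / sqrt (a * (1 + s))"
        by (intro divide_left_mono mult_pos_pos) auto
      then show "0 \<le> 1 / sqrt (A i + s) \<and> 1 / sqrt (A i + s) \<le> (1 / sqrt a) * (1 / sqrt (1 + s))"
        using assms(2)[rule_format, OF i] s by (simp add: real_sqrt_mult)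
    qed
    also have "\<dots> = (1 / sqrt a) ^ card I * (1 / sqrt (1 + s)) ^ card I"
      by (simp add: power_mult_distrib power_divide)
    also have "\<dots> \<le> (1 / sqrt a) ^ card I * (1 / sqrt (1 + s)) ^ k"
      using assms(3) a s by (intro mult_left_mono power_decreasing) auto
    finally show ?thesis .
  qed
  moreover have "(1 / sqrt a) ^ card I > 0" using a by simp
  ultimately show ?thesis by blast
qed

lemma integrable_inverse_sqrt_cubed:
  "integrable lborel (\<lambda>s. indicator {0..} s * (1 / sqrt (1 + s)) ^ 3 :: real)"
proof -
  have lim: "((\<lambda>s. - 2 / sqrt (1 + s)) \<longlongrightarrow> 0) at_top"
    by real_asymp
  have "(\<integral>\<^sup>+s. ennreal ((1 / sqrt (1 + s)) ^ 3) * indicator {0..} s \<partial>lborel) = 0 - (- 2 / sqrt (1 + 0 :: real))"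
  proof (rule nn_integral_FTC_atLeast[OF _ _ _ lim])
    fix s :: real assume "0 \<le> s"
    then show "((\<lambda>s. - 2 / sqrt (1 + s)) has_real_derivative (1 / sqrt (1 + s)) ^ 3) (at s)"
      by (auto intro!: derivative_eq_intros simp: field_simps power3_eq_cube)
  qed auto
  then have "(\<integral>\<^sup>+s. ennreal (indicator {0..} s * (1 / sqrt (1 + s)) ^ 3) \<partial>lborel) < \<infinity>"
    by (subst nn_integral_cong[where v = "\<lambda>s. ennreal ((1 / sqrt (1 + s)) ^ 3) * indicator {0..} s"])
      (auto simp: indicator_def)
  then show ?thesis
    by (intro integrableI_nonneg) (auto simp: indicator_def)
qed

lemma integrable_wt:
  assumes "finite I" "\<forall>i\<in>I. A i > 0" "card I \<ge> 3"
  shows "integrable lborel (\<lambda>s. indicator {0..} s * wt I A s)"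
proof -
  obtain C where C: "C > 0" "\<And>s. s \<ge> 0 \<Longrightarrow> wt I A s \<le> C * (1 / sqrt (1 + s)) ^ 3"
    using wt_le_power[of I A 3] assms by auto
  have "integrable lborel (\<lambda>s. C * (indicator {0..} s * (1 / sqrt (1 + s)) ^ 3 :: real))"
    using integrable_inverse_sqrt_cubed by simp
  then show ?thesis
  proof (rule Bochner_Integration.integrable_bound)
    show "AE s in lborel. norm (indicator {0..} s * wt I A s) \<le> norm (C * (indicator {0..} s * (1 / sqrt (1 + s)) ^ 3 :: real))"
      using C wt_pos[of I A] assms(2) by (auto simp: indicator_def intro!: AE_I2 order_trans[OF _ abs_ge_self] abs_leI)
         (smt (verit))
  qed measurable
qed

text \<open>Five factors decay like s^(-5/2), which leaves the integrable s^(-3/2) after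
  multiplication by s; four factors would leave 1/s. This is where the dimension bound N - 1 >= 5
  enters.\<close>

lemma integrable_mult_wt:
  assumes "finite I" "\<forall>i\<in>I. A i > 0" "card I \<ge> 5"
  shows "integrable lborel (\<lambda>s. indicator {0..} s * (s * wt I A s))"
proof -
  obtain C where C: "C > 0" "\<And>s. s \<ge> 0 \<Longrightarrow> wt I A s \<le> C * (1 / sqrt (1 + s)) ^ 5"
    using wt_le_power[of I A 5] assms by auto
  have "integrable lborel (\<lambda>s. C * (indicator {0..} s * (1 / sqrt (1 + s)) ^ 3 :: real))"
    using integrable_inverse_sqrt_cubed by simp
  then show ?thesis
  proof (rule Bochner_Integration.integrable_bound)
    show "AE s in lborel. norm (indicator {0..} s * (s * wt I A s)) \<le> norm (C * (indicator {0..} s * (1 / sqrt (1 + s)) ^ 3 :: real))"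
    proof (rule AE_I2)
      fix s :: real
      show "norm (indicator {0..} s * (s * wt I A s)) \<le> norm (C * (indicator {0..} s * (1 / sqrt (1 + s)) ^ 3 :: real))"
      proof (cases "s \<ge> 0")
        case True
        let ?q = "1 / sqrt (1 + s)"
        have gen: "s * (C * q ^ 5) = (s * q\<^sup>2) * (C * q ^ 3)" for q :: real by (simp add: eval_nat_numeral)
        have sq: "s * ?q\<^sup>2 \<le> 1" using True by (simp add: power_divide field_simps)
        have "s * wt I A s \<le> s * (C * ?q ^ 5)" using C True by (intro mult_left_mono) auto
        also have "\<dots> = (s * ?q\<^sup>2) * (C * ?q ^ 3)" by (rule gen)
        also have "\<dots> \<le> 1 * (C * ?q ^ 3)" using sq C True by (intro mult_right_mono) auto
        finally show ?thesis using True C wt_pos[of I A s] assms(2) by (auto simp: less_imp_le)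
      qed auto
    qed
  qed measurable
qed

section \<open>The parabolic profile of the unit ball\<close>

lemma profile_lipschitz:
  fixes x y :: "'a::euclidean_space"
  shows "\<bar>max 0 (1 - (norm x)\<^sup>2) - max 0 (1 - (norm y)\<^sup>2)\<bar> \<le> 2 * norm (x - y)"
proof -
  \<comment> \<open>By symmetry a one-sided bound suffices, and it is trivial unless x lies in the
    open ball. There the left side is (|y| - |x|)(|y| + |x|), with |y| replaced by 1 when y lies
    outside the ball, and the second factor is at most 2.\<close>
  have *: "max 0 (1 - (norm x)\<^sup>2) - max 0 (1 - (norm y)\<^sup>2) \<le> 2 * norm (x - y)" for x y :: 'a
  proof (cases "norm x < 1")
    case False
    then have "(norm x)\<^sup>2 \<ge> 1" by (simp add: one_le_power)
    then have "max 0 (1 - (norm x)\<^sup>2) = 0" by simp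
    then show ?thesis using norm_ge_zero[of "x - y"] by linarith
  next
    case True
    then have x1: "(norm x)\<^sup>2 \<le> 1" by (simp add: power_le_one)
    have n: "norm y - norm x \<le> norm (x - y)" by norm
    show ?thesis
    proof (cases "norm y \<le> 1")
      case y: True
      then have y1: "(norm y)\<^sup>2 \<le> 1" by (simp add: power_le_one)
      have "(norm y - norm x) * (norm y + norm x) \<le> norm (x - y) * 2"
        using n True y by (intro mult_mono) auto
      then show ?thesis using x1 y1 by (simp add: algebra_simps power2_eq_square)
    next
      case y: False
      have "(1 - norm x) * (1 + norm x) \<le> norm (x - y) * 2"
        using n True y by (intro mult_mono) auto
      then show ?thesis using x1 by (simp add: algebra_simps power2_eq_square)
    qed
  qed
  show ?thesis using *[of x y] *[of y x] by (simp add: abs_le_iff norm_minus_commute)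
qed

text \<open>Off the unit sphere a whole neighbourhood lies on one side of it, where the profile is a
  polynomial or vanishes; the kink is confined to a null set.\<close>

lemma profile_derivative:
  fixes x i :: "'a::euclidean_space"
  assumes "norm x \<noteq> 1" "i \<in> Basis"
  shows "((\<lambda>t. max 0 (1 - (norm (x + t *\<^sub>R i))\<^sup>2)) has_real_derivative - (2 * (x \<bullet> i) * indicator (cball 0 1) x)) (at 0)"
proof -
  have c: "continuous_on UNIV (\<lambda>t::real. norm (x + t *\<^sub>R i))" by (intro continuous_intros)
  show ?thesis
  proof (cases "norm x < 1")
    case True
    have "((\<lambda>t. 1 - (norm x ^ 2 + 2 * t * (x \<bullet> i) + t\<^sup>2)) has_real_derivative - (2 * (x \<bullet> i) * indicator (cball 0 1) x)) (at 0)"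
      using True by (auto intro!: derivative_eq_intros)
    then show ?thesis
    proof (rule has_field_derivative_transform_within_open)
      show "open {t. norm (x + t *\<^sub>R i) < 1}"
        using c by (intro open_Collect_less continuous_on_const)
      fix t assume "t \<in> {t. norm (x + t *\<^sub>R i) < 1}"
      then have "(norm (x + t *\<^sub>R i))\<^sup>2 \<le> 1" by (simp add: power_le_one)
      moreover have "(norm (x + t *\<^sub>R i))\<^sup>2 = norm x ^ 2 + 2 * t * (x \<bullet> i) + t\<^sup>2"
        using assms(2) unfolding power2_norm_eq_inner
        by (simp add: inner_add_left inner_add_right inner_commute algebra_simps power2_eq_square)
      ultimately show "1 - (norm x ^ 2 + 2 * t * (x \<bullet> i) + t\<^sup>2) = max 0 (1 - (norm (x + t *\<^sub>R i))\<^sup>2)" by simp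
    qed (use True in auto)
  next
    case False
    with assms have x: "norm x > 1" by simp
    have "((\<lambda>t. 0::real) has_real_derivative - (2 * (x \<bullet> i) * indicator (cball 0 1) x)) (at 0)"
      using x by auto
    then show ?thesis
    proof (rule has_field_derivative_transform_within_open)
      show "open {t. norm (x + t *\<^sub>R i) > 1}"
        using c by (intro open_Collect_less continuous_on_const)
      fix t assume "t \<in> {t. norm (x + t *\<^sub>R i) > 1}"
      then have "(norm (x + t *\<^sub>R i))\<^sup>2 \<ge> 1" by (simp add: one_le_power)
      then show "0 = max 0 (1 - (norm (x + t *\<^sub>R i))\<^sup>2)" by simp
    qed (use x in auto)
  qed
qed

lemma AE_not_in_sphere: "AE x::'a::euclidean_space in lborel. norm x \<noteq> 1"
proof -
  have "sphere 0 1 \<in> null_sets (lborel :: 'a measure)"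
    using negligible_sphere[of "0::'a" 1]
    by (auto simp: null_sets_completion_iff negligible_iff_null_sets)
  then show ?thesis by (rule AE_I') auto
qed

text \<open>First moments over the ball are traded for integrals of a derivative against the
  profile. The profile vanishes on the sphere, so no boundary term appears.\<close>

lemma profile_integral_by_parts:
  fixes f :: "'a::euclidean_space \<Rightarrow> real"
  assumes "continuous_on UNIV f" "continuous_on UNIV f'" "i \<in> Basis"
    and "\<And>x t. ((\<lambda>t. f (x + t *\<^sub>R i)) has_real_derivative f' (x + t *\<^sub>R i)) (at t)"
  shows "(\<integral>z. f' z * max 0 (1 - (norm z)\<^sup>2) \<partial>lborel) = 2 * (\<integral>z. indicator (cball 0 1) z * ((z \<bullet> i) * f z) \<partial>lborel)"
proof -
  have [measurable]: "cball (0::'a) 1 \<in> sets borel" by simp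
  have "(\<integral>z. f' z * max 0 (1 - (norm z)\<^sup>2) \<partial>lborel) = - (\<integral>z. f z * - (2 * (z \<bullet> i) * indicator (cball 0 1) z) \<partial>lborel)"
  proof (rule integral_by_parts_direction[OF assms(1,2,4), where R = 1 and M = 1 and K = 2])
    show "AE x in lborel. ((\<lambda>t. max 0 (1 - (norm (x + t *\<^sub>R i))\<^sup>2)) has_real_derivative - (2 * (x \<bullet> i) * indicator (cball 0 1) x)) (at 0)"
      using AE_not_in_sphere by eventually_elim (rule profile_derivative[OF _ assms(3)])
    fix x :: 'a and t :: real
    show "1 < norm x \<Longrightarrow> max 0 (1 - (norm x)\<^sup>2) = 0" by (simp add: one_le_power)
    show "\<bar>max 0 (1 - (norm x)\<^sup>2)\<bar> \<le> 1" by simp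
    show "\<bar>max 0 (1 - (norm (x + t *\<^sub>R i))\<^sup>2) - max 0 (1 - (norm x)\<^sup>2)\<bar> \<le> 2 * \<bar>t\<bar>"
      using profile_lipschitz[of "x + t *\<^sub>R i" x] assms(3) by simp
  qed measurable
  also have "\<dots> = (\<integral>z. 2 * (indicator (cball 0 1) z * ((z \<bullet> i) * f z)) \<partial>lborel)"
    by (subst integral_minus[symmetric]) (simp add: algebra_simps)
  finally show ?thesis by simp
qed

section \<open>The confocal flow\<close>

text \<open>The entries of \<open>A\<close> are the squared semi-axes, so adding s to all of them
  runs through the confocal family; the q_s of the overview is
  \<open>1 - conf_quad A c x s\<close>.\<close>

definition conf_quad :: "('a::euclidean_space \<Rightarrow> real) \<Rightarrow> 'a \<Rightarrow> 'a \<Rightarrow> real \<Rightarrow> real" where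
  "conf_quad A c x s = (\<Sum>i\<in>Basis. ((x - c) \<bullet> i)\<^sup>2 / (A i + s))"

definition ellip :: "('a::euclidean_space \<Rightarrow> real) \<Rightarrow> 'a \<Rightarrow> 'a set" where
  "ellip A c = {x. conf_quad A c x 0 \<le> 1}"

text \<open>The classical Dirichlet-Ivory formula. For x outside the ellipsoid the positive part
  starts the integration at the ellipsoidal coordinate of x, so a single expression covers interior
  and exterior.\<close>

definition ell_pot :: "('a::euclidean_space \<Rightarrow> real) \<Rightarrow> 'a \<Rightarrow> 'a \<Rightarrow> real" where
  "ell_pot A c x = (\<integral>s. indicator {0..} s * (wt Basis A s * max 0 (1 - conf_quad A c x s)) \<partial>lborel) / (4 * wt Basis A 0)"

text \<open>Parametrises E_s by the fixed unit ball, so that differentiation in s falls on the test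
  function and not on the domain.\<close>

definition conf_map :: "('a::euclidean_space \<Rightarrow> real) \<Rightarrow> 'a \<Rightarrow> real \<Rightarrow> 'a \<Rightarrow> 'a" where
  "conf_map A c s z = c + (\<Sum>i\<in>Basis. (sqrt (A i + s) * (z \<bullet> i)) *\<^sub>R i)"

text \<open>Carries the gradient and the pure second derivatives along the axes as explicit
  functions. Mixed derivatives are absent because only the Laplacian, the sum of the
  \<open>h i\<close>, is ever formed; kernels, polynomials and test functions can all supply such
  data.\<close>

definition C2_data :: "('a::euclidean_space \<Rightarrow> real) \<Rightarrow> ('a \<Rightarrow> 'a \<Rightarrow> real) \<Rightarrow> ('a \<Rightarrow> 'a \<Rightarrow> real) \<Rightarrow> bool" where
  "C2_data \<phi> g h \<longleftrightarrow>
     (\<forall>x. (\<phi> has_derivative (\<lambda>v. \<Sum>i\<in>Basis. (v \<bullet> i) * g i x)) (at x)) \<and>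
     (\<forall>i\<in>Basis. continuous_on UNIV (g i) \<and> continuous_on UNIV (h i) \<and>
        (\<forall>x. ((\<lambda>t. g i (x + t *\<^sub>R i)) has_real_derivative h i x) (at 0)))"

lemma C2_data_continuous:
  assumes "C2_data \<phi> g h"
  shows "continuous_on UNIV \<phi>"
  using assms unfolding C2_data_def
  by (auto intro!: continuous_at_imp_continuous_on has_derivative_continuous)

lemma line_derivative_shift:
  fixes f :: "'a::real_vector \<Rightarrow> real"
  assumes "\<And>x. ((\<lambda>t. f (x + t *\<^sub>R v)) has_real_derivative f' x) (at 0)"
  shows "((\<lambda>t. f (x + t *\<^sub>R v)) has_real_derivative f' (x + t *\<^sub>R v)) (at t)"
proof -
  have "((\<lambda>s. f (x + (t + s) *\<^sub>R v)) has_real_derivative f' (x + t *\<^sub>R v)) (at 0)"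
    using assms[of "x + t *\<^sub>R v"] by (simp add: scaleR_add_left add.assoc)
  then show ?thesis
    using DERIV_shift[of "\<lambda>t. f (x + t *\<^sub>R v)" "f' (x + t *\<^sub>R v)" 0 t] by (simp add: add.commute)
qed

lemma conf_map_inner:
  assumes "i \<in> Basis"
  shows "(conf_map A c s z - c) \<bullet> i = sqrt (A i + s) * (z \<bullet> i)"
  using assms by (simp add: conf_map_def inner_sum_left_Basis)

lemma conf_quad_conf_map:
  assumes "\<forall>i\<in>Basis. A i > 0" "s \<ge> 0"
  shows "conf_quad A c (conf_map A c s z) s = (norm z)\<^sup>2"
proof -
  have "conf_quad A c (conf_map A c s z) s = (\<Sum>i\<in>Basis. (z \<bullet> i)\<^sup>2)"
    unfolding conf_quad_def
  proof (rule sum.cong)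
    fix i :: 'a assume i: "i \<in> Basis"
    then have "A i + s > 0" using assms by (simp add: add_pos_nonneg)
    then show "((conf_map A c s z - c) \<bullet> i)\<^sup>2 / (A i + s) = (z \<bullet> i)\<^sup>2"
      using conf_map_inner[OF i, of A c s z] by (simp add: power_mult_distrib)
  qed simp
  also have "\<dots> = (norm z)\<^sup>2"
    unfolding power2_norm_eq_inner by (subst euclidean_inner) (simp add: power2_eq_square)
  finally show ?thesis .
qed

lemma continuous_on_conf_map[continuous_intros]:
  assumes "continuous_on S f" "continuous_on S g"
  shows "continuous_on S (\<lambda>x. conf_map A c (f x) (g x))"
  unfolding conf_map_def by (intro continuous_intros assms)

lemma conf_map_measurable[measurable]: "conf_map A c s \<in> borel_measurable borel"
  by (intro borel_measurable_continuous_onI continuous_intros)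

text \<open>The Jacobian of \<open>conf_map A c s\<close> is the product of the sqrt (A_i + s), that
  is, the reciprocal of the weight.\<close>

lemma integral_conf_map:
  fixes f :: "'a::euclidean_space \<Rightarrow> real"
  assumes "\<forall>i\<in>Basis. A i > 0" "s \<ge> 0" and [measurable]: "f \<in> borel_measurable borel"
  shows "(\<integral>z. f (conf_map A c s z) \<partial>lborel) = wt Basis A s * (\<integral>y. f y \<partial>lborel)"
proof -
  have pos: "A i + s > 0" if "i \<in> Basis" for i using assms that by (simp add: add_pos_nonneg)
  then have nz: "sqrt (A i + s) \<noteq> 0" if "i \<in> Basis" for i using that by force
  let ?T = "\<lambda>x. c + (\<Sum>j\<in>Basis. (sqrt (A j + s) * (x \<bullet> j)) *\<^sub>R j)"
  let ?d = "\<Prod>j\<in>Basis. \<bar>sqrt (A j + s)\<bar>"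
  have T: "?T = conf_map A c s" by (simp add: conf_map_def fun_eq_iff)
  have "(\<integral>y. f y \<partial>lborel) = (\<integral>y. f y \<partial>density (distr lborel borel ?T) (\<lambda>_. ?d))"
    using lborel_affine_euclidean[of "\<lambda>j. sqrt (A j + s)" c, OF nz] by simp
  also have "\<dots> = (\<integral>y. ?d *\<^sub>R f y \<partial>distr lborel borel ?T)"
    by (rule integral_density) (auto intro!: prod_nonneg)
  also have "\<dots> = (\<integral>z. ?d *\<^sub>R f (conf_map A c s z) \<partial>lborel)"
    unfolding T by (rule integral_distr) measurable
  also have "\<dots> = ?d * (\<integral>z. f (conf_map A c s z) \<partial>lborel)"
    by simp
  finally have "wt Basis A s * (\<integral>y. f y \<partial>lborel) = (wt Basis A s * ?d) * (\<integral>z. f (conf_map A c s z) \<partial>lborel)"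
    by simp
  moreover have "wt Basis A s * ?d = 1"
    unfolding wt_def prod.distrib[symmetric] using pos nz
    by (intro prod.neutral) (auto simp: less_imp_le)
  ultimately show ?thesis by simp
qed

lemma conf_map_path_derivative:
  assumes "C2_data \<phi> g h" "\<forall>i\<in>Basis. A i > 0" "s \<ge> 0"
  shows "((\<lambda>s. \<phi> (conf_map A c s z)) has_real_derivative
    (\<Sum>i\<in>Basis. (z \<bullet> i) / (2 * sqrt (A i + s)) * g i (conf_map A c s z))) (at s)"
proof -
  have pos: "A i + s > 0" if "i \<in> Basis" for i using assms that by (simp add: add_pos_nonneg)
  have "((\<lambda>s. conf_map A c s z) has_derivative
      (\<lambda>h. \<Sum>i\<in>Basis. (h * ((z \<bullet> i) / (2 * sqrt (A i + s)))) *\<^sub>R i)) (at s)"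
    unfolding conf_map_def
    using pos by (auto intro!: derivative_eq_intros sum.cong simp: field_simps)
  moreover have "(\<phi> has_derivative (\<lambda>v. \<Sum>j\<in>Basis. (v \<bullet> j) * g j (conf_map A c s z))) (at (conf_map A c s z))"
    using assms(1) unfolding C2_data_def by blast
  ultimately have "((\<lambda>s. \<phi> (conf_map A c s z)) has_derivative
      (\<lambda>h. \<Sum>j\<in>Basis. ((\<Sum>i\<in>Basis. (h * ((z \<bullet> i) / (2 * sqrt (A i + s)))) *\<^sub>R i) \<bullet> j) * g j (conf_map A c s z))) (at s)"
    by (rule has_derivative_compose)
  moreover have "(\<Sum>j\<in>Basis. ((\<Sum>i\<in>Basis. (h * ((z \<bullet> i) / (2 * sqrt (A i + s)))) *\<^sub>R i) \<bullet> j) * g j (conf_map A c s z))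
    = (\<Sum>i\<in>Basis. (z \<bullet> i) / (2 * sqrt (A i + s)) * g i (conf_map A c s z)) * h" for h
    unfolding sum_distrib_right by (intro sum.cong refl) (simp add: inner_sum_left_Basis)
  ultimately show ?thesis
    unfolding has_field_derivative_def by simp
qed

lemma integrable_rectangle:
  fixes K :: "real \<Rightarrow> 'a::euclidean_space \<Rightarrow> real"
  assumes "compact X" "compact Y" "continuous_on (X \<times> Y) (case_prod K)"
  shows "integrable (lborel \<Otimes>\<^sub>M lborel) (\<lambda>(s, z). indicator X s * (indicator Y z * K s z))"
proof -
  have "integrable lborel (\<lambda>p. indicator (X \<times> Y) p *\<^sub>R case_prod K p)"
    using assms by (intro borel_integrable_compact compact_Times)
  then show ?thesis
    unfolding lborel_prod
    by (rule back_subst[of "integrable lborel"]) (auto simp: fun_eq_iff indicator_def)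
qed

lemma conf_quad_measurable[measurable]:
  "(\<lambda>p. conf_quad A c (snd p) (fst p)) \<in> borel_measurable (borel \<Otimes>\<^sub>M borel)"
  "(\<lambda>x. conf_quad A c x s) \<in> borel_measurable borel"
  "(\<lambda>s. conf_quad A c x s) \<in> borel_measurable borel"
  unfolding conf_quad_def[abs_def] by measurable

text \<open>The left side is the s-derivative of the integral of \<phi> over the ball along the
  flow. Integrating by parts in z_i differentiates g_i along \<open>conf_map\<close>, which produces
  a factor sqrt (A_i + s); it cancels against the speed 1 / (2 sqrt (A_i + s)). The remaining
  coefficient 1/4 is the same for every i, so exactly the Laplacian appears: this is the effect of
  confocality. Undoing the substitution produces the weight.\<close>

lemma sphere_flux:
  assumes C2: "C2_data \<phi> g h" and A: "\<forall>i\<in>Basis. A i > 0" and s: "s \<ge> 0"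
  shows "(\<integral>z. indicator (cball 0 1) z * (\<Sum>i\<in>Basis. (z \<bullet> i) / (2 * sqrt (A i + s)) * g i (conf_map A c s z)) \<partial>lborel)
    = wt Basis A s / 4 * (\<integral>y. (\<Sum>i\<in>Basis. h i y) * max 0 (1 - conf_quad A c y s) \<partial>lborel)"
proof -
  have pos: "A i + s > 0" if "i \<in> Basis" for i using A s that by (simp add: add_pos_nonneg)
  have cg: "continuous_on UNIV (g i)" and ch: "continuous_on UNIV (h i)" if "i \<in> Basis" for i
    using C2 that unfolding C2_data_def by auto
  have hm[measurable]: "i \<in> Basis \<Longrightarrow> h i \<in> borel_measurable borel" for i
    using ch by (auto intro: borel_measurable_continuous_onI)
  have cgm: "continuous_on UNIV (\<lambda>z. g i (conf_map A c s z))" and chm: "continuous_on UNIV (\<lambda>z. h i (conf_map A c s z))"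
    if "i \<in> Basis" for i
    by (rule continuous_on_compose2[OF cg[OF that]] continuous_on_compose2[OF ch[OF that]];
        auto intro!: continuous_intros)+
  have int1: "integrable lborel (\<lambda>z. indicator (cball 0 1) z * ((z \<bullet> i) * g i (conf_map A c s z)))" if "i \<in> Basis" for i
  proof -
    have "continuous_on (cball 0 1) (\<lambda>z. (z \<bullet> i) * g i (conf_map A c s z))"
      by (intro continuous_intros continuous_on_subset[OF cgm[OF that]]) auto
    then show ?thesis
      using borel_integrable_compact[of "cball 0 1" "\<lambda>z. (z \<bullet> i) * g i (conf_map A c s z)"] by simp
  qed
  have int2: "integrable lborel (\<lambda>z. h i (conf_map A c s z) * max 0 (1 - (norm z)\<^sup>2))" if "i \<in> Basis" for i
    by (rule integrable_continuous_mult_bounded_support[OF chm[OF that], where R = 1 and M = 1])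
      (auto simp: one_le_power)
  have ibp: "(\<integral>z. h i (conf_map A c s z) * max 0 (1 - (norm z)\<^sup>2) \<partial>lborel)
      = 2 / sqrt (A i + s) * (\<integral>z. indicator (cball 0 1) z * ((z \<bullet> i) * g i (conf_map A c s z)) \<partial>lborel)"
    if i: "i \<in> Basis" for i
  proof -
    have "(\<integral>z. (sqrt (A i + s) * h i (conf_map A c s z)) * max 0 (1 - (norm z)\<^sup>2) \<partial>lborel)
      = 2 * (\<integral>z. indicator (cball 0 1) z * ((z \<bullet> i) * g i (conf_map A c s z)) \<partial>lborel)"
    proof (rule profile_integral_by_parts[OF cgm[OF i] _ i])
      show "continuous_on UNIV (\<lambda>z. sqrt (A i + s) * h i (conf_map A c s z))"
        by (intro continuous_intros chm i)
      fix x :: 'a and t :: real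
      show "((\<lambda>t. g i (conf_map A c s (x + t *\<^sub>R i))) has_real_derivative sqrt (A i + s) * h i (conf_map A c s (x + t *\<^sub>R i))) (at t)"
      proof (rule line_derivative_shift[where f = "\<lambda>x. g i (conf_map A c s x)" and f' = "\<lambda>x. sqrt (A i + s) * h i (conf_map A c s x)"])
        fix x :: 'a
        have e: "conf_map A c s (x + t *\<^sub>R i) = conf_map A c s x + (sqrt (A i + s) * t) *\<^sub>R i" for t
        proof (rule euclidean_eqI)
          fix b :: 'a assume b: "b \<in> Basis"
          show "conf_map A c s (x + t *\<^sub>R i) \<bullet> b = (conf_map A c s x + (sqrt (A i + s) * t) *\<^sub>R i) \<bullet> b"
            using conf_map_inner[OF b, of A c s "x + t *\<^sub>R i"] conf_map_inner[OF b, of A c s x] b i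
            by (cases "b = i") (auto simp: inner_diff_left inner_add_left inner_not_same_Basis distrib_left)
        qed
        have "((\<lambda>t. g i (conf_map A c s x + t *\<^sub>R i)) has_real_derivative h i (conf_map A c s x)) (at (sqrt (A i + s) * 0))"
          using C2 i unfolding C2_data_def by simp
        then have "((\<lambda>t. g i (conf_map A c s x + (sqrt (A i + s) * t) *\<^sub>R i)) has_real_derivative
            h i (conf_map A c s x) * sqrt (A i + s)) (at 0)"
          by (rule DERIV_chain2) (auto intro!: derivative_eq_intros)
        then show "((\<lambda>t. g i (conf_map A c s (x + t *\<^sub>R i))) has_real_derivative sqrt (A i + s) * h i (conf_map A c s x)) (at 0)"
          by (simp add: e mult.commute)
      qed
    qed
    then have "sqrt (A i + s) * (\<integral>z. h i (conf_map A c s z) * max 0 (1 - (norm z)\<^sup>2) \<partial>lborel)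
      = 2 * (\<integral>z. indicator (cball 0 1) z * ((z \<bullet> i) * g i (conf_map A c s z)) \<partial>lborel)"
      by (simp add: mult.assoc)
    then show ?thesis using pos[OF i] by (simp add: field_simps)
  qed
  have "(\<integral>z. indicator (cball 0 1) z * (\<Sum>i\<in>Basis. (z \<bullet> i) / (2 * sqrt (A i + s)) * g i (conf_map A c s z)) \<partial>lborel)
    = (\<integral>z. (\<Sum>i\<in>Basis. (1 / (2 * sqrt (A i + s))) * (indicator (cball 0 1) z * ((z \<bullet> i) * g i (conf_map A c s z)))) \<partial>lborel)"
    by (simp add: sum_distrib_left mult_ac)
  also have "\<dots> = (\<Sum>i\<in>Basis. (1 / (2 * sqrt (A i + s))) * (\<integral>z. indicator (cball 0 1) z * ((z \<bullet> i) * g i (conf_map A c s z)) \<partial>lborel))"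
    using int1 by (subst Bochner_Integration.integral_sum) auto
  also have "\<dots> = (\<Sum>i\<in>Basis. 1 / 4 * (\<integral>z. h i (conf_map A c s z) * max 0 (1 - (norm z)\<^sup>2) \<partial>lborel))"
    by (intro sum.cong) (auto simp: ibp)
  also have "\<dots> = 1 / 4 * (\<integral>z. (\<Sum>i\<in>Basis. h i (conf_map A c s z)) * max 0 (1 - (norm z)\<^sup>2) \<partial>lborel)"
    unfolding sum_distrib_right sum_distrib_left[symmetric]
    using int2 by (subst Bochner_Integration.integral_sum) auto
  also have "(\<integral>z. (\<Sum>i\<in>Basis. h i (conf_map A c s z)) * max 0 (1 - (norm z)\<^sup>2) \<partial>lborel)
     = wt Basis A s * (\<integral>y. (\<Sum>i\<in>Basis. h i y) * max 0 (1 - conf_quad A c y s) \<partial>lborel)"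
    using integral_conf_map[OF A s, where c = c and f = "\<lambda>y. (\<Sum>i\<in>Basis. h i y) * max 0 (1 - conf_quad A c y s)"]
    by (simp add: conf_quad_conf_map[OF A s])
  finally show ?thesis by simp
qed

text \<open>The fundamental theorem along each path \<open>s \<mapsto> conf_map A c s z\<close>
  turns the difference into a double integral, and Fubini applies because the integrand is
  continuous on the compact set [0, S] times the ball. The inner integral is then the flux
  above.\<close>

lemma conf_flow_difference:
  assumes C2: "C2_data \<phi> g h" and A: "\<forall>i\<in>Basis. A i > 0" and S: "S \<ge> 0"
  shows "(\<integral>z. indicator (cball 0 1) z * \<phi> (conf_map A c S z) \<partial>lborel) - (\<integral>z. indicator (cball 0 1) z * \<phi> (conf_map A c 0 z) \<partial>lborel)
    = (\<integral>s. indicator {0..S} s * (wt Basis A s / 4 * (\<integral>y. (\<Sum>i\<in>Basis. h i y) * max 0 (1 - conf_quad A c y s) \<partial>lborel)) \<partial>lborel)"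
proof -
  let ?K = "\<lambda>s z. \<Sum>i\<in>Basis. (z \<bullet> i) / (2 * sqrt (A i + s)) * g i (conf_map A c s z)"
  have c\<phi>: "continuous_on UNIV \<phi>" by (rule C2_data_continuous[OF C2])
  have cg: "continuous_on UNIV (g i)" if "i \<in> Basis" for i
    using C2 that unfolding C2_data_def by auto
  have cK: "continuous_on ({0..S} \<times> cball 0 1) (\<lambda>(s, z). ?K s z)"
    unfolding case_prod_unfold
  proof (intro continuous_intros)
    fix i :: 'a assume i: "i \<in> Basis"
    show "continuous_on ({0..S} \<times> cball 0 1) (\<lambda>x. g i (conf_map A c (fst x) (snd x)))"
      by (rule continuous_on_compose2[OF cg[OF i]]) (auto intro!: continuous_intros)
    show "\<forall>x\<in>{0..S} \<times> cball 0 1. 2 * sqrt (A i + fst x) \<noteq> 0"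
      using A[rule_format, OF i] by auto
  qed
  have I: "integrable (lborel \<Otimes>\<^sub>M lborel) (\<lambda>(s, z). indicator {0..S} s * (indicator (cball 0 1) z * ?K s z))"
    by (rule integrable_rectangle[OF _ _ cK]) auto
  have ftc: "(\<integral>s. indicator {0..S} s * ?K s z \<partial>lborel) = \<phi> (conf_map A c S z) - \<phi> (conf_map A c 0 z)" for z
  proof -
    have "(\<integral>s. ?K s z * indicator {0..S} s \<partial>lborel) = \<phi> (conf_map A c S z) - \<phi> (conf_map A c 0 z)"
    proof (rule integral_FTC_Icc_real[OF S])
      fix s assume s: "0 \<le> s" "s \<le> S"
      show "((\<lambda>s. \<phi> (conf_map A c s z)) has_real_derivative ?K s z) (at s)"
        by (rule conf_map_path_derivative[OF C2 A s(1)])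
      have "isCont (\<lambda>s. g i (conf_map A c s z)) s" if "i \<in> Basis" for i
      proof -
        have "continuous_on UNIV (\<lambda>s. g i (conf_map A c s z))"
          by (rule continuous_on_compose2[OF cg[OF that]]) (auto intro!: continuous_intros)
        then show ?thesis by (simp add: continuous_on_eq_continuous_at)
      qed
      moreover have "2 * sqrt (A i + s) \<noteq> 0" if "i \<in> Basis" for i
        using A[rule_format, OF that] s by auto
      ultimately show "isCont (\<lambda>s. ?K s z) s"
        by (intro continuous_intros) auto
    qed
    then show ?thesis by (simp add: mult.commute)
  qed
  have int: "integrable lborel (\<lambda>z. indicator (cball 0 1) z * \<phi> (conf_map A c s z))" for s
  proof -
    have "continuous_on (cball 0 1) (\<lambda>z. \<phi> (conf_map A c s z))"
      by (rule continuous_on_compose2[OF c\<phi>]) (auto intro!: continuous_intros)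
    then show ?thesis using borel_integrable_compact[of "cball 0 1" "\<lambda>z. \<phi> (conf_map A c s z)"] by simp
  qed
  have "(\<integral>z. indicator (cball 0 1) z * \<phi> (conf_map A c S z) \<partial>lborel) - (\<integral>z. indicator (cball 0 1) z * \<phi> (conf_map A c 0 z) \<partial>lborel)
    = (\<integral>z. indicator (cball 0 1) z * (\<phi> (conf_map A c S z) - \<phi> (conf_map A c 0 z)) \<partial>lborel)"
    using int by (subst Bochner_Integration.integral_diff[symmetric]) (auto simp: algebra_simps)
  also have "\<dots> = (\<integral>z. (\<integral>s. indicator {0..S} s * (indicator (cball 0 1) z * ?K s z) \<partial>lborel) \<partial>lborel)"
    unfolding ftc[symmetric] integral_mult_right_zero[symmetric] by (simp add: mult_ac)
  also have "\<dots> = (\<integral>s. (\<integral>z. indicator {0..S} s * (indicator (cball 0 1) z * ?K s z) \<partial>lborel) \<partial>lborel)"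
    by (rule lborel_pair.Fubini_integral[OF I])
  also have "\<dots> = (\<integral>s. indicator {0..S} s * (wt Basis A s / 4 * (\<integral>y. (\<Sum>i\<in>Basis. h i y) * max 0 (1 - conf_quad A c y s) \<partial>lborel)) \<partial>lborel)"
  proof (rule Bochner_Integration.integral_cong[OF refl])
    fix s :: real
    show "(\<integral>z. indicator {0..S} s * (indicator (cball 0 1) z * ?K s z) \<partial>lborel) =
      indicator {0..S} s * (wt Basis A s / 4 * (\<integral>y. (\<Sum>i\<in>Basis. h i y) * max 0 (1 - conf_quad A c y s) \<partial>lborel))"
      using sphere_flux[OF C2 A, where s = s and c = c] by (cases "s \<in> {0..S}") auto
  qed
  finally show ?thesis .
qed

section \<open>The candidate potential of an ellipsoid and its Green identity\<close>

lemma conf_quad_nonneg: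
  assumes "\<forall>i\<in>Basis. A i > 0" "s \<ge> 0"
  shows "conf_quad A c x s \<ge> 0"
  unfolding conf_quad_def using assms by (intro sum_nonneg divide_nonneg_nonneg) (auto simp: add_nonneg_nonneg less_imp_le)

lemma continuous_on_conf_quad[continuous_intros]:
  assumes "continuous_on S f"
  shows "continuous_on S (\<lambda>x. conf_quad A c (f x) s)"
proof -
  have "(\<lambda>x. conf_quad A c (f x) s) = (\<lambda>x. \<Sum>i\<in>Basis. inverse (A i + s) * ((f x - c) \<bullet> i)\<^sup>2)"
    by (simp add: conf_quad_def field_simps)
  then show ?thesis by (simp only:) (intro continuous_intros assms)
qed

lemma compact_ellip:
  assumes "\<forall>i\<in>Basis. A i > 0"
  shows "compact (ellip A c)"
proof -
  have "ellip A c \<subseteq> cball c (\<Sum>i\<in>Basis. sqrt (A i))"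
  proof
    fix x assume "x \<in> ellip A c"
    then have q: "(\<Sum>i\<in>Basis. ((x - c) \<bullet> i)\<^sup>2 / A i) \<le> 1"
      by (simp add: ellip_def conf_quad_def)
    have "\<bar>(x - c) \<bullet> i\<bar> \<le> sqrt (A i)" if i: "i \<in> Basis" for i
    proof -
      have "((x - c) \<bullet> i)\<^sup>2 / A i \<le> (\<Sum>i\<in>Basis. ((x - c) \<bullet> i)\<^sup>2 / A i)"
        using assms i by (intro member_le_sum) (auto simp: less_imp_le)
      with q have "((x - c) \<bullet> i)\<^sup>2 / A i \<le> 1" by linarith
      then have "((x - c) \<bullet> i)\<^sup>2 \<le> A i"
        using assms[rule_format, OF i] by (simp add: field_simps)
      then have "sqrt (((x - c) \<bullet> i)\<^sup>2) \<le> sqrt (A i)" by (rule real_sqrt_le_mono)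
      then show ?thesis by simp
    qed
    then have "norm (x - c) \<le> (\<Sum>i\<in>Basis. sqrt (A i))"
      by (intro order_trans[OF norm_le_l1] sum_mono)
    then show "x \<in> cball c (\<Sum>i\<in>Basis. sqrt (A i))" by (simp add: dist_norm norm_minus_commute)
  qed
  then have "bounded (ellip A c)" using bounded_cball bounded_subset by blast
  moreover have "closed (ellip A c)"
    unfolding ellip_def by (intro closed_Collect_le continuous_intros)
  ultimately show ?thesis by (simp add: compact_eq_bounded_closed)
qed

lemma ellip_measurable[measurable]: "ellip A c \<in> sets borel"
  unfolding ellip_def by measurable

lemma integrable_ell_pot_integrand:
  fixes A :: "'a::euclidean_space \<Rightarrow> real"
  assumes A: "\<forall>i\<in>Basis. A i > 0" and D: "DIM('a) \<ge> 3"
  shows "integrable lborel (\<lambda>s. indicator {0..} s * (wt Basis A s * max 0 (1 - conf_quad A c x s)))"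
proof (rule Bochner_Integration.integrable_bound[OF integrable_wt[of Basis A]])
  show "AE s in lborel. norm (indicator {0..} s * (wt Basis A s * max 0 (1 - conf_quad A c x s)))
      \<le> norm (indicator {0..} s * wt Basis A s)"
  proof (rule AE_I2)
    fix s :: real
    show "norm (indicator {0..} s * (wt Basis A s * max 0 (1 - conf_quad A c x s))) \<le> norm (indicator {0..} s * wt Basis A s)"
    proof (cases "s \<ge> 0")
      case True
      have "\<bar>wt Basis A s\<bar> * \<bar>max 0 (1 - conf_quad A c x s)\<bar> \<le> \<bar>wt Basis A s\<bar> * 1"
        using conf_quad_nonneg[OF A True, where c = c and x = x] by (intro mult_left_mono) auto
      then show ?thesis using True by (simp add: abs_mult)
    qed simp
  qed
qed (use A D in auto)

lemma ell_pot_nonneg: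
  assumes A: "\<forall>i\<in>Basis. A i > 0"
  shows "ell_pot A c x \<ge> 0"
  unfolding ell_pot_def using wt_pos[of Basis A] A
  by (intro divide_nonneg_nonneg integral_nonneg_AE AE_I2) (auto simp: indicator_def less_imp_le)

lemma ell_pot_le:
  fixes A :: "'a::euclidean_space \<Rightarrow> real"
  assumes A: "\<forall>i\<in>Basis. A i > 0" and D: "DIM('a) \<ge> 3"
  shows "ell_pot A c x \<le> (\<integral>s. indicator {0..} s * wt Basis A s \<partial>lborel) / (4 * wt Basis A 0)"
  unfolding ell_pot_def
proof (intro divide_right_mono integral_mono integrable_ell_pot_integrand assms integrable_wt)
  fix s :: real
  show "indicator {0..} s * (wt Basis A s * max 0 (1 - conf_quad A c x s)) \<le> indicator {0..} s * wt Basis A s"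
    using conf_quad_nonneg[OF A, where s = s and c = c and x = x] wt_pos[of Basis A s] A
    by (auto simp: indicator_def mult_le_cancel_left1)
qed (use wt_pos[of Basis A 0] A D in auto)

lemma continuous_on_ell_pot:
  fixes A :: "'a::euclidean_space \<Rightarrow> real"
  assumes A: "\<forall>i\<in>Basis. A i > 0" and D: "DIM('a) \<ge> 3"
  shows "continuous_on UNIV (ell_pot A c)"
  unfolding continuous_on_sequentially o_def
proof (intro allI ballI impI)
  fix y :: "nat \<Rightarrow> 'a" and x
  assume "(\<forall>n. y n \<in> UNIV) \<and> y \<longlonglongrightarrow> x"
  then have y: "y \<longlonglongrightarrow> x" by simp
  have "(\<lambda>n. \<integral>s. indicator {0..} s * (wt Basis A s * max 0 (1 - conf_quad A c (y n) s)) \<partial>lborel)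
     \<longlonglongrightarrow> (\<integral>s. indicator {0..} s * (wt Basis A s * max 0 (1 - conf_quad A c x s)) \<partial>lborel)"
  proof (rule integral_dominated_convergence[where w = "\<lambda>s. indicator {0..} s * wt Basis A s"])
    show "integrable lborel (\<lambda>s. indicator {0..} s * wt Basis A s)"
      using A D by (intro integrable_wt) auto
    show "AE s in lborel. (\<lambda>n. indicator {0..} s * (wt Basis A s * max 0 (1 - conf_quad A c (y n) s)))
        \<longlonglongrightarrow> indicator {0..} s * (wt Basis A s * max 0 (1 - conf_quad A c x s))"
    proof (rule AE_I2)
      fix s
      have "continuous_on UNIV (\<lambda>y. conf_quad A c y s)" by (intro continuous_intros)
      then have "(\<lambda>n. conf_quad A c (y n) s) \<longlonglongrightarrow> conf_quad A c x s"
        using y by (simp add: continuous_on_sequentially o_def)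
      then show "(\<lambda>n. indicator {0..} s * (wt Basis A s * max 0 (1 - conf_quad A c (y n) s)))
        \<longlonglongrightarrow> indicator {0..} s * (wt Basis A s * max 0 (1 - conf_quad A c x s))"
        by (intro tendsto_intros)
    qed
    fix n
    show "AE s in lborel. norm (indicator {0..} s * (wt Basis A s * max 0 (1 - conf_quad A c (y n) s))) \<le> indicator {0..} s * wt Basis A s"
    proof (rule AE_I2)
      fix s :: real
      show "norm (indicator {0..} s * (wt Basis A s * max 0 (1 - conf_quad A c (y n) s))) \<le> indicator {0..} s * wt Basis A s"
        using conf_quad_nonneg[OF A, where s = s and c = c and x = "y n"] wt_pos[of Basis A s] A
        by (auto simp: indicator_def mult_le_cancel_left1)
    qed
  qed measurable
  then show "(\<lambda>n. ell_pot A c (y n)) \<longlonglongrightarrow> ell_pot A c x"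
    unfolding ell_pot_def using wt_pos[of Basis A 0] A by (intro tendsto_intros) auto
qed

text \<open>Every coordinate of z is stretched by at least sqrt n, so every path except the one at
  the centre escapes. A function that vanishes at infinity is therefore lost in the limit of the
  flow.\<close>

lemma conf_map_at_infinity:
  fixes z :: "'a::euclidean_space"
  assumes A: "\<forall>i\<in>Basis. A i > 0" and "z \<noteq> 0"
  shows "filterlim (\<lambda>n. conf_map A c (real n) z) at_infinity sequentially"
proof -
  obtain i where i: "i \<in> Basis" "z \<bullet> i \<noteq> 0"
    using assms(2) euclidean_all_zero_iff by blast
  have "filterlim (\<lambda>n. sqrt (real n) * \<bar>z \<bullet> i\<bar> + (- norm c)) at_top sequentially"
    using i(2) by (intro filterlim_at_top_add_at_top tendsto_const filterlim_tendsto_add_at_top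
      filterlim_at_top_mult_tendsto_pos filterlim_compose[OF sqrt_at_top filterlim_real_sequentially]
      filterlim_tendsto_add_at_top[OF tendsto_const, of _ _ "- norm c", simplified add.commute]) auto
  then have "filterlim (\<lambda>n. norm (conf_map A c (real n) z)) at_top sequentially"
  proof (rule filterlim_at_top_mono, intro always_eventually allI)
    fix n
    have "sqrt (real n) * \<bar>z \<bullet> i\<bar> \<le> sqrt (A i + real n) * \<bar>z \<bullet> i\<bar>"
      using A[rule_format, OF i(1)] by (intro mult_right_mono) auto
    also have "\<dots> = \<bar>(conf_map A c (real n) z - c) \<bullet> i\<bar>"
      using A[rule_format, OF i(1)] by (simp add: conf_map_inner[OF i(1)] abs_mult)
    also have "\<dots> \<le> norm (conf_map A c (real n) z - c)"
      by (rule Basis_le_norm[OF i(1)])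
    also have "\<dots> \<le> norm (conf_map A c (real n) z) + norm c" by (rule norm_triangle_ineq4)
    finally show "sqrt (real n) * \<bar>z \<bullet> i\<bar> + (- norm c) \<le> norm (conf_map A c (real n) z)" by simp
  qed
  then show ?thesis by (simp add: filterlim_at_infinity_conv_norm_at_top)
qed

lemma integrable_product_mult:
  fixes f :: "real \<Rightarrow> real" and k :: "'a::euclidean_space \<Rightarrow> real"
  assumes f: "integrable lborel f" and k: "integrable lborel k"
  shows "integrable (lborel \<Otimes>\<^sub>M lborel) (\<lambda>(s, y). f s * k y)"
proof (rule lborel_pair.Fubini_integrable)
  have [measurable]: "f \<in> borel_measurable borel" "k \<in> borel_measurable borel"
    using f k by auto
  show "(\<lambda>(s, y). f s * k y) \<in> borel_measurable (lborel \<Otimes>\<^sub>M lborel)"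
    by measurable
  have "(\<lambda>x. \<integral>y. norm (case (x, y) of (s, y) \<Rightarrow> f s * k y) \<partial>lborel) = (\<lambda>x. \<bar>f x\<bar> * (\<integral>y. \<bar>k y\<bar> \<partial>lborel))"
    by (simp add: abs_mult)
  then show "integrable lborel (\<lambda>x. \<integral>y. norm (case (x, y) of (s, y) \<Rightarrow> f s * k y) \<partial>lborel)"
    using f by simp
  show "AE x in lborel. integrable lborel (\<lambda>y. case (x, y) of (s, y) \<Rightarrow> f s * k y)"
    using k by simp
qed

text \<open>The limit of the flow as S tends to infinity: the end term vanishes by decay of \<phi>,
  the initial term is w(0) times the integral over the ellipsoid, and Fubini collects the flux into
  \<open>ell_pot\<close>. Compact support is not demanded, because the regularised Newton kernels
  lack it; an integrable Laplacian takes its place.\<close>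

lemma ellipsoid_green:
  fixes A :: "'a::euclidean_space \<Rightarrow> real"
  assumes C2: "C2_data \<phi> g h" and A: "\<forall>i\<in>Basis. A i > 0" and D: "DIM('a) \<ge> 3"
    and bdd: "\<And>x. \<bar>\<phi> x\<bar> \<le> M" and lim: "(\<phi> \<longlongrightarrow> 0) at_infinity"
    and int: "integrable lborel (\<lambda>x. \<Sum>i\<in>Basis. h i x)"
  shows "(\<integral>y. indicator (ellip A c) y * \<phi> y \<partial>lborel) = - (\<integral>y. (\<Sum>i\<in>Basis. h i y) * ell_pot A c y \<partial>lborel)"
proof -
  define L where "L y = (\<Sum>i\<in>Basis. h i y)" for y
  have intL: "integrable lborel L" using int by (simp add: L_def[abs_def])
  have [measurable]: "\<phi> \<in> borel_measurable borel" "L \<in> borel_measurable borel"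
    using C2_data_continuous[OF C2] intL by (auto intro: borel_measurable_continuous_onI)
  have [measurable]: "cball (0::'a) 1 \<in> sets borel" by simp
  let ?m = "\<lambda>s y. max 0 (1 - conf_quad A c y s)"
  let ?\<Phi> = "\<lambda>s y. indicator {0..} s * wt Basis A s * (L y * ?m s y)"
  have I: "integrable (lborel \<Otimes>\<^sub>M lborel) (\<lambda>(s, y). ?\<Phi> s y)"
  proof (rule Bochner_Integration.integrable_bound[OF integrable_product_mult[OF integrable_wt[of Basis A] intL]])
    show "AE p in lborel \<Otimes>\<^sub>M lborel. norm (case p of (s, y) \<Rightarrow> ?\<Phi> s y) \<le> norm (case p of (s, y) \<Rightarrow> indicator {0..} s * wt Basis A s * L y)"
    proof (rule AE_I2, clarsimp)
      fix s :: real and y :: 'a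
      show "\<bar>indicator {0..} s * wt Basis A s * (L y * ?m s y)\<bar> \<le> \<bar>indicator {0..} s * wt Basis A s * L y\<bar>"
      proof (cases "s \<ge> 0")
        case True
        have "\<bar>indicator {0..} s * wt Basis A s * L y\<bar> * \<bar>?m s y\<bar> \<le> \<bar>indicator {0..} s * wt Basis A s * L y\<bar> * 1"
          using conf_quad_nonneg[OF A True, where c = c and x = y] by (intro mult_left_mono) auto
        then show ?thesis by (simp add: abs_mult mult_ac)
      qed simp
    qed
    show "(\<lambda>(s, y). ?\<Phi> s y) \<in> borel_measurable (lborel \<Otimes>\<^sub>M lborel)"
      unfolding case_prod_unfold by measurable
  qed (use A D in auto)
  define J where "J s = indicator {0..} s * (wt Basis A s / 4 * (\<integral>y. L y * ?m s y \<partial>lborel))" for s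
  have J: "J s = 1 / 4 * (\<integral>y. ?\<Phi> s y \<partial>lborel)" for s
    unfolding J_def by simp
  have intJ: "integrable lborel J"
    unfolding J[abs_def] using lborel_pair.integrable_fst[OF I] by simp
  have [measurable]: "J \<in> borel_measurable borel" using intJ by auto
  have limJ: "(\<lambda>n. \<integral>s. indicator {0..real n} s * J s \<partial>lborel) \<longlonglongrightarrow> (\<integral>s. J s \<partial>lborel)"
  proof (rule integral_dominated_convergence[where w = "\<lambda>s. \<bar>J s\<bar>"])
    show "AE s in lborel. (\<lambda>n. indicator {0..real n} s * J s) \<longlonglongrightarrow> J s"
    proof (rule AE_I2)
      fix s
      show "(\<lambda>n. indicator {0..real n} s * J s) \<longlonglongrightarrow> J s"
      proof (cases "s \<ge> 0")
        case True
        obtain N where N: "s \<le> real N" using real_arch_simple by blast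
        have "eventually (\<lambda>n. indicator {0..real n} s * J s = J s) sequentially"
          using eventually_ge_at_top[of N]
        proof eventually_elim
          case (elim n)
          then have "s \<le> real n" using N by linarith
          then show ?case using True by simp
        qed
        then show ?thesis by (rule tendsto_eventually)
      qed (simp add: J_def)
    qed
  qed (use intJ in \<open>auto simp: indicator_def\<close>)
  have limF: "(\<lambda>n. \<integral>z. indicator (cball 0 1) z * \<phi> (conf_map A c (real n) z) \<partial>lborel) \<longlonglongrightarrow> (\<integral>z. (0::real) \<partial>(lborel :: 'a measure))"
  proof (rule integral_dominated_convergence[where w = "\<lambda>z. M * indicator (cball 0 1) z"])
    show "integrable lborel (\<lambda>z::'a. M * indicator (cball 0 1) z)"
      by (intro integrable_mult_right integrable_real_indicator) (use emeasure_lborel_cball_finite[of "0::'a" 1] in auto)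
    \<comment> \<open>The point z = 0 stays at the centre c for all s, hence the exceptional null
      set.\<close>
    show "AE z in lborel. (\<lambda>n. indicator (cball 0 1) z * \<phi> (conf_map A c (real n) z)) \<longlonglongrightarrow> 0"
      using AE_lborel_singleton[of "0::'a"]
    proof eventually_elim
      fix z :: 'a assume "z \<noteq> 0"
      then have "(\<lambda>n. \<phi> (conf_map A c (real n) z)) \<longlonglongrightarrow> 0"
        using filterlim_compose[OF lim conf_map_at_infinity[OF A]] by blast
      then show "(\<lambda>n. indicator (cball 0 1) z * \<phi> (conf_map A c (real n) z)) \<longlonglongrightarrow> 0"
        by (rule tendsto_mult_right_zero)
    qed
    show "AE z in lborel. norm (indicator (cball 0 1) z * \<phi> (conf_map A c (real n) z)) \<le> M * indicator (cball 0 1) z" for n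
      using bdd by (auto simp: indicator_def)
  qed measurable
  have F0: "(\<integral>z. indicator (cball 0 1) z * \<phi> (conf_map A c 0 z) \<partial>lborel) = wt Basis A 0 * (\<integral>y. indicator (ellip A c) y * \<phi> y \<partial>lborel)"
  proof -
    have "indicator (ellip A c) (conf_map A c 0 z) = (indicator (cball 0 1) z :: real)" for z
    proof -
      have "norm z ^ 2 \<le> 1 \<longleftrightarrow> norm z \<le> 1" by (simp add: abs_square_le_1)
      then show ?thesis
        using conf_quad_conf_map[OF A, where s = 0 and c = c and z = z] by (auto simp: ellip_def indicator_def)
    qed
    then show ?thesis
      using integral_conf_map[OF A, where s = 0 and c = c and f = "\<lambda>y. indicator (ellip A c) y * \<phi> y"] by simp
  qed
  have "(\<lambda>n. \<integral>s. indicator {0..real n} s * J s \<partial>lborel) \<longlonglongrightarrow> 0 - wt Basis A 0 * (\<integral>y. indicator (ellip A c) y * \<phi> y \<partial>lborel)"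
  proof -
    have "(\<integral>s. indicator {0..real n} s * J s \<partial>lborel) = (\<integral>z. indicator (cball 0 1) z * \<phi> (conf_map A c (real n) z) \<partial>lborel)
       - wt Basis A 0 * (\<integral>y. indicator (ellip A c) y * \<phi> y \<partial>lborel)" for n
      using conf_flow_difference[OF C2 A, where S = "real n" and c = c] unfolding F0 L_def[symmetric]
      by (auto simp: J_def indicator_def intro!: Bochner_Integration.integral_cong)
    then show ?thesis
      using tendsto_diff[OF limF tendsto_const[of "wt Basis A 0 * (\<integral>y. indicator (ellip A c) y * \<phi> y \<partial>lborel)"]] by simp
  qed
  with limJ have e1: "(\<integral>s. J s \<partial>lborel) = 0 - wt Basis A 0 * (\<integral>y. indicator (ellip A c) y * \<phi> y \<partial>lborel)"
    by (rule LIMSEQ_unique)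
  have inner: "(\<integral>s. ?\<Phi> s y \<partial>lborel) = 4 * wt Basis A 0 * (L y * ell_pot A c y)" for y
  proof -
    have "(\<integral>s. ?\<Phi> s y \<partial>lborel) = (\<integral>s. L y * (indicator {0..} s * (wt Basis A s * ?m s y)) \<partial>lborel)"
      by (simp add: mult_ac)
    then show ?thesis unfolding ell_pot_def using wt_pos[of Basis A 0] A by simp
  qed
  have "(\<integral>s. J s \<partial>lborel) = 1 / 4 * (\<integral>s. (\<integral>y. ?\<Phi> s y \<partial>lborel) \<partial>lborel)"
    unfolding J by (rule integral_mult_right_zero)
  also have "(\<integral>s. (\<integral>y. ?\<Phi> s y \<partial>lborel) \<partial>lborel) = (\<integral>y. (\<integral>s. ?\<Phi> s y \<partial>lborel) \<partial>lborel)"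
    by (rule lborel_pair.Fubini_integral[OF I, symmetric])
  also have "\<dots> = 4 * wt Basis A 0 * (\<integral>y. L y * ell_pot A c y \<partial>lborel)"
    unfolding inner by (rule integral_mult_right_zero)
  finally have "wt Basis A 0 * (\<integral>y. indicator (ellip A c) y * \<phi> y \<partial>lborel) = wt Basis A 0 * - (\<integral>y. L y * ell_pot A c y \<partial>lborel)"
    using e1 by linarith
  moreover have "wt Basis A 0 \<noteq> 0" using wt_pos[of Basis A 0] A by simp
  ultimately show ?thesis unfolding L_def[symmetric] by (simp only: mult_cancel_left simp_thms)
qed

section \<open>The regularised Newton kernel\<close>

text \<open>The parameter \<open>e\<close> is the \<epsilon>^2 of the overview: this is the square
  of the regularised distance.\<close>

definition smooth_dist :: "real \<Rightarrow> 'a::euclidean_space \<Rightarrow> 'a \<Rightarrow> real" where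
  "smooth_dist e x y = e + (y - x) \<bullet> (y - x)"

lemma smooth_dist_pos: "e > 0 \<Longrightarrow> smooth_dist e x y > 0"
  by (simp add: smooth_dist_def add_pos_nonneg)

lemma continuous_on_smooth_dist[continuous_intros]:
  "continuous_on S f \<Longrightarrow> continuous_on S (\<lambda>z. smooth_dist e x (f z))"
  unfolding smooth_dist_def by (intro continuous_intros)

lemma smooth_dist_measurable[measurable]: "smooth_dist e x \<in> borel_measurable borel"
  by (intro borel_measurable_continuous_onI continuous_intros)

lemma C2_data_smooth_kernel:
  fixes x :: "'a::euclidean_space"
  assumes e: "e > 0"
  defines "m \<equiv> real DIM('a)"
  shows "C2_data (\<lambda>y. smooth_dist e x y powr ((2 - m) / 2))
    (\<lambda>i y. (2 - m) * ((y - x) \<bullet> i) * smooth_dist e x y powr (- m / 2))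
    (\<lambda>i y. (2 - m) * smooth_dist e x y powr (- m / 2) - (2 - m) * m * ((y - x) \<bullet> i)\<^sup>2 * smooth_dist e x y powr (- m / 2 - 1))"
  unfolding C2_data_def
proof (intro conjI allI ballI)
  fix y :: 'a
  note pos = smooth_dist_pos[OF e, of x]
  have m1: "(2 - m) / 2 - 1 = - m / 2" by (simp add: field_simps)
  have d: "(smooth_dist e x has_derivative (\<lambda>v. 2 * (v \<bullet> (y - x)))) (at y)"
    unfolding smooth_dist_def[abs_def]
    by (auto intro!: derivative_eq_intros simp: inner_commute)
  have "((\<lambda>r. r powr ((2 - m) / 2)) has_derivative (*) ((2 - m) / 2 * smooth_dist e x y powr (- m / 2))) (at (smooth_dist e x y))"
    using has_real_derivative_powr[OF pos[of y], of "(2 - m) / 2"] unfolding m1 has_field_derivative_def .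
  from has_derivative_compose[OF d this]
  have "((\<lambda>y. smooth_dist e x y powr ((2 - m) / 2)) has_derivative
      (\<lambda>v. (2 - m) / 2 * smooth_dist e x y powr (- m / 2) * (2 * (v \<bullet> (y - x))))) (at y)" .
  moreover have "(2 - m) / 2 * smooth_dist e x y powr (- m / 2) * (2 * (v \<bullet> (y - x)))
     = (\<Sum>i\<in>Basis. (v \<bullet> i) * ((2 - m) * ((y - x) \<bullet> i) * smooth_dist e x y powr (- m / 2)))" for v
    by (subst euclidean_inner[of v]) (simp add: sum_distrib_left mult_ac)
  ultimately show "((\<lambda>y. smooth_dist e x y powr ((2 - m) / 2)) has_derivative
      (\<lambda>v. \<Sum>i\<in>Basis. (v \<bullet> i) * ((2 - m) * ((y - x) \<bullet> i) * smooth_dist e x y powr (- m / 2)))) (at y)"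
    by simp
next
  note pos = smooth_dist_pos[OF e, of x]
  have nz: "\<forall>y\<in>UNIV. smooth_dist e x y \<noteq> 0" using pos by (metis less_irrefl)
  fix i :: 'a assume i: "i \<in> Basis"
  show "continuous_on UNIV (\<lambda>y. (2 - m) * ((y - x) \<bullet> i) * smooth_dist e x y powr (- m / 2))"
    "continuous_on UNIV (\<lambda>y. (2 - m) * smooth_dist e x y powr (- m / 2) - (2 - m) * m * ((y - x) \<bullet> i)\<^sup>2 * smooth_dist e x y powr (- m / 2 - 1))"
    using nz by (auto intro!: continuous_intros)
  fix y :: 'a
  have q: "smooth_dist e x (y + t *\<^sub>R i) = smooth_dist e x y + 2 * t * ((y - x) \<bullet> i) + t\<^sup>2" for t
    using i by (simp add: smooth_dist_def algebra_simps inner_add_left inner_add_right inner_diff_left inner_diff_right inner_commute power2_eq_square)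
  have dq: "((\<lambda>t. smooth_dist e x (y + t *\<^sub>R i)) has_real_derivative 2 * ((y - x) \<bullet> i)) (at 0)"
    unfolding q by (auto intro!: derivative_eq_intros)
  have d1: "((\<lambda>t. smooth_dist e x (y + t *\<^sub>R i) powr (- m / 2)) has_real_derivative
      (- m / 2 * smooth_dist e x y powr (- m / 2 - 1)) * (2 * ((y - x) \<bullet> i))) (at 0)"
    using has_real_derivative_powr[OF pos[of y], of "- m / 2"]
    by (intro DERIV_chain2[OF _ dq]) simp
  have d2: "((\<lambda>t. (y + t *\<^sub>R i - x) \<bullet> i) has_real_derivative 1) (at 0)"
    using i by (auto intro!: derivative_eq_intros simp: inner_diff_left inner_add_left)
  have alg: "(2 - m) * 1 * P + (- m / 2 * Q * (2 * a)) * ((2 - m) * a) = (2 - m) * P - (2 - m) * m * a\<^sup>2 * Q" for a P Q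
    by (simp add: power2_eq_square field_simps)
  show "((\<lambda>t. (2 - m) * ((y + t *\<^sub>R i - x) \<bullet> i) * smooth_dist e x (y + t *\<^sub>R i) powr (- m / 2)) has_real_derivative
      (2 - m) * smooth_dist e x y powr (- m / 2) - (2 - m) * m * ((y - x) \<bullet> i)\<^sup>2 * smooth_dist e x y powr (- m / 2 - 1)) (at 0)"
    by (rule DERIV_cong[OF DERIV_mult[OF DERIV_cmult[OF d2, of "2 - m"] d1]])
      (use alg in simp)
qed

text \<open>With r = \<open>smooth_dist e x y\<close>, the squared coordinates add up to r - e. The
  terms proportional to r cancel because (2 - m)/2 is the harmonic exponent, and only the term with
  e survives.\<close>

lemma smooth_kernel_laplacian:
  fixes x y :: "'a::euclidean_space"
  assumes e: "e > 0"
  defines "m \<equiv> real DIM('a)"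
  shows "(\<Sum>i\<in>Basis. (2 - m) * smooth_dist e x y powr (- m / 2) - (2 - m) * m * ((y - x) \<bullet> i)\<^sup>2 * smooth_dist e x y powr (- m / 2 - 1))
    = - (m * (m - 2)) * (e * smooth_dist e x y powr (- m / 2 - 1))"
proof -
  let ?r = "smooth_dist e x y" and ?p = "smooth_dist e x y powr (- m / 2 - 1)"
  have r: "?r powr (- m / 2) = ?r * ?p"
    using smooth_dist_pos[OF e, of x y] by (simp add: powr_diff)
  have "(\<Sum>i\<in>Basis. ((y - x) \<bullet> i)\<^sup>2) = ?r - e"
    unfolding smooth_dist_def by (subst euclidean_inner) (simp add: power2_eq_square)
  moreover have "(\<Sum>i\<in>Basis. (2 - m) * (?r * ?p) - (2 - m) * m * ((y - x) \<bullet> i)\<^sup>2 * ?p)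
    = m * ((2 - m) * (?r * ?p)) - (2 - m) * m * ?p * (\<Sum>i\<in>Basis. ((y - x) \<bullet> i)\<^sup>2)"
    unfolding sum_subtractf by (subst sum_distrib_left) (simp add: mult_ac m_def)
  ultimately have "(\<Sum>i\<in>Basis. (2 - m) * (?r * ?p) - (2 - m) * m * ((y - x) \<bullet> i)\<^sup>2 * ?p)
    = m * ((2 - m) * (?r * ?p)) - (2 - m) * m * ?p * (?r - e)"
    by (simp only:)
  also have "\<dots> = - (m * (m - 2)) * (e * ?p)"
    by (simp add: algebra_simps)
  finally show ?thesis unfolding r .
qed

text \<open>A layer-cake representation: it writes the radial kernel as a superposition of
  indicators of balls, whose volumes are known.\<close>

lemma radial_tail:
  assumes "\<rho> \<ge> 0" "p > 0"
  shows "(\<integral>\<^sup>+r. ennreal (2 * p * r * (1 + r\<^sup>2) powr (- p - 1)) * indicator {\<rho>..} r \<partial>lborel) = ennreal ((1 + \<rho>\<^sup>2) powr (- p))"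
proof -
  have "(\<integral>\<^sup>+r. ennreal (2 * p * r * (1 + r\<^sup>2) powr (- p - 1)) * indicator {\<rho>..} r \<partial>lborel) = ennreal (0 - (- ((1 + \<rho>\<^sup>2) powr (- p))))"
  proof (rule nn_integral_FTC_atLeast[where F = "\<lambda>r. - ((1 + r\<^sup>2) powr (- p))"])
    show "((\<lambda>r. - ((1 + r\<^sup>2) powr (- p))) \<longlongrightarrow> 0) at_top"
      using assms(2) by real_asymp
    fix r assume "\<rho> \<le> r"
    then show "0 \<le> 2 * p * r * (1 + r\<^sup>2) powr (- p - 1)" using assms by simp
    have "1 + r\<^sup>2 > 0" by (simp add: add_pos_nonneg)
    then show "((\<lambda>r. - ((1 + r\<^sup>2) powr (- p))) has_real_derivative 2 * p * r * (1 + r\<^sup>2) powr (- p - 1)) (at r)"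
      by (auto intro!: derivative_eq_intros simp: powr_diff field_simps)
  qed measurable
  then show ?thesis by simp
qed

text \<open>The antiderivative is (r^2 / (1 + r^2)) powr (m/2 + 1), written as a product; it rises
  from 0 to 1.\<close>

lemma radial_moment:
  assumes m: "m = real n" "n \<ge> 1"
  shows "(\<integral>\<^sup>+r. ennreal ((m + 2) * r * (1 + r\<^sup>2) powr (- (m / 2 + 1) - 1) * r ^ n) * indicator {0..} r \<partial>lborel) = 1"
proof -
  let ?p = "m / 2 + 1"
  have "(\<integral>\<^sup>+r. ennreal ((m + 2) * r * (1 + r\<^sup>2) powr (- ?p - 1) * r ^ n) * indicator {0..} r \<partial>lborel)
    = ennreal (1 - (0 ^ (n + 2) * (1 + 0\<^sup>2) powr (- ?p)))"
  proof (rule nn_integral_FTC_atLeast[where F = "\<lambda>r. r ^ (n + 2) * (1 + r\<^sup>2) powr (- ?p)" and a = 0])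
    have "((\<lambda>r::real. r\<^sup>2 / (1 + r\<^sup>2)) \<longlongrightarrow> 1) at_top" by real_asymp
    then have "((\<lambda>r::real. (r\<^sup>2 / (1 + r\<^sup>2)) powr ?p) \<longlongrightarrow> 1 powr ?p) at_top"
      by (intro tendsto_powr) auto
    then have l: "((\<lambda>r::real. (r\<^sup>2 / (1 + r\<^sup>2)) powr ?p) \<longlongrightarrow> 1) at_top" by simp
    have ev: "eventually (\<lambda>r::real. (r\<^sup>2 / (1 + r\<^sup>2)) powr ?p = r ^ (n + 2) * (1 + r\<^sup>2) powr (- ?p)) at_top"
      using eventually_gt_at_top[of 0]
    proof eventually_elim
      fix r :: real assume r: "r > 0"
      have "(r\<^sup>2) powr ?p = (r powr 2) powr ?p" using r by simp
      also have "\<dots> = r powr (real (n + 2))" using m by (simp add: powr_powr add.commute)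
      also have "\<dots> = r ^ (n + 2)" using r by (rule powr_realpow)
      finally have "(r\<^sup>2) powr ?p = r ^ (n + 2)" .
      then show "(r\<^sup>2 / (1 + r\<^sup>2)) powr ?p = r ^ (n + 2) * (1 + r\<^sup>2) powr (- ?p)"
        by (simp add: powr_divide powr_minus field_simps)
    qed
    show "((\<lambda>r. r ^ (n + 2) * (1 + r\<^sup>2) powr (- ?p)) \<longlongrightarrow> 1) at_top"
      by (rule Lim_transform_eventually[OF l ev])
    fix r :: real assume r: "0 \<le> r"
    then show "0 \<le> (m + 2) * r * (1 + r\<^sup>2) powr (- ?p - 1) * r ^ n" using m by simp
    have pos: "1 + r\<^sup>2 > 0" by (simp add: add_pos_nonneg)
    have e: "(1 + r\<^sup>2) powr (- ?p) = (1 + r\<^sup>2) * (1 + r\<^sup>2) powr (- ?p - 1)"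
    proof -
      have "1 + (- ?p - 1) = - ?p" by simp
      then show ?thesis using powr_mult_base[of "1 + r\<^sup>2" "- ?p - 1"] pos by (simp only: less_imp_le)
    qed
    have "((\<lambda>r. r ^ (n + 2) * (1 + r\<^sup>2) powr (- ?p)) has_real_derivative
       (m + 2) * r ^ (n + 1) * (1 + r\<^sup>2) powr (- ?p) + r ^ (n + 2) * (- ?p * (1 + r\<^sup>2) powr (- ?p - 1) * (2 * r))) (at r)"
    proof -
      have "((\<lambda>r. r ^ (n + 2)) has_real_derivative (m + 2) * r ^ (n + 1)) (at r)"
        using DERIV_pow[of "n + 2" r] m by (simp add: add.commute)
      moreover have "((\<lambda>r. 1 + r\<^sup>2) has_real_derivative 2 * r) (at r)"
        by (auto intro!: derivative_eq_intros)
      then have "((\<lambda>r. (1 + r\<^sup>2) powr (- ?p)) has_real_derivative - ?p * (1 + r\<^sup>2) powr (- ?p - 1) * (2 * r)) (at r)"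
        by (rule DERIV_chain2[where f = "\<lambda>z. z powr (- ?p)" and g = "\<lambda>r. 1 + r\<^sup>2" and x = r, OF has_real_derivative_powr[OF pos]])
      ultimately show ?thesis
        by (rule DERIV_cong[OF DERIV_mult]) simp
    qed
    moreover have "(m + 2) * r ^ (n + 1) * (1 + r\<^sup>2) powr (- ?p) + r ^ (n + 2) * (- ?p * (1 + r\<^sup>2) powr (- ?p - 1) * (2 * r))
      = (m + 2) * r * (1 + r\<^sup>2) powr (- ?p - 1) * r ^ n"
      unfolding e by (simp add: field_simps power2_eq_square)
    ultimately show "((\<lambda>r. r ^ (n + 2) * (1 + r\<^sup>2) powr (- ?p)) has_real_derivative
       (m + 2) * r * (1 + r\<^sup>2) powr (- ?p - 1) * r ^ n) (at r)" by simp
  qed measurable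
  then show ?thesis by simp
qed

text \<open>By the layer-cake formula and Tonelli the integral becomes one of ball volumes
  \<open>unit_ball_vol m * r ^ m\<close> over r, which \<open>radial_moment\<close> evaluates. The
  resulting mass is the ball volume in the denominator of \<open>newton_alpha\<close>.\<close>

lemma nn_integral_kernel:
  "(\<integral>\<^sup>+u. ennreal (smooth_dist 1 0 u powr (- (real DIM('a) / 2 + 1))) \<partial>(lborel :: 'a measure))
    = ennreal (unit_ball_vol (real DIM('a::euclidean_space)))"
proof -
  let ?m = "real DIM('a)"
  let ?p = "?m / 2 + 1"
  let ?f = "\<lambda>r. ennreal ((?m + 2) * r * (1 + r\<^sup>2) powr (- ?p - 1))"
  have p: "2 * ?p = ?m + 2" by simp
  have [measurable]: "(\<lambda>p::'a \<times> real. indicator {norm (fst p)..} (snd p) :: ennreal) \<in> borel_measurable (borel \<Otimes>\<^sub>M (borel :: real measure))"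
  proof -
    have "(\<lambda>p::'a \<times> real. indicator {norm (fst p)..} (snd p) :: ennreal) = indicator {p. norm (fst p) \<le> snd p}"
      by (auto simp: indicator_def fun_eq_iff)
    then show ?thesis by (simp only:) measurable
  qed
  have "(\<integral>\<^sup>+u. ennreal (smooth_dist 1 0 u powr (- ?p)) \<partial>(lborel :: 'a measure))
    = (\<integral>\<^sup>+u. (\<integral>\<^sup>+r. ?f r * indicator {norm u..} r \<partial>lborel) \<partial>(lborel :: 'a measure))"
  proof (rule nn_integral_cong)
    fix u :: 'a
    have "smooth_dist 1 0 u = 1 + (norm u)\<^sup>2" by (simp add: smooth_dist_def power2_norm_eq_inner)
    moreover have "?p > 0" by (simp add: add_nonneg_pos)
    ultimately show "ennreal (smooth_dist 1 0 u powr (- ?p)) = (\<integral>\<^sup>+r. ?f r * indicator {norm u..} r \<partial>lborel)"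
      using radial_tail[OF norm_ge_zero[of u], of ?p] by (simp only: p)
  qed
  also have "\<dots> = (\<integral>\<^sup>+r. (\<integral>\<^sup>+u. ?f r * indicator {norm u..} r \<partial>(lborel :: 'a measure)) \<partial>lborel)"
    by (rule lborel_pair.Fubini'[symmetric]) measurable
  also have "\<dots> = (\<integral>\<^sup>+r. ennreal (unit_ball_vol ?m) * (ennreal ((?m + 2) * r * (1 + r\<^sup>2) powr (- ?p - 1) * r ^ DIM('a)) * indicator {0..} r) \<partial>lborel)"
  proof (rule nn_integral_cong)
    fix r :: real
    have i: "indicator {norm u..} r = (indicator (cball 0 r) u :: ennreal)" for u :: 'a
      by (simp add: indicator_def)
    show "(\<integral>\<^sup>+u. ?f r * indicator {norm u..} r \<partial>(lborel :: 'a measure)) =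
      ennreal (unit_ball_vol ?m) * (ennreal ((?m + 2) * r * (1 + r\<^sup>2) powr (- ?p - 1) * r ^ DIM('a)) * indicator {0..} r)"
    proof (cases "r \<ge> 0")
      case True
      have "(\<integral>\<^sup>+u. ?f r * indicator {norm u..} r \<partial>(lborel :: 'a measure)) = ?f r * emeasure lborel (cball (0::'a) r)"
        unfolding i by (subst nn_integral_cmult) (auto simp: borel_measurable_indicator)
      also have "\<dots> = ?f r * ennreal (unit_ball_vol ?m * r ^ DIM('a))"
        by (subst emeasure_cball[OF True]) simp
      finally show ?thesis using True
        by (simp add: ennreal_mult[symmetric] mult_ac)
    next
      case False
      then have "cball (0::'a) r = {}" by simp
      then show ?thesis using False unfolding i by simp
    qed
  qed
  also have "\<dots> = ennreal (unit_ball_vol ?m)"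
    by (subst nn_integral_cmult) (use radial_moment[OF refl, of "DIM('a)"] in \<open>auto simp: DIM_positive Suc_leI\<close>)
  finally show ?thesis .
qed

lemma measure_unit_ball: "measure lebesgue (ball (0::'a::euclidean_space) 1) = unit_ball_vol (real DIM('a))"
  using content_ball[of 1 "0::'a"] by simp

section \<open>The potential of an ellipsoid\<close>

lemma
  fixes f :: "'a::euclidean_space \<Rightarrow> real"
  assumes t: "t > 0" and [measurable]: "f \<in> borel_measurable borel"
  shows lborel_integral_affine: "(\<integral>y. f y \<partial>lborel) = t ^ DIM('a) * (\<integral>u. f (x + t *\<^sub>R u) \<partial>lborel)"
    and lborel_integrable_affine: "integrable lborel f \<longleftrightarrow> integrable lborel (\<lambda>u. f (x + t *\<^sub>R u))"
proof -
  have L: "lborel = density (distr lborel borel (\<lambda>u::'a. x + t *\<^sub>R u)) (\<lambda>_. t ^ DIM('a))"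
    using lborel_affine[of t x] t by simp
  have "(\<integral>y. f y \<partial>lborel) = (\<integral>y. f y \<partial>density (distr lborel borel (\<lambda>u::'a. x + t *\<^sub>R u)) (\<lambda>_. t ^ DIM('a)))"
    using L by simp
  also have "\<dots> = (\<integral>y. t ^ DIM('a) *\<^sub>R f y \<partial>distr lborel borel (\<lambda>u::'a. x + t *\<^sub>R u))"
    by (rule integral_density) (use t in auto)
  also have "\<dots> = (\<integral>u. t ^ DIM('a) *\<^sub>R f (x + t *\<^sub>R u) \<partial>lborel)"
    by (rule integral_distr) measurable
  finally show "(\<integral>y. f y \<partial>lborel) = t ^ DIM('a) * (\<integral>u. f (x + t *\<^sub>R u) \<partial>lborel)" by simp
  have "integrable lborel f \<longleftrightarrow> integrable (density (distr lborel borel (\<lambda>u::'a. x + t *\<^sub>R u)) (\<lambda>_. t ^ DIM('a))) f"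
    using L by simp
  also have "\<dots> \<longleftrightarrow> integrable (distr lborel borel (\<lambda>u::'a. x + t *\<^sub>R u)) (\<lambda>y. t ^ DIM('a) *\<^sub>R f y)"
    by (rule integrable_density) (use t in auto)
  also have "\<dots> \<longleftrightarrow> integrable lborel (\<lambda>u. t ^ DIM('a) *\<^sub>R f (x + t *\<^sub>R u))"
    by (rule integrable_distr_eq) measurable
  finally show "integrable lborel f \<longleftrightarrow> integrable lborel (\<lambda>u. f (x + t *\<^sub>R u))"
    using t by simp
qed

abbreviation std_kernel :: "'a::euclidean_space \<Rightarrow> real" where
  "std_kernel u \<equiv> smooth_dist 1 0 u powr (- (real DIM('a) / 2 + 1))"

lemma
  shows integrable_std_kernel: "integrable lborel (std_kernel :: 'a::euclidean_space \<Rightarrow> real)"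
    and integral_std_kernel: "(\<integral>u. std_kernel u \<partial>(lborel :: 'a measure)) = unit_ball_vol (real DIM('a))"
proof -
  note n = nn_integral_kernel[where 'a = 'a]
  show i: "integrable lborel (std_kernel :: 'a \<Rightarrow> real)"
    by (rule integrableI_nonneg) (use n in auto)
  show "(\<integral>u. std_kernel u \<partial>(lborel :: 'a measure)) = unit_ball_vol (real DIM('a))"
    using n by (subst (asm) nn_integral_eq_integral[OF i]) auto
qed

text \<open>The powers of t add up to m + 2 - (m + 2) = 0. So the kernels with
  \<open>e = t\<^sup>2\<close> are rescaled copies of one integrable function, which makes them an
  approximate identity up to its mass.\<close>

lemma scaled_kernel:
  fixes x u :: "'a::euclidean_space"
  assumes t: "t > 0"
  shows "t ^ DIM('a) * (t\<^sup>2 * smooth_dist (t\<^sup>2) x (x + t *\<^sub>R u) powr (- real DIM('a) / 2 - 1)) = std_kernel u"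
proof -
  let ?m = "real DIM('a)"
  have "smooth_dist (t\<^sup>2) x (x + t *\<^sub>R u) = t\<^sup>2 * smooth_dist 1 0 u"
    by (simp add: smooth_dist_def power2_eq_square algebra_simps)
  moreover have "t ^ DIM('a) * (t\<^sup>2 * (t\<^sup>2) powr (- ?m / 2 - 1)) = 1"
  proof -
    have "t ^ DIM('a) * (t\<^sup>2 * (t\<^sup>2) powr (- ?m / 2 - 1)) = t powr ?m * (t powr 2 * (t powr 2) powr (- ?m / 2 - 1))"
      using t by (simp add: powr_realpow)
    also have "\<dots> = t powr (?m + (2 + 2 * (- ?m / 2 - 1)))"
      by (simp only: powr_powr powr_add)
    also have "\<dots> = 1" using t by simp
    finally show ?thesis .
  qed
  moreover have "- ?m / 2 - 1 = - (?m / 2 + 1)" by simp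
  ultimately show ?thesis
    using t smooth_dist_pos[of 1 0 u] by (simp add: powr_mult mult.assoc[symmetric])
qed

lemma integral_scaled_kernel:
  fixes x :: "'a::euclidean_space"
  assumes t: "t > 0" and [measurable]: "G \<in> borel_measurable borel"
  shows "(\<integral>y. t\<^sup>2 * smooth_dist (t\<^sup>2) x y powr (- real DIM('a) / 2 - 1) * G y \<partial>lborel)
      = (\<integral>u. std_kernel u * G (x + t *\<^sub>R u) \<partial>lborel)"
proof -
  have "(\<integral>y. t\<^sup>2 * smooth_dist (t\<^sup>2) x y powr (- real DIM('a) / 2 - 1) * G y \<partial>lborel)
    = (\<integral>u. t ^ DIM('a) * (t\<^sup>2 * smooth_dist (t\<^sup>2) x (x + t *\<^sub>R u) powr (- real DIM('a) / 2 - 1)) * G (x + t *\<^sub>R u) \<partial>lborel)"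
    by (subst lborel_integral_affine[OF t, where x = x]) (auto simp: mult.assoc)
  then show "(\<integral>y. t\<^sup>2 * smooth_dist (t\<^sup>2) x y powr (- real DIM('a) / 2 - 1) * G y \<partial>lborel)
      = (\<integral>u. std_kernel u * G (x + t *\<^sub>R u) \<partial>lborel)"
    unfolding scaled_kernel[OF t] .
qed

lemma integrable_scaled_kernel:
  fixes x :: "'a::euclidean_space"
  assumes t: "t > 0"
  shows "integrable lborel (\<lambda>y. t\<^sup>2 * smooth_dist (t\<^sup>2) x y powr (- real DIM('a) / 2 - 1))"
proof -
  have "(\<lambda>u. t ^ DIM('a) * (t\<^sup>2 * smooth_dist (t\<^sup>2) x (x + t *\<^sub>R u) powr (- real DIM('a) / 2 - 1))) = (std_kernel :: 'a \<Rightarrow> real)"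
    by (intro ext scaled_kernel[OF t])
  then have "integrable lborel (\<lambda>u. t ^ DIM('a) * (t\<^sup>2 * smooth_dist (t\<^sup>2) x (x + t *\<^sub>R u) powr (- real DIM('a) / 2 - 1)))"
    using integrable_std_kernel[where 'a = 'a] by (simp only:)
  then have "integrable lborel (\<lambda>y. t ^ DIM('a) * (t\<^sup>2 * smooth_dist (t\<^sup>2) x y powr (- real DIM('a) / 2 - 1)))"
    by (subst lborel_integrable_affine[OF t, where x = x]) auto
  then show "integrable lborel (\<lambda>y. t\<^sup>2 * smooth_dist (t\<^sup>2) x y powr (- real DIM('a) / 2 - 1))"
    using t by simp
qed

lemma smooth_dist_at_infinity: "e \<ge> 0 \<Longrightarrow> filterlim (smooth_dist e x) at_top at_infinity"
proof (rule filterlim_at_top_mono)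
  show "filterlim (\<lambda>y. (- norm x - 1) + norm y) at_top at_infinity"
    by (rule filterlim_tendsto_add_at_top[OF tendsto_const filterlim_norm_at_top])
  assume e: "e \<ge> 0"
  show "eventually (\<lambda>y. (- norm x - 1) + norm y \<le> smooth_dist e x y) at_infinity"
  proof (intro always_eventually allI)
    fix y
    have "norm y \<le> norm (y - x) + norm x" by norm
    moreover have "norm (y - x) \<le> (norm (y - x))\<^sup>2 + 1"
      using sum_squares_bound[of "norm (y - x)" 1] by (simp add: power2_eq_square) (smt (verit) norm_ge_zero)
    ultimately show "(- norm x - 1) + norm y \<le> smooth_dist e x y"
      using e by (simp add: smooth_dist_def power2_norm_eq_inner)
  qed
qed

text \<open>Green's identity for the kernels with \<open>e = (t n)\<^sup>2\<close> has a limit on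
  both sides: on the left the kernels increase to the singular one, on the right the approximate
  identity evaluates the continuous bounded function \<open>ell_pot\<close> at x. The argument is
  indifferent to whether x lies inside or outside.\<close>

theorem newton_pot_ellip:
  fixes A :: "'a::euclidean_space \<Rightarrow> real"
  assumes A: "\<forall>i\<in>Basis. A i > 0" and D: "DIM('a) \<ge> 3"
  shows "newton_pot (ellip A c) x = ennreal (ell_pot A c x)"
proof -
  define m where "m = real DIM('a)"
  have m3: "m \<ge> 3" using D by (simp add: m_def)
  define t where "t n = inverse (real (Suc n))" for n
  have tpos: "t n > 0" for n by (simp add: t_def)
  have t0: "t \<longlonglongrightarrow> 0" unfolding t_def by (rule LIMSEQ_inverse_real_of_nat)
  have tmono: "t n \<le> t k" if "k \<le> n" for n k using that by (simp add: t_def field_simps)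
  define \<phi> where "\<phi> n y = smooth_dist ((t n)\<^sup>2) x y powr ((2 - m) / 2)" for n y
  let ?G = "ell_pot A c"
  define B where "B = (\<integral>s. indicator {0..} s * wt Basis A s \<partial>lborel) / (4 * wt Basis A 0)"
  have cG: "continuous_on UNIV ?G" by (rule continuous_on_ell_pot[OF A D])
  have G0: "?G y \<ge> 0" and GB: "?G y \<le> B" for y
    using ell_pot_nonneg[OF A] ell_pot_le[OF A D] by (auto simp: B_def)
  have [measurable]: "?G \<in> borel_measurable borel" using cG by (rule borel_measurable_continuous_onI)
  have [measurable]: "\<phi> n \<in> borel_measurable borel" for n unfolding \<phi>_def[abs_def] by measurable
  have sdt: "smooth_dist ((t n)\<^sup>2) x y \<ge> (t n)\<^sup>2" for n y by (simp add: smooth_dist_def)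
  have t2: "(t n)\<^sup>2 > 0" for n by (rule zero_less_power[OF tpos])
  have bdd: "\<bar>\<phi> n y\<bar> \<le> ((t n)\<^sup>2) powr ((2 - m) / 2)" for n y
    unfolding \<phi>_def using m3 t2 sdt[of n y] by (simp add: powr_mono2')
  have green: "(\<integral>y. indicator (ellip A c) y * \<phi> n y \<partial>lborel) = m * (m - 2) * (\<integral>u. std_kernel u * ?G (x + t n *\<^sub>R u) \<partial>lborel)" for n
  proof -
    let ?h = "\<lambda>i y. (2 - m) * smooth_dist ((t n)\<^sup>2) x y powr (- m / 2) - (2 - m) * m * ((y - x) \<bullet> i)\<^sup>2 * smooth_dist ((t n)\<^sup>2) x y powr (- m / 2 - 1)"
    have h: "(\<Sum>i\<in>Basis. ?h i y) = - (m * (m - 2)) * ((t n)\<^sup>2 * smooth_dist ((t n)\<^sup>2) x y powr (- m / 2 - 1))" for y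
      unfolding m_def by (rule smooth_kernel_laplacian[OF t2])
    have "(\<integral>y. indicator (ellip A c) y * \<phi> n y \<partial>lborel) = - (\<integral>y. (\<Sum>i\<in>Basis. ?h i y) * ?G y \<partial>lborel)"
    proof (rule ellipsoid_green[OF _ A D bdd])
      show "C2_data (\<phi> n) (\<lambda>i y. (2 - m) * ((y - x) \<bullet> i) * smooth_dist ((t n)\<^sup>2) x y powr (- m / 2)) ?h"
        unfolding \<phi>_def[abs_def] m_def by (rule C2_data_smooth_kernel[OF t2])
      show "(\<phi> n \<longlongrightarrow> 0) at_infinity"
        unfolding \<phi>_def[abs_def] using m3 by (intro tendsto_neg_powr smooth_dist_at_infinity) auto
      show "integrable lborel (\<lambda>y. \<Sum>i\<in>Basis. ?h i y)"
        unfolding h using integrable_scaled_kernel[OF tpos[of n], of x] by (simp add: m_def)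
    qed
    also have "\<dots> = m * (m - 2) * (\<integral>y. (t n)\<^sup>2 * smooth_dist ((t n)\<^sup>2) x y powr (- m / 2 - 1) * ?G y \<partial>lborel)"
      unfolding h by (simp add: mult.assoc)
    also have "(\<integral>y. (t n)\<^sup>2 * smooth_dist ((t n)\<^sup>2) x y powr (- m / 2 - 1) * ?G y \<partial>lborel) = (\<integral>u. std_kernel u * ?G (x + t n *\<^sub>R u) \<partial>lborel)"
      unfolding m_def by (rule integral_scaled_kernel[OF tpos]) measurable
    finally show ?thesis .
  qed
  have lim: "(\<lambda>n. \<integral>u. std_kernel u * ?G (x + t n *\<^sub>R u) \<partial>lborel) \<longlonglongrightarrow> (\<integral>u. std_kernel u * ?G x \<partial>(lborel :: 'a measure))"
  proof (rule integral_dominated_convergence[where w = "\<lambda>u. std_kernel u * B"])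
    show "integrable lborel (\<lambda>u::'a. std_kernel u * B)" using integrable_std_kernel[where 'a = 'a] by (rule integrable_mult_left)
    show "AE u::'a in lborel. (\<lambda>n. std_kernel u * ?G (x + t n *\<^sub>R u)) \<longlonglongrightarrow> std_kernel u * ?G x"
    proof (rule AE_I2)
      fix u :: 'a
      have "(\<lambda>n. x + t n *\<^sub>R u) \<longlonglongrightarrow> x" using t0 by (auto intro!: tendsto_eq_intros)
      then have "(\<lambda>n. ?G (x + t n *\<^sub>R u)) \<longlonglongrightarrow> ?G x"
        using cG by (simp add: continuous_on_sequentially o_def)
      then show "(\<lambda>n. std_kernel u * ?G (x + t n *\<^sub>R u)) \<longlonglongrightarrow> std_kernel u * ?G x" by (intro tendsto_intros)
    qed
    show "AE u::'a in lborel. norm (std_kernel u * ?G (x + t n *\<^sub>R u)) \<le> std_kernel u * B" for n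
      using G0 GB by (intro AE_I2) (auto simp: abs_mult intro!: mult_left_mono)
  qed measurable
  \<comment> \<open>The factor m (m - 2) comes from the Laplacian of the kernel and the ball volume
    from its mass; \<open>newton_alpha\<close> is the reciprocal of their product.\<close>
  define V where "V = m * (m - 2) * (unit_ball_vol m * ?G x)"
  have "(\<lambda>n. \<integral>y. indicator (ellip A c) y * \<phi> n y \<partial>lborel) \<longlonglongrightarrow> V"
    unfolding green V_def using tendsto_mult_left[OF lim, of "m * (m - 2)"]
    by (simp add: integral_std_kernel[where 'a = 'a, simplified] m_def)
  then have L1: "(\<lambda>n. ennreal (\<integral>y. indicator (ellip A c) y * \<phi> n y \<partial>lborel)) \<longlonglongrightarrow> ennreal V"
    by (rule tendsto_ennrealI)
  \<comment> \<open>At y = x the convention \<open>0 powr a = 0\<close> makes the limit kernel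
    vanish while the regularised kernels blow up. Deleting this null point restores pointwise
    convergence everywhere.\<close>
  let ?f = "\<lambda>n y. indicator (ellip A c - {x}) y * ennreal (\<phi> n y)"
  let ?F = "\<lambda>y. indicator (ellip A c - {x}) y * ennreal (norm (x - y) powr (2 - m))"
  have L2: "(\<lambda>n. \<integral>\<^sup>+y. ?f n y \<partial>lborel) \<longlonglongrightarrow> (\<integral>\<^sup>+y. ?F y \<partial>lborel)"
  proof (rule nn_integral_LIMSEQ)
    show "incseq ?f"
    proof (intro incseq_SucI le_funI mult_left_mono ennreal_leI)
      fix n y
      have "(t (Suc n))\<^sup>2 \<le> (t n)\<^sup>2" using tpos[of "Suc n"] tmono[of n "Suc n"] by (intro power_mono) auto
      then show "\<phi> n y \<le> \<phi> (Suc n) y"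
        unfolding \<phi>_def using m3 smooth_dist_pos[OF t2, of "Suc n" x y]
        by (intro powr_mono2') (auto simp: smooth_dist_def)
    qed simp
    show "(\<lambda>n. ?f n y) \<longlonglongrightarrow> ?F y" for y
    proof (cases "y \<in> ellip A c - {x}")
      case True
      then have n0: "norm (x - y) > 0" by auto
      have "(\<lambda>n. smooth_dist ((t n)\<^sup>2) x y) \<longlonglongrightarrow> (norm (x - y))\<^sup>2"
        unfolding smooth_dist_def power2_norm_eq_inner[symmetric] using t0
        by (auto intro!: tendsto_eq_intros simp: norm_minus_commute)
      then have "(\<lambda>n. \<phi> n y) \<longlonglongrightarrow> ((norm (x - y))\<^sup>2) powr ((2 - m) / 2)"
        unfolding \<phi>_def using n0 by (intro tendsto_powr tendsto_const) auto
      also have "((norm (x - y))\<^sup>2) powr ((2 - m) / 2) = (norm (x - y) powr 2) powr ((2 - m) / 2)"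
        using n0 by simp
      also have "\<dots> = norm (x - y) powr (2 * ((2 - m) / 2))" by (simp only: powr_powr)
      also have "2 * ((2 - m) / 2) = 2 - m" by (subst times_divide_eq_right, subst nonzero_mult_div_cancel_left) auto
      finally show ?thesis using True by (simp add: tendsto_ennrealI)
    qed simp
  qed measurable
  have feq: "(\<integral>\<^sup>+y. ?f n y \<partial>lborel) = ennreal (\<integral>y. indicator (ellip A c) y * \<phi> n y \<partial>lborel)" for n
  proof -
    have "(\<integral>\<^sup>+y. ?f n y \<partial>lborel) = (\<integral>\<^sup>+y. ennreal (indicator (ellip A c) y * \<phi> n y) \<partial>lborel)"
      using AE_lborel_singleton[of x] by (intro nn_integral_cong_AE) (auto simp: indicator_def elim!: eventually_mono)
    also have "\<dots> = ennreal (\<integral>y. indicator (ellip A c) y * \<phi> n y \<partial>lborel)"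
    proof (rule nn_integral_eq_integral)
      have cont: "continuous_on (ellip A c) (\<phi> n)"
        unfolding \<phi>_def[abs_def] using smooth_dist_pos[OF t2, of n x]
        by (intro continuous_intros) (auto simp: less_imp_neq[THEN not_sym])
      show "integrable lborel (\<lambda>y. indicator (ellip A c) y * \<phi> n y)"
        using borel_integrable_compact[OF compact_ellip[OF A] cont] by simp
    qed (auto simp: \<phi>_def)
    finally show ?thesis .
  qed
  have eq: "(\<integral>\<^sup>+y. ?F y \<partial>lborel) = ennreal V"
    by (rule LIMSEQ_unique[OF L2[unfolded feq] L1])
  have "(\<integral>\<^sup>+y. indicator (ellip A c) y * ennreal (norm (x - y) powr (2 - m)) \<partial>lebesgue) = (\<integral>\<^sup>+y. ?F y \<partial>lborel)"
    unfolding nn_integral_completion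
    using AE_lborel_singleton[of x] by (intro nn_integral_cong_AE) (auto simp: indicator_def elim!: eventually_mono)
  then have "newton_pot (ellip A c) x = ennreal (1 / (m * (m - 2) * unit_ball_vol m)) * ennreal V"
    unfolding newton_pot_def newton_alpha_def measure_unit_ball m_def[symmetric] by (simp only: eq)
  also have "\<dots> = ennreal (1 / (m * (m - 2) * unit_ball_vol m) * V)"
    using m3 by (intro ennreal_mult'[symmetric]) auto
  also have "1 / (m * (m - 2) * unit_ball_vol m) * V = ?G x"
  proof -
    have "1 / (m * (m - 2) * b) * (m * (m - 2) * (b * g)) = g" if "b > 0" for b g
      using m3 that by simp
    from this[of "unit_ball_vol m"] show ?thesis using m3 unfolding V_def by simp
  qed
  finally show ?thesis .
qed

section \<open>Ellipsoids exhausting a paraboloid\<close>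

lemma Basis_vec_real_prod: "(Basis :: ((real^'n::finite) \<times> real) set) = insert (0, 1) (range (\<lambda>j. (axis j 1, 0)))"
  by (auto simp: Basis_prod_def Basis_vec_def)

lemma
  shows sum_Basis_vec_real: "(\<Sum>v\<in>(Basis :: ((real^'n::finite) \<times> real) set). f v) = (\<Sum>j\<in>UNIV. f (axis j 1, 0)) + f (0, 1)"
    and prod_Basis_vec_real: "(\<Prod>v\<in>(Basis :: ((real^'n::finite) \<times> real) set). f v) = (\<Prod>j\<in>UNIV. f (axis j 1, 0)) * f (0, 1)"
proof -
  have i: "inj (\<lambda>j::'n. (axis j (1::real), 0::real))"
    by (auto simp: inj_on_def axis_eq_axis)
  have n: "(0, 1) \<notin> range (\<lambda>j::'n. (axis j (1::real), 0::real))" by auto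
  show "(\<Sum>v\<in>Basis. f v) = (\<Sum>j\<in>UNIV. f (axis j 1, 0)) + f (0, 1)"
    unfolding Basis_vec_real_prod using n by (simp add: sum.reindex[OF i] add.commute)
  show "(\<Prod>v\<in>Basis. f v) = (\<Prod>j\<in>UNIV. f (axis j 1, 0)) * f (0, 1)"
    unfolding Basis_vec_real_prod using n by (simp add: prod.reindex[OF i] mult.commute)
qed

definition par_quad :: "('n::finite \<Rightarrow> real) \<Rightarrow> real^'n \<Rightarrow> real \<Rightarrow> real" where
  "par_quad \<alpha> x u = (\<Sum>j\<in>UNIV. (x $ j)\<^sup>2 / (\<alpha> j + u))"

text \<open>\<open>snd x + h\<close> is the height above the vertex, the z of the overview; the
  vertex itself lies at height -h.\<close>

definition par_pot :: "('n::finite \<Rightarrow> real) \<Rightarrow> real \<Rightarrow> (real^'n) \<times> real \<Rightarrow> real" where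
  "par_pot \<alpha> h x = (\<integral>u. indicator {0..} u * (wt UNIV \<alpha> u * max 0 (u / 4 + (snd x + h) - par_quad \<alpha> (fst x) u)) \<partial>lborel) / (4 * wt UNIV \<alpha> 0)"

text \<open>Completing the square in \<open>par_quad \<alpha> x 0 \<le> z - z\<^sup>2 / L\<close>
  and multiplying by 4/L gives centre z = L/2 and squared semi-axes L \<alpha>_j / 4 and L^2 / 4.
  Since \<open>conf_quad\<close> takes axes indexed by basis vectors, they are encoded as a linear
  function with these values on the basis.\<close>

definition cut_axes :: "('n::finite \<Rightarrow> real) \<Rightarrow> real \<Rightarrow> (real^'n) \<times> real \<Rightarrow> real" where
  "cut_axes \<alpha> L v = L / 4 * (\<Sum>j\<in>UNIV. \<alpha> j * (fst v $ j)) + L\<^sup>2 / 4 * snd v"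

abbreviation cut_centre :: "real \<Rightarrow> real \<Rightarrow> (real^'n::finite) \<times> real" where
  "cut_centre L h \<equiv> (0, L / 2 - h)"

text \<open>The parameter L runs through the positive integers, hence the successor.\<close>

abbreviation cut_ellip :: "('n::finite \<Rightarrow> real) \<Rightarrow> real \<Rightarrow> nat \<Rightarrow> ((real^'n) \<times> real) set" where
  "cut_ellip \<alpha> h k \<equiv> ellip (cut_axes \<alpha> (real (Suc k))) (cut_centre (real (Suc k)) h)"

abbreviation cut_pot :: "('n::finite \<Rightarrow> real) \<Rightarrow> real \<Rightarrow> nat \<Rightarrow> (real^'n) \<times> real \<Rightarrow> real" where
  "cut_pot \<alpha> h k \<equiv> ell_pot (cut_axes \<alpha> (real (Suc k))) (cut_centre (real (Suc k)) h)"

lemma cut_axes_simps[simp]: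
  fixes \<alpha> :: "'n::finite \<Rightarrow> real"
  shows "cut_axes \<alpha> L (axis j 1, 0) = L / 4 * \<alpha> j" "cut_axes \<alpha> L (0, 1) = L\<^sup>2 / 4"
proof -
  have "(\<Sum>i\<in>UNIV. \<alpha> i * ((axis j 1 :: real^'n) $ i)) = (\<Sum>i\<in>UNIV. if i = j then \<alpha> i else 0)"
    by (intro sum.cong) (auto simp: axis_def)
  then show "cut_axes \<alpha> L (axis j 1, 0) = L / 4 * \<alpha> j" by (simp add: cut_axes_def)
  show "cut_axes \<alpha> L (0, 1) = L\<^sup>2 / 4" by (simp add: cut_axes_def)
qed

lemma cut_axes_pos:
  assumes "\<forall>j. \<alpha> j > 0" "L > 0"
  shows "\<forall>v\<in>Basis. cut_axes \<alpha> L v > 0"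
  unfolding Basis_vec_real_prod using assms by auto

lemma conf_quad_cut:
  "conf_quad (cut_axes \<alpha> L) (cut_centre L h) x s =
    (\<Sum>j\<in>UNIV. (fst x $ j)\<^sup>2 / (L / 4 * \<alpha> j + s)) + (snd x + h - L / 2)\<^sup>2 / (L\<^sup>2 / 4 + s)"
  unfolding conf_quad_def sum_Basis_vec_real
  by (simp add: inner_prod_def inner_axis algebra_simps)

lemma wt_cut:
  "wt Basis (cut_axes \<alpha> L) s = (\<Prod>j\<in>UNIV. 1 / sqrt (L / 4 * \<alpha> j + s)) * (1 / sqrt (L\<^sup>2 / 4 + s))"
  unfolding wt_def prod_Basis_vec_real by simp

lemma ellip_cut:
  assumes "\<forall>j. \<alpha> j > 0" "L > 0"
  shows "ellip (cut_axes \<alpha> L) (cut_centre L h) = {x. par_quad \<alpha> (fst x) 0 \<le> (snd x + h) - (snd x + h)\<^sup>2 / L}"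
proof -
  have "conf_quad (cut_axes \<alpha> L) (cut_centre L h) x 0 = 4 / L * (par_quad \<alpha> (fst x) 0 - ((snd x + h) - (snd x + h)\<^sup>2 / L)) + 1" for x
  proof -
    have "(\<Sum>j\<in>UNIV. (fst x $ j)\<^sup>2 / (L / 4 * \<alpha> j + 0)) = 4 / L * par_quad \<alpha> (fst x) 0"
      unfolding par_quad_def sum_distrib_left by (intro sum.cong) auto
    moreover have "(snd x + h - L / 2)\<^sup>2 / (L\<^sup>2 / 4 + 0) = 1 - 4 / L * ((snd x + h) - (snd x + h)\<^sup>2 / L)"
      using assms by (simp add: field_simps power2_eq_square)
    ultimately show ?thesis unfolding conf_quad_cut by (simp only: right_diff_distrib)
  qed
  moreover have "4 / L * D + 1 \<le> 1 \<longleftrightarrow> D \<le> 0" for D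
    using assms(2) by (simp add: mult_le_0_iff divide_le_0_iff)
  ultimately show ?thesis unfolding ellip_def by (simp only: diff_le_0_iff_le)
qed

text \<open>After s = (L/4) u each horizontal factor is that of \<alpha>_j + u up to a power of L/4
  that cancels in the quotient. What depends on L is the vertical factor alone, and it tends to
  1.\<close>

lemma wt_cut_scaled:
  fixes \<alpha> :: "'n::finite \<Rightarrow> real"
  assumes \<alpha>: "\<forall>j. \<alpha> j > 0" and L: "L > 0" and u: "u \<ge> 0"
  shows "wt Basis (cut_axes \<alpha> L) (L / 4 * u) / wt Basis (cut_axes \<alpha> L) 0 = wt UNIV \<alpha> u / wt UNIV \<alpha> 0 * sqrt (L / (L + u))"
proof -
  have "(\<Prod>j\<in>UNIV. 1 / sqrt (L / 4 * \<alpha> j + L / 4 * v)) = (\<Prod>j\<in>(UNIV::'n set). 1 / sqrt (L / 4)) * wt UNIV \<alpha> v" for v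
    unfolding wt_def prod.distrib[symmetric]
    by (intro prod.cong refl) (simp only: distrib_left[symmetric] real_sqrt_mult, simp)
  from this[of u] this[of 0]
  have "wt Basis (cut_axes \<alpha> L) (L / 4 * u) / wt Basis (cut_axes \<alpha> L) 0
    = (wt UNIV \<alpha> u / wt UNIV \<alpha> 0) * (sqrt (L\<^sup>2 / 4) / sqrt (L\<^sup>2 / 4 + L / 4 * u))"
    unfolding wt_cut using L by simp
  also have "sqrt (L\<^sup>2 / 4) / sqrt (L\<^sup>2 / 4 + L / 4 * u) = sqrt (L / (L + u))"
  proof -
    have "L\<^sup>2 / 4 + L / 4 * u = L / 4 * (L + u)" "L\<^sup>2 / 4 = L / 4 * L"
      by (simp_all add: power2_eq_square algebra_simps)
    then have "(L\<^sup>2 / 4) / (L\<^sup>2 / 4 + L / 4 * u) = (L / 4 * L) / (L / 4 * (L + u))"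
      by (simp only:)
    also have "\<dots> = L / (L + u)" using L by (subst mult_divide_mult_cancel_left) auto
    finally show ?thesis by (simp only: real_sqrt_divide[symmetric])
  qed
  finally show ?thesis .
qed

text \<open>The factor L/4 is the Jacobian of s = (L/4) u. It is compensated by the vertical term,
  which differs from 1 by order 1/L, so the product has the finite limit u/4 + z -
  \<open>par_quad \<alpha> (fst x) u\<close>.\<close>

lemma conf_quad_cut_scaled:
  assumes \<alpha>: "\<forall>j. \<alpha> j > 0" and L: "L > 0" and u: "u \<ge> 0"
  shows "L / 4 * (1 - conf_quad (cut_axes \<alpha> L) (cut_centre L h) x (L / 4 * u))
    = (L * (u / 4 + (snd x + h)) - (snd x + h)\<^sup>2) / (L + u) - par_quad \<alpha> (fst x) u"
proof -
  let ?z = "snd x + h"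
  have "L / 4 * (\<Sum>j\<in>UNIV. (fst x $ j)\<^sup>2 / (L / 4 * \<alpha> j + L / 4 * u)) = par_quad \<alpha> (fst x) u"
    unfolding par_quad_def sum_distrib_left
  proof (intro sum.cong refl)
    fix j
    have "\<alpha> j + u > 0" using \<alpha> u by (simp add: add_pos_nonneg)
    then show "L / 4 * ((fst x $ j)\<^sup>2 / (L / 4 * \<alpha> j + L / 4 * u)) = (fst x $ j)\<^sup>2 / (\<alpha> j + u)"
      using L by (simp add: distrib_left[symmetric])
  qed
  moreover have "L / 4 - L / 4 * ((?z - L / 2)\<^sup>2 / (L\<^sup>2 / 4 + L / 4 * u)) = (L * (u / 4 + ?z) - ?z\<^sup>2) / (L + u)"
  proof -
    have p: "L + u > 0" using L u by simp
    have den: "L\<^sup>2 / 4 + L / 4 * u = L / 4 * (L + u)"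
      by (simp add: power2_eq_square algebra_simps)
    have "L / 4 * ((?z - L / 2)\<^sup>2 / (L\<^sup>2 / 4 + L / 4 * u)) = (L / 4 * (?z - L / 2)\<^sup>2) / (L / 4 * (L + u))"
      by (simp only: den times_divide_eq_right)
    also have "\<dots> = (?z - L / 2)\<^sup>2 / (L + u)" using L by (subst mult_divide_mult_cancel_left) auto
    finally have F: "L / 4 * ((?z - L / 2)\<^sup>2 / (L\<^sup>2 / 4 + L / 4 * u)) = (?z - L / 2)\<^sup>2 / (L + u)" .
    have "L / 4 - W / (L + u) = (L / 4 * (L + u) - W) / (L + u)" for W using p by (simp add: field_simps)
    then have "L / 4 - L / 4 * ((?z - L / 2)\<^sup>2 / (L\<^sup>2 / 4 + L / 4 * u)) = (L / 4 * (L + u) - (?z - L / 2)\<^sup>2) / (L + u)"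
      unfolding F .
    also have "L / 4 * (L + u) - (?z - L / 2)\<^sup>2 = L * (u / 4 + ?z) - ?z\<^sup>2"
      by (simp add: power2_eq_square algebra_simps)
    finally show ?thesis .
  qed
  ultimately show ?thesis unfolding conf_quad_cut by (simp add: algebra_simps)
qed

definition cut_integrand :: "('n::finite \<Rightarrow> real) \<Rightarrow> real \<Rightarrow> real \<Rightarrow> (real^'n) \<times> real \<Rightarrow> real \<Rightarrow> real" where
  "cut_integrand \<alpha> h L x u = indicator {0..} u * (wt UNIV \<alpha> u * (sqrt (L / (L + u)) *
     max 0 ((L * (u / 4 + (snd x + h)) - (snd x + h)\<^sup>2) / (L + u) - par_quad \<alpha> (fst x) u)))"

lemma par_quad_measurable[measurable]: "(\<lambda>u. par_quad \<alpha> x u) \<in> borel_measurable borel"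
  unfolding par_quad_def[abs_def] by measurable

lemma cut_integrand_measurable[measurable]: "cut_integrand \<alpha> h L x \<in> borel_measurable borel"
  unfolding cut_integrand_def[abs_def] by measurable

lemma ell_pot_cut:
  assumes \<alpha>: "\<forall>j. \<alpha> j > 0" and L: "L > 0"
  shows "ell_pot (cut_axes \<alpha> L) (cut_centre L h) x = (\<integral>u. cut_integrand \<alpha> h L x u \<partial>lborel) / (4 * wt UNIV \<alpha> 0)"
proof -
  let ?A = "cut_axes \<alpha> L" and ?c = "cut_centre L h :: (real^'n) \<times> real"
  let ?f = "\<lambda>s. indicator {0..} s * (wt Basis ?A s * max 0 (1 - conf_quad ?A ?c x s))"
  have w0: "wt Basis ?A 0 > 0" "wt UNIV \<alpha> 0 > 0" using wt_pos[of Basis ?A 0] wt_pos[of UNIV \<alpha> 0] cut_axes_pos[OF \<alpha> L] \<alpha> by auto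
  have "(\<integral>s. ?f s \<partial>lborel) = L / 4 * (\<integral>u. ?f (0 + (L / 4) *\<^sub>R u) \<partial>lborel)"
    using L by (subst lborel_integral_affine[where x = 0 and t = "L / 4"]) auto
  then have "ell_pot ?A ?c x = (\<integral>u. L / 4 * ?f (0 + (L / 4) *\<^sub>R u) / (4 * wt Basis ?A 0) \<partial>lborel)"
    unfolding ell_pot_def by (simp only: integral_mult_right_zero integral_divide_zero)
  also have "\<dots> = (\<integral>u. cut_integrand \<alpha> h L x u / (4 * wt UNIV \<alpha> 0) \<partial>lborel)"
  proof (rule Bochner_Integration.integral_cong[OF refl])
    fix u :: real
    show "L / 4 * ?f (0 + (L / 4) *\<^sub>R u) / (4 * wt Basis ?A 0) = cut_integrand \<alpha> h L x u / (4 * wt UNIV \<alpha> 0)"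
    proof (cases "u \<ge> 0")
      case True
      let ?m = "1 - conf_quad ?A ?c x (L / 4 * u)"
      have "L / 4 * max 0 ?m = max 0 (L / 4 * ?m)"
        using L by (simp add: max_mult_distrib_left)
      moreover have "?f (0 + (L / 4) *\<^sub>R u) = wt Basis ?A (L / 4 * u) * max 0 ?m"
        using True L by simp
      moreover have "K * (a * M) / (4 * b) = 1 / 4 * (a / b) * (K * M)" for K a M b :: real by simp
      ultimately have "L / 4 * ?f (0 + (L / 4) *\<^sub>R u) / (4 * wt Basis ?A 0) = 1 / 4 * (wt Basis ?A (L / 4 * u) / wt Basis ?A 0) * max 0 (L / 4 * ?m)"
        by (simp only:)
      then show ?thesis
        unfolding wt_cut_scaled[OF \<alpha> L True] conf_quad_cut_scaled[OF \<alpha> L True] cut_integrand_def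
        using True by simp
    next
      case False
      then show ?thesis using L by (simp add: cut_integrand_def zero_le_mult_iff)
    qed
  qed
  finally show ?thesis by simp
qed

lemma par_quad_nonneg: "\<forall>j. \<alpha> j > 0 \<Longrightarrow> u \<ge> 0 \<Longrightarrow> par_quad \<alpha> x u \<ge> 0"
  unfolding par_quad_def by (intro sum_nonneg divide_nonneg_nonneg) (auto simp: add_nonneg_nonneg less_imp_le)

text \<open>The bound does not depend on L and serves as majorant in the limit: the square root is
  at most 1, and the subtracted terms only decrease the positive part.\<close>

lemma cut_integrand_bounds:
  assumes \<alpha>: "\<forall>j. \<alpha> j > 0" and L: "L > 0"
  shows "0 \<le> cut_integrand \<alpha> h L x u" "cut_integrand \<alpha> h L x u \<le> indicator {0..} u * (wt UNIV \<alpha> u * (u / 4 + \<bar>snd x + h\<bar>))"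
proof -
  let ?z = "snd x + h"
  let ?M = "max 0 ((L * (u / 4 + ?z) - ?z\<^sup>2) / (L + u) - par_quad \<alpha> (fst x) u)"
  have "0 \<le> cut_integrand \<alpha> h L x u \<and> cut_integrand \<alpha> h L x u \<le> indicator {0..} u * (wt UNIV \<alpha> u * (u / 4 + \<bar>?z\<bar>))"
  proof (cases "u \<ge> 0")
    case True
    have w: "wt UNIV \<alpha> u > 0" using \<alpha> True by (intro wt_pos) auto
    have Lu: "L + u > 0" using L True by simp
    have "(L * (u / 4 + ?z) - ?z\<^sup>2) \<le> (L + u) * (u / 4 + \<bar>?z\<bar>)"
    proof -
      have "L * (u / 4 + ?z) \<le> L * (u / 4 + \<bar>?z\<bar>)" using L by (intro mult_left_mono) auto
      also have "\<dots> \<le> (L + u) * (u / 4 + \<bar>?z\<bar>)" using True by (intro mult_right_mono) auto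
      finally show ?thesis using zero_le_power2[of ?z] by linarith
    qed
    then have "(L * (u / 4 + ?z) - ?z\<^sup>2) / (L + u) \<le> u / 4 + \<bar>?z\<bar>"
      using Lu by (simp add: pos_divide_le_eq mult.commute)
    then have M: "?M \<le> u / 4 + \<bar>?z\<bar>" using par_quad_nonneg[OF \<alpha> True, of "fst x"] True by auto
    have s: "0 \<le> sqrt (L / (L + u))" "sqrt (L / (L + u)) \<le> 1" using L True by auto
    have "sqrt (L / (L + u)) * ?M \<le> 1 * (u / 4 + \<bar>?z\<bar>)" using s M by (intro mult_mono) auto
    then show ?thesis using w s True unfolding cut_integrand_def by (auto intro!: mult_left_mono mult_nonneg_nonneg)
  qed (simp add: cut_integrand_def)
  then show "0 \<le> cut_integrand \<alpha> h L x u" "cut_integrand \<alpha> h L x u \<le> indicator {0..} u * (wt UNIV \<alpha> u * (u / 4 + \<bar>?z\<bar>))"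
    by auto
qed

lemma integrable_wt_affine:
  fixes \<alpha> :: "'n::finite \<Rightarrow> real"
  assumes \<alpha>: "\<forall>j. \<alpha> j > 0" and n: "CARD('n) \<ge> 5"
  shows "integrable lborel (\<lambda>u. indicator {0..} u * (wt UNIV \<alpha> u * (u / 4 + k)))"
proof -
  have "integrable lborel (\<lambda>u. 1 / 4 * (indicator {0..} u * (u * wt UNIV \<alpha> u)) + k * (indicator {0..} u * wt UNIV \<alpha> u))"
    using \<alpha> n by (intro Bochner_Integration.integrable_add integrable_mult_right integrable_mult_wt integrable_wt) auto
  then show ?thesis
    by (rule back_subst[of "integrable lborel"]) (auto simp: fun_eq_iff algebra_simps)
qed

lemma ell_pot_cut_tendsto:
  fixes \<alpha> :: "'n::finite \<Rightarrow> real"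
  assumes \<alpha>: "\<forall>j. \<alpha> j > 0" and n: "CARD('n) \<ge> 5"
  shows "(\<lambda>k. cut_pot \<alpha> h k x) \<longlonglongrightarrow> par_pot \<alpha> h x"
proof -
  let ?z = "snd x + h"
  let ?g = "\<lambda>u. indicator {0..} u * (wt UNIV \<alpha> u * max 0 (u / 4 + ?z - par_quad \<alpha> (fst x) u))"
  have "(\<lambda>k. \<integral>u. cut_integrand \<alpha> h (real (Suc k)) x u \<partial>lborel) \<longlonglongrightarrow> (\<integral>u. ?g u \<partial>lborel)"
  proof (rule integral_dominated_convergence[OF _ _ integrable_wt_affine[OF \<alpha> n, of "\<bar>?z\<bar>"]])
    show "AE u in lborel. (\<lambda>k. cut_integrand \<alpha> h (real (Suc k)) x u) \<longlonglongrightarrow> ?g u"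
    proof (rule AE_I2)
      fix u :: real
      have l1: "(\<lambda>k. real (Suc k) / (real (Suc k) + u)) \<longlonglongrightarrow> 1" by real_asymp
      have l2: "(\<lambda>k. (real (Suc k) * (u / 4 + ?z) - ?z\<^sup>2) / (real (Suc k) + u)) \<longlonglongrightarrow> u / 4 + ?z"
        by real_asymp
      have "(\<lambda>k. sqrt (real (Suc k) / (real (Suc k) + u)) * max 0 ((real (Suc k) * (u / 4 + ?z) - ?z\<^sup>2) / (real (Suc k) + u) - par_quad \<alpha> (fst x) u))
         \<longlonglongrightarrow> sqrt 1 * max 0 (u / 4 + ?z - par_quad \<alpha> (fst x) u)"
        by (intro tendsto_intros l1 l2)
      then show "(\<lambda>k. cut_integrand \<alpha> h (real (Suc k)) x u) \<longlonglongrightarrow> ?g u"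
        unfolding cut_integrand_def by (intro tendsto_mult tendsto_const) simp
    qed
    show "AE u in lborel. norm (cut_integrand \<alpha> h (real (Suc k)) x u) \<le> indicator {0..} u * (wt UNIV \<alpha> u * (u / 4 + \<bar>?z\<bar>))" for k
      using cut_integrand_bounds[OF \<alpha>, of "real (Suc k)" h x] by (intro AE_I2) auto
  qed measurable
  then show ?thesis
    unfolding ell_pot_cut[OF \<alpha> of_nat_0_less_iff[THEN iffD2, OF zero_less_Suc]] par_pot_def
    using wt_pos[of UNIV \<alpha> 0] \<alpha> by (intro tendsto_divide tendsto_const) auto
qed

section \<open>The potential of a paraboloid\<close>

definition par_set :: "('n::finite \<Rightarrow> real) \<Rightarrow> real \<Rightarrow> ((real^'n) \<times> real) set" where
  "par_set \<alpha> h = {x. par_quad \<alpha> (fst x) 0 \<le> snd x + h}"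

text \<open>One integral with two roles: the slope in the height for the paraboloid, and the value
  at the centre of the potential of the ellipsoid with squared semi-axes \<alpha>.\<close>

definition par_lin :: "('n::finite \<Rightarrow> real) \<Rightarrow> real" where
  "par_lin \<alpha> = (\<integral>u. indicator {0..} u * wt UNIV \<alpha> u \<partial>lborel) / (4 * wt UNIV \<alpha> 0)"

definition par_const :: "('n::finite \<Rightarrow> real) \<Rightarrow> real" where
  "par_const \<alpha> = (\<integral>u. indicator {0..} u * (u * wt UNIV \<alpha> u) \<partial>lborel) / (16 * wt UNIV \<alpha> 0)"

definition ell_coeff :: "('n::finite \<Rightarrow> real) \<Rightarrow> 'n \<Rightarrow> real" where
  "ell_coeff \<alpha> j = (\<integral>u. indicator {0..} u * (wt UNIV \<alpha> u / (\<alpha> j + u)) \<partial>lborel) / (4 * wt UNIV \<alpha> 0)"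

text \<open>The integral of the negative part; it turns out to be the solution u of the obstacle
  problem.\<close>

definition par_defect :: "('n::finite \<Rightarrow> real) \<Rightarrow> real \<Rightarrow> (real^'n) \<times> real \<Rightarrow> real" where
  "par_defect \<alpha> h x = (\<integral>u. indicator {0..} u * (wt UNIV \<alpha> u * max 0 (par_quad \<alpha> (fst x) u - u / 4 - (snd x + h))) \<partial>lborel) / (4 * wt UNIV \<alpha> 0)"

lemma integral_wt_affine:
  fixes \<alpha> :: "'n::finite \<Rightarrow> real"
  assumes \<alpha>: "\<forall>j. \<alpha> j > 0" and n: "CARD('n) \<ge> 5"
  shows "(\<integral>u. indicator {0..} u * (wt UNIV \<alpha> u * (u / 4 + k)) \<partial>lborel) / (4 * wt UNIV \<alpha> 0) = par_const \<alpha> + par_lin \<alpha> * k"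
proof -
  have "(\<integral>u. indicator {0..} u * (wt UNIV \<alpha> u * (u / 4 + k)) \<partial>lborel)
    = (\<integral>u. 1 / 4 * (indicator {0..} u * (u * wt UNIV \<alpha> u)) + k * (indicator {0..} u * wt UNIV \<alpha> u) \<partial>lborel)"
    by (intro Bochner_Integration.integral_cong) (auto simp: algebra_simps)
  also have "\<dots> = 1 / 4 * (\<integral>u. indicator {0..} u * (u * wt UNIV \<alpha> u) \<partial>lborel) + k * (\<integral>u. indicator {0..} u * wt UNIV \<alpha> u \<partial>lborel)"
    using \<alpha> n by (subst Bochner_Integration.integral_add) (auto intro!: integrable_mult_right integrable_mult_wt integrable_wt simp del: mult_1_left times_divide_eq_left)
  finally show ?thesis by (simp add: par_const_def par_lin_def add_divide_distrib)
qed

text \<open>Being uniform in L, the bound is inherited by \<open>par_pot\<close>. It serves as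
  majorant on compact sets and gives the linear growth that the quadratic blow-down cannot
  see.\<close>

lemma ell_pot_cut_le:
  fixes \<alpha> :: "'n::finite \<Rightarrow> real"
  assumes \<alpha>: "\<forall>j. \<alpha> j > 0" and n: "CARD('n) \<ge> 5" and L: "L > 0"
  shows "ell_pot (cut_axes \<alpha> L) (cut_centre L h) x \<le> par_const \<alpha> + par_lin \<alpha> * \<bar>snd x + h\<bar>"
  unfolding ell_pot_cut[OF \<alpha> L] integral_wt_affine[OF \<alpha> n, symmetric]
proof (intro divide_right_mono integral_mono integrable_wt_affine \<alpha> n cut_integrand_bounds L)
  show "integrable lborel (cut_integrand \<alpha> h L x)"
    by (rule Bochner_Integration.integrable_bound[OF integrable_wt_affine[OF \<alpha> n, of "\<bar>snd x + h\<bar>"]])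
      (use cut_integrand_bounds[OF \<alpha> L, of h x] in \<open>auto intro!: AE_I2 order_trans[OF _ abs_ge_self]\<close>)
  show "0 \<le> 4 * wt UNIV \<alpha> 0" using wt_pos[of UNIV \<alpha> 0] \<alpha> by auto
qed

lemma
  fixes \<alpha> :: "'n::finite \<Rightarrow> real"
  assumes \<alpha>: "\<forall>j. \<alpha> j > 0" and n: "CARD('n) \<ge> 5"
  shows par_pot_le: "par_pot \<alpha> h x \<le> par_const \<alpha> + par_lin \<alpha> * \<bar>snd x + h\<bar>"
    and par_pot_nonneg: "par_pot \<alpha> h x \<ge> 0"
    and par_pot_measurable: "par_pot \<alpha> h \<in> borel_measurable borel"
proof -
  show "par_pot \<alpha> h x \<le> par_const \<alpha> + par_lin \<alpha> * \<bar>snd x + h\<bar>"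
    by (rule LIMSEQ_le_const2[OF ell_pot_cut_tendsto[OF \<alpha> n]]) (auto intro!: ell_pot_cut_le[OF \<alpha> n])
  show "par_pot \<alpha> h x \<ge> 0"
    by (rule LIMSEQ_le_const[OF ell_pot_cut_tendsto[OF \<alpha> n]]) (auto intro!: ell_pot_nonneg cut_axes_pos[OF \<alpha>])
  have D: "DIM((real^'n) \<times> real) \<ge> 3" using n by simp
  show "par_pot \<alpha> h \<in> borel_measurable borel"
    by (rule borel_measurable_LIMSEQ_real[OF ell_pot_cut_tendsto[OF \<alpha> n]])
      (intro borel_measurable_continuous_onI continuous_on_ell_pot cut_axes_pos[OF \<alpha>] D, simp)
qed

section \<open>Exhaustion of the paraboloid and passage to the limit in the potentials\<close>

lemma continuous_on_par_quad[continuous_intros]: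
  assumes "continuous_on S f"
  shows "continuous_on S (\<lambda>x. par_quad \<alpha> (f x) u)"
proof -
  have "(\<lambda>x. par_quad \<alpha> (f x) u) = (\<lambda>x. \<Sum>j\<in>UNIV. inverse (\<alpha> j + u) * (f x $ j)\<^sup>2)"
    by (simp add: par_quad_def field_simps)
  then show ?thesis by (simp only:) (intro continuous_intros assms)
qed

lemma par_set_measurable[measurable]: "par_set \<alpha> h \<in> sets borel"
proof -
  have "closed (par_set \<alpha> h)"
    unfolding par_set_def by (intro closed_Collect_le continuous_intros)
  then show ?thesis by simp
qed

text \<open>Every vertical line meets the boundary in a single point, so Tonelli gives measure zero.
  The set has to be discarded because the cut ellipsoids miss all boundary points other than the
  vertex.\<close>

lemma par_boundary_null:
  fixes \<alpha> :: "'n::finite \<Rightarrow> real"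
  shows "AE x in lborel. par_quad \<alpha> (fst x) 0 \<noteq> snd x + h"
proof -
  let ?S = "{x. par_quad \<alpha> (fst x) 0 = snd x + h}"
  have "closed ?S" by (intro closed_Collect_eq continuous_intros)
  then have S: "?S \<in> sets borel" by simp
  then have S': "?S \<in> sets (lborel \<Otimes>\<^sub>M lborel)" unfolding lborel_prod by simp
  have "emeasure lborel ?S = emeasure (lborel \<Otimes>\<^sub>M lborel) ?S" unfolding lborel_prod by (rule refl)
  also have "\<dots> = (\<integral>\<^sup>+x. emeasure lborel (Pair x -` ?S) \<partial>lborel)"
    by (rule lborel.emeasure_pair_measure_alt[OF S'])
  also have "\<dots> = (\<integral>\<^sup>+x. 0 \<partial>(lborel :: (real^'n) measure))"
  proof (rule nn_integral_cong)
    fix x :: "real^'n"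
    have "Pair x -` ?S = {par_quad \<alpha> x 0 - h}" by auto
    then show "emeasure lborel (Pair x -` ?S) = 0" by simp
  qed
  finally have "?S \<in> null_sets lborel" using S by auto
  then show ?thesis by (rule AE_I') auto
qed

lemma cut_mono:
  assumes \<alpha>: "\<forall>j. \<alpha> j > 0" and "k \<le> l"
  shows "cut_ellip \<alpha> h k \<subseteq> cut_ellip \<alpha> h l"
proof -
  have "z\<^sup>2 / real (Suc l) \<le> z\<^sup>2 / real (Suc k)" for z :: real
    using assms(2) by (intro divide_left_mono) auto
  then show ?thesis
    by (auto simp: ellip_cut[OF \<alpha>] intro: order_trans)
qed

lemma cut_subset: 
  assumes \<alpha>: "\<forall>j. \<alpha> j > 0"
  shows "cut_ellip \<alpha> h k \<subseteq> par_set \<alpha> h"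
proof -
  have "0 \<le> z\<^sup>2 / real (Suc k)" for z :: real by simp
  then show ?thesis
    by (auto simp: ellip_cut[OF \<alpha>] par_set_def intro: order_trans)
qed

lemma cut_exhaust:
  assumes \<alpha>: "\<forall>j. \<alpha> j > 0" and x: "x \<in> par_set \<alpha> h" "par_quad \<alpha> (fst x) 0 \<noteq> snd x + h"
  shows "\<exists>k. x \<in> cut_ellip \<alpha> h k"
proof -
  let ?z = "snd x + h"
  have d: "?z - par_quad \<alpha> (fst x) 0 > 0" using x by (auto simp: par_set_def)
  \<comment> \<open>The inequality q \<le> z - z^2/L solved for L.\<close>
  obtain k where k: "?z\<^sup>2 / (?z - par_quad \<alpha> (fst x) 0) < real (Suc k)"
    by (meson lessI less_imp_of_nat_less order.strict_trans reals_Archimedean2)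
  then have "?z\<^sup>2 / real (Suc k) \<le> ?z - par_quad \<alpha> (fst x) 0"
    using d by (simp add: field_simps)
  then show ?thesis by (intro exI[of _ k]) (simp add: ellip_cut[OF \<alpha>])
qed

lemma cut_indicator_tendsto:
  assumes \<alpha>: "\<forall>j. \<alpha> j > 0" and x: "par_quad \<alpha> (fst x) 0 \<noteq> snd x + h"
  shows "(\<lambda>k. indicator (cut_ellip \<alpha> h k) x :: real) \<longlonglongrightarrow> indicator (par_set \<alpha> h) x"
proof (cases "x \<in> par_set \<alpha> h")
  case True
  then obtain k where "x \<in> cut_ellip \<alpha> h k"
    using cut_exhaust[OF \<alpha> _ x] by blast
  then have "eventually (\<lambda>l. indicator (cut_ellip \<alpha> h l) x = (indicator (par_set \<alpha> h) x :: real)) sequentially"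
    using eventually_ge_at_top[of k] True cut_mono[OF \<alpha>, of k _ h] by (elim eventually_mono) (auto simp: indicator_def)
  then show ?thesis by (rule tendsto_eventually)
next
  case False
  then have "indicator (cut_ellip \<alpha> h k) x = (0::real)" for k
    using cut_subset[OF \<alpha>, of k h] by (auto simp: indicator_def)
  then show ?thesis using False by simp
qed

lemma newton_pot_par_set:
  fixes \<alpha> :: "'n::finite \<Rightarrow> real"
  assumes \<alpha>: "\<forall>j. \<alpha> j > 0" and n: "CARD('n) \<ge> 5"
  shows "newton_pot (par_set \<alpha> h) x = ennreal (par_pot \<alpha> h x)"
proof -
  have D: "DIM((real^'n) \<times> real) \<ge> 3" using n by simp
  let ?E = "cut_ellip \<alpha> h"
  let ?K = "\<lambda>y. ennreal (norm (x - y) powr (2 - real DIM((real^'n) \<times> real)))"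
  let ?a = "ennreal (newton_alpha TYPE((real^'n) \<times> real))"
  have [measurable]: "(\<lambda>y. norm (x - y) powr (2 - real DIM((real^'n) \<times> real))) \<in> borel_measurable borel"
    by measurable
  have U[measurable]: "(\<Union>k. ?E k) \<in> sets borel" by measurable
  have "(\<lambda>k. \<integral>\<^sup>+y. indicator (?E k) y * ?K y \<partial>lborel) \<longlonglongrightarrow> (\<integral>\<^sup>+y. indicator (\<Union>k. ?E k) y * ?K y \<partial>lborel)"
  proof (rule nn_integral_LIMSEQ)
    show "incseq (\<lambda>k y. indicator (?E k) y * ?K y)"
    proof (intro incseq_SucI le_funI mult_right_mono)
      fix k y
      show "indicator (?E k) y \<le> (indicator (?E (Suc k)) y :: ennreal)"
        using cut_mono[OF \<alpha>, of k "Suc k" h] by (auto simp: indicator_def)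
    qed simp
    fix y
    show "(\<lambda>k. indicator (?E k) y * ?K y) \<longlonglongrightarrow> indicator (\<Union>k. ?E k) y * ?K y"
    proof (cases "y \<in> (\<Union>k. ?E k)")
      case True
      then obtain k where "y \<in> ?E k" by blast
      then have "eventually (\<lambda>l. indicator (?E l) y * ?K y = indicator (\<Union>k. ?E k) y * ?K y) sequentially"
        using eventually_ge_at_top[of k] True cut_mono[OF \<alpha>, of k _ h] by (elim eventually_mono) (auto simp: indicator_def)
      then show ?thesis by (rule tendsto_eventually)
    next
      case False
      then have "indicator (?E k) y * ?K y = 0" for k by (auto simp: indicator_def)
      then show ?thesis using False by simp
    qed
  qed measurable
  also have "(\<integral>\<^sup>+y. indicator (\<Union>k. ?E k) y * ?K y \<partial>lborel) = (\<integral>\<^sup>+y. indicator (par_set \<alpha> h) y * ?K y \<partial>lborel)"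
  proof (rule nn_integral_cong_AE)
    show "AE y in lborel. indicator (\<Union>k. ?E k) y * ?K y = indicator (par_set \<alpha> h) y * ?K y"
      using par_boundary_null[of \<alpha> h]
    proof eventually_elim
      case (elim y)
      then have "y \<in> (\<Union>k. ?E k) \<longleftrightarrow> y \<in> par_set \<alpha> h"
        using cut_exhaust[OF \<alpha>, of y h] cut_subset[OF \<alpha>, of _ h] by blast
      then show ?case by (simp add: indicator_def)
    qed
  qed
  finally have "(\<lambda>k. ?a * (\<integral>\<^sup>+y. indicator (?E k) y * ?K y \<partial>lborel)) \<longlonglongrightarrow> ?a * (\<integral>\<^sup>+y. indicator (par_set \<alpha> h) y * ?K y \<partial>lborel)"
    by (intro ennreal_tendsto_cmult) auto
  then have "(\<lambda>k. newton_pot (?E k) x) \<longlonglongrightarrow> newton_pot (par_set \<alpha> h) x"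
    unfolding newton_pot_def nn_integral_completion .
  moreover have "newton_pot (?E k) x = ennreal (cut_pot \<alpha> h k x)" for k
    by (intro newton_pot_ellip cut_axes_pos[OF \<alpha>] D) simp
  moreover have "(\<lambda>k. ennreal (cut_pot \<alpha> h k x)) \<longlonglongrightarrow> ennreal (par_pot \<alpha> h x)"
    by (intro tendsto_ennrealI ell_pot_cut_tendsto[OF \<alpha> n])
  ultimately show ?thesis using LIMSEQ_unique by auto
qed

section \<open>The quadratic polynomial and the defect\<close>

lemma integrable_wt_div:
  fixes \<alpha> :: "'n::finite \<Rightarrow> real"
  assumes \<alpha>: "\<forall>j. \<alpha> j > 0" and n: "CARD('n) \<ge> 3"
  shows "integrable lborel (\<lambda>u. indicator {0..} u * (wt UNIV \<alpha> u / (\<alpha> j + u)))"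
proof (rule Bochner_Integration.integrable_bound)
  show "integrable lborel (\<lambda>u. 1 / \<alpha> j * (indicator {0..} u * wt UNIV \<alpha> u))"
    using \<alpha> n by (intro integrable_mult_right integrable_wt) auto
  show "AE u in lborel. norm (indicator {0..} u * (wt UNIV \<alpha> u / (\<alpha> j + u))) \<le> norm (1 / \<alpha> j * (indicator {0..} u * wt UNIV \<alpha> u))"
  proof (rule AE_I2)
    fix u :: real
    show "norm (indicator {0..} u * (wt UNIV \<alpha> u / (\<alpha> j + u))) \<le> norm (1 / \<alpha> j * (indicator {0..} u * wt UNIV \<alpha> u))"
    proof (cases "u \<ge> 0")
      case True
      have "wt UNIV \<alpha> u > 0" using \<alpha> True by (intro wt_pos) auto
      moreover have "\<alpha> j > 0" using \<alpha> by simp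
      ultimately show ?thesis using True by (simp add: frac_le divide_left_mono)
    qed simp
  qed
qed measurable

lemma integrable_par_quad:
  fixes \<alpha> :: "'n::finite \<Rightarrow> real"
  assumes \<alpha>: "\<forall>j. \<alpha> j > 0" and n: "CARD('n) \<ge> 3"
  shows "integrable lborel (\<lambda>u. indicator {0..} u * (wt UNIV \<alpha> u * par_quad \<alpha> x u))"
    and "(\<integral>u. indicator {0..} u * (wt UNIV \<alpha> u * par_quad \<alpha> x u) \<partial>lborel) / (4 * wt UNIV \<alpha> 0) = (\<Sum>j\<in>UNIV. ell_coeff \<alpha> j * (x $ j)\<^sup>2)"
proof -
  have e: "indicator {0..} u * (wt UNIV \<alpha> u * par_quad \<alpha> x u) = (\<Sum>j\<in>UNIV. (x $ j)\<^sup>2 * (indicator {0..} u * (wt UNIV \<alpha> u / (\<alpha> j + u))))" for u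
    unfolding par_quad_def sum_distrib_left by (intro sum.cong) auto
  show "integrable lborel (\<lambda>u. indicator {0..} u * (wt UNIV \<alpha> u * par_quad \<alpha> x u))"
    unfolding e by (intro Bochner_Integration.integrable_sum integrable_mult_right integrable_wt_div \<alpha> n)
  have "(\<integral>u. indicator {0..} u * (wt UNIV \<alpha> u * par_quad \<alpha> x u) \<partial>lborel) = (\<Sum>j\<in>UNIV. (x $ j)\<^sup>2 * (\<integral>u. indicator {0..} u * (wt UNIV \<alpha> u / (\<alpha> j + u)) \<partial>lborel))"
    unfolding e using integrable_wt_div[OF \<alpha> n]
    by (subst Bochner_Integration.integral_sum) (auto simp del: times_divide_eq_right)
  then show "(\<integral>u. indicator {0..} u * (wt UNIV \<alpha> u * par_quad \<alpha> x u) \<partial>lborel) / (4 * wt UNIV \<alpha> 0) = (\<Sum>j\<in>UNIV. ell_coeff \<alpha> j * (x $ j)\<^sup>2)"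
    by (simp add: ell_coeff_def sum_divide_distrib mult.commute)
qed

text \<open>The identity max 0 (a - q) = (a - q) + max 0 (q - a) is integrated against the weight;
  each of the three pieces is integrable.\<close>

lemma
  fixes \<alpha> :: "'n::finite \<Rightarrow> real"
  assumes \<alpha>: "\<forall>j. \<alpha> j > 0" and n: "CARD('n) \<ge> 5"
  shows integrable_par_defect: "integrable lborel (\<lambda>u. indicator {0..} u * (wt UNIV \<alpha> u * max 0 (par_quad \<alpha> (fst x) u - u / 4 - (snd x + h))))"
    and par_pot_eq: "par_pot \<alpha> h x = par_const \<alpha> + par_lin \<alpha> * (snd x + h) - (\<Sum>j\<in>UNIV. ell_coeff \<alpha> j * (fst x $ j)\<^sup>2) + par_defect \<alpha> h x"
proof -
  have n3: "CARD('n) \<ge> 3" using n by simp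
  let ?z = "snd x + h"
  let ?a = "\<lambda>u. indicator {0..} u * (wt UNIV \<alpha> u * (u / 4 + ?z))"
  let ?q = "\<lambda>u. indicator {0..} u * (wt UNIV \<alpha> u * par_quad \<alpha> (fst x) u)"
  let ?d = "\<lambda>u. indicator {0..} u * (wt UNIV \<alpha> u * max 0 (par_quad \<alpha> (fst x) u - u / 4 - ?z))"
  have ia: "integrable lborel ?a" by (rule integrable_wt_affine[OF \<alpha> n])
  have iq: "integrable lborel ?q" by (rule integrable_par_quad(1)[OF \<alpha> n3])
  have "integrable lborel (\<lambda>u. max 0 (?q u - ?a u))"
    by (intro integrable_max Bochner_Integration.integrable_diff ia iq) simp
  moreover have d: "max 0 (?q u - ?a u) = ?d u" for u
  proof (cases "u \<ge> 0")
    case True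
    have "wt UNIV \<alpha> u > 0" using \<alpha> True by (intro wt_pos) auto
    then have "max 0 (wt UNIV \<alpha> u * a - wt UNIV \<alpha> u * b) = wt UNIV \<alpha> u * max 0 (a - b)" for a b
      by (simp add: max_mult_distrib_left right_diff_distrib)
    then show ?thesis using True by (simp add: diff_diff_eq)
  qed simp
  ultimately show id: "integrable lborel ?d" by simp
  have "(\<integral>u. indicator {0..} u * (wt UNIV \<alpha> u * max 0 (u / 4 + ?z - par_quad \<alpha> (fst x) u)) \<partial>lborel) = (\<integral>u. ?a u - ?q u + ?d u \<partial>lborel)"
    by (intro Bochner_Integration.integral_cong) (auto simp: max_def algebra_simps)
  also have "\<dots> = (\<integral>u. ?a u \<partial>lborel) - (\<integral>u. ?q u \<partial>lborel) + (\<integral>u. ?d u \<partial>lborel)"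
    using ia iq id by simp
  finally show "par_pot \<alpha> h x = par_const \<alpha> + par_lin \<alpha> * ?z - (\<Sum>j\<in>UNIV. ell_coeff \<alpha> j * (fst x $ j)\<^sup>2) + par_defect \<alpha> h x"
    unfolding par_pot_def par_defect_def integral_wt_affine[OF \<alpha> n, symmetric] integrable_par_quad(2)[OF \<alpha> n3, symmetric]
    by (simp only: add_divide_distrib diff_divide_distrib)
qed

lemma par_defect_nonneg:
  assumes \<alpha>: "\<forall>j. \<alpha> j > 0"
  shows "par_defect \<alpha> h x \<ge> 0"
  unfolding par_defect_def using \<alpha> wt_pos[of UNIV \<alpha>]
  by (intro divide_nonneg_nonneg integral_nonneg_AE AE_I2) (auto simp: indicator_def less_imp_le)

lemma par_quad_antimono:
  assumes \<alpha>: "\<forall>j. \<alpha> j > 0" and "u \<ge> 0"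
  shows "par_quad \<alpha> x u \<le> par_quad \<alpha> x 0"
  unfolding par_quad_def using assms by (intro sum_mono divide_left_mono) (auto simp: add_pos_nonneg)

text \<open>On the paraboloid the integrand vanishes for all u >= 0, since \<open>par_quad\<close>
  decreases in u while u/4 + z increases. Off it the integrand is positive at u = 0, hence by
  continuity on an interval of positive length.\<close>

lemma par_defect_eq_0_iff:
  fixes \<alpha> :: "'n::finite \<Rightarrow> real"
  assumes \<alpha>: "\<forall>j. \<alpha> j > 0" and n: "CARD('n) \<ge> 5"
  shows "par_defect \<alpha> h x = 0 \<longleftrightarrow> x \<in> par_set \<alpha> h"
proof
  assume x: "x \<in> par_set \<alpha> h"
  have e: "indicator {0..} u * (wt UNIV \<alpha> u * max 0 (par_quad \<alpha> (fst x) u - u / 4 - (snd x + h))) = 0" for u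
  proof (cases "u \<ge> 0")
    case True
    then show ?thesis using par_quad_antimono[OF \<alpha> True, of "fst x"] x by (simp add: par_set_def)
  qed simp
  show "par_defect \<alpha> h x = 0" unfolding par_defect_def e by simp
next
  assume d: "par_defect \<alpha> h x = 0"
  show "x \<in> par_set \<alpha> h"
  proof (rule ccontr)
    assume "x \<notin> par_set \<alpha> h"
    then have g0: "par_quad \<alpha> (fst x) 0 - 0 / 4 - (snd x + h) > 0" by (simp add: par_set_def)
    let ?g = "\<lambda>u. par_quad \<alpha> (fst x) u - u / 4 - (snd x + h)"
    have c: "isCont ?g 0" unfolding par_quad_def using \<alpha> by (intro continuous_intros) (auto simp: less_imp_neq[THEN not_sym])
    have "(?g \<longlongrightarrow> ?g 0) (nhds 0)"
      by (rule iffD1[OF tendsto_at_iff_tendsto_nhds[of ?g 0] isContD[OF c]])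
    from order_tendstoD(1)[OF this g0] have "eventually (\<lambda>u. ?g u > 0) (nhds 0)" .
    then obtain e where e: "e > 0" "\<And>u. \<bar>u\<bar> < e \<Longrightarrow> ?g u > 0"
      by (auto simp: eventually_nhds_metric dist_real_def)
    have "(\<integral>u. indicator {0..} u * (wt UNIV \<alpha> u * max 0 (?g u)) \<partial>lborel) = 0"
      using d wt_pos[of UNIV \<alpha> 0] \<alpha> by (auto simp: par_defect_def)
    then have "AE u in lborel. indicator {0..} u * (wt UNIV \<alpha> u * max 0 (?g u)) = 0"
      by (subst (asm) integral_nonneg_eq_0_iff_AE[OF integrable_par_defect[OF \<alpha> n]])
        (use wt_pos[of UNIV \<alpha>] \<alpha> in \<open>auto simp: indicator_def less_imp_le\<close>)
    then have "AE u in lborel. u \<notin> {0..e/2}"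
    proof eventually_elim
      case (elim u)
      show ?case
      proof
        assume u: "u \<in> {0..e/2}"
        then have "?g u > 0" using e by (intro e(2)) auto
        moreover have "wt UNIV \<alpha> u > 0" using u \<alpha> by (intro wt_pos) auto
        ultimately show False using elim u by auto
      qed
    qed
    then have "{0..e/2} \<in> null_sets lborel" by (subst AE_iff_null_sets) auto
    then show False using e(1) by auto
  qed
qed

section \<open>The weak Laplace equation\<close>

lemma integrable_compact_support:
  fixes f :: "'a::euclidean_space \<Rightarrow> real"
  assumes "continuous_on UNIV f" "\<And>x. norm x > R \<Longrightarrow> f x = 0"
  shows "integrable lborel f"
proof -
  have "integrable lborel (\<lambda>x. indicator (cball 0 R) x *\<^sub>R f x)"
    by (rule borel_integrable_compact) (auto intro: continuous_on_subset[OF assms(1)])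
  moreover have "(\<lambda>x. indicator (cball 0 R) x *\<^sub>R f x) = f"
  proof
    show "indicator (cball 0 R) x *\<^sub>R f x = f x" for x
      using assms(2)[of x] by (cases "norm x > R") auto
  qed
  ultimately show ?thesis by (simp only:)
qed

lemma bounded_compact_support:
  fixes f :: "'a::euclidean_space \<Rightarrow> real"
  assumes "continuous_on UNIV f" "\<And>x. norm x > R \<Longrightarrow> f x = 0"
  shows "\<exists>M. \<forall>x. \<bar>f x\<bar> \<le> M"
proof -
  have "bounded (f ` cball 0 R)"
    by (intro compact_imp_bounded compact_continuous_image continuous_on_subset[OF assms(1)]) auto
  then obtain M where M: "\<And>x. norm x \<le> R \<Longrightarrow> \<bar>f x\<bar> \<le> M"
    unfolding bounded_iff by (metis image_eqI mem_cball_0 real_norm_def)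
  have "\<bar>f x\<bar> \<le> max M 0" for x
  proof (cases "norm x > R")
    case False
    then have "\<bar>f x\<bar> \<le> M" by (intro M) simp
    then show ?thesis by simp
  qed (simp add: assms(2))
  then show ?thesis by blast
qed

text \<open>Green's identity for the cut ellipsoids passes to the limit: compact support turns the
  linear growth bound into a constant that holds for all cuts.\<close>

lemma par_green:
  fixes \<alpha> :: "'n::finite \<Rightarrow> real"
  assumes \<alpha>: "\<forall>j. \<alpha> j > 0" and n: "CARD('n) \<ge> 5" and C2: "C2_data \<phi> g k"
    and supp: "\<And>x. norm x > R \<Longrightarrow> \<phi> x = 0" "\<And>x i. norm x > R \<Longrightarrow> i \<in> Basis \<Longrightarrow> k i x = 0"
  shows "(\<integral>y. indicator (par_set \<alpha> h) y * \<phi> y \<partial>lborel) = - (\<integral>y. (\<Sum>i\<in>Basis. k i y) * par_pot \<alpha> h y \<partial>lborel)"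
proof -
  have D: "DIM((real^'n) \<times> real) \<ge> 3" using n by simp
  define L where "L y = (\<Sum>i\<in>Basis. k i y)" for y
  have c\<phi>: "continuous_on UNIV \<phi>" by (rule C2_data_continuous[OF C2])
  have cL: "continuous_on UNIV L"
    unfolding L_def[abs_def] using C2 by (intro continuous_on_sum) (auto simp: C2_data_def)
  have L0: "L x = 0" if "norm x > R" for x using supp(2)[OF that] by (simp add: L_def)
  have [measurable]: "\<phi> \<in> borel_measurable borel" "L \<in> borel_measurable borel"
    using c\<phi> cL by (auto intro: borel_measurable_continuous_onI)
  note [measurable] = par_pot_measurable[OF \<alpha> n]
  note compact_int = integrable_compact_support[where R = R]
  obtain M where M: "\<And>x. \<bar>\<phi> x\<bar> \<le> M" using bounded_compact_support[OF c\<phi> supp(1)] by blast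
  have lim: "(\<phi> \<longlongrightarrow> 0) at_infinity"
    by (rule tendsto_eventually) (auto simp: eventually_at_infinity intro!: exI[of _ "R + 1"] supp(1))
  let ?E = "cut_ellip \<alpha> h"
  let ?V = "cut_pot \<alpha> h"
  have Vm[measurable]: "?V l \<in> borel_measurable borel" for l
    by (intro borel_measurable_continuous_onI continuous_on_ell_pot cut_axes_pos[OF \<alpha>] D) simp
  have eq: "(\<integral>y. indicator (?E l) y * \<phi> y \<partial>lborel) = - (\<integral>y. L y * ?V l y \<partial>lborel)" for l
    unfolding L_def using compact_int[OF cL L0]
    by (intro ellipsoid_green[OF C2 _ D M lim] cut_axes_pos[OF \<alpha>]) (auto simp: L_def[abs_def])
  have lim1: "(\<lambda>l. \<integral>y. indicator (?E l) y * \<phi> y \<partial>lborel) \<longlonglongrightarrow> (\<integral>y. indicator (par_set \<alpha> h) y * \<phi> y \<partial>lborel)"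
  proof (rule integral_dominated_convergence[where w = "\<lambda>y. \<bar>\<phi> y\<bar>"])
    show "integrable lborel (\<lambda>y. \<bar>\<phi> y\<bar>)" using compact_int[OF c\<phi> supp(1)] by simp
    show "AE y in lborel. (\<lambda>l. indicator (?E l) y * \<phi> y) \<longlonglongrightarrow> indicator (par_set \<alpha> h) y * \<phi> y"
      using par_boundary_null[of \<alpha> h] by eventually_elim (intro tendsto_mult tendsto_const cut_indicator_tendsto[OF \<alpha>])
  qed (auto simp: indicator_def)
  \<comment> \<open>Neither R nor h has a known sign, hence the absolute values.\<close>
  let ?C = "par_const \<alpha> + \<bar>par_lin \<alpha>\<bar> * (\<bar>R\<bar> + \<bar>h\<bar>)"
  have lim2: "(\<lambda>l. \<integral>y. L y * ?V l y \<partial>lborel) \<longlonglongrightarrow> (\<integral>y. L y * par_pot \<alpha> h y \<partial>lborel)"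
  proof (rule integral_dominated_convergence[where w = "\<lambda>y. \<bar>L y\<bar> * ?C"])
    show "integrable lborel (\<lambda>y. \<bar>L y\<bar> * ?C)" using compact_int[OF cL L0] by simp
    show "AE y in lborel. (\<lambda>l. L y * ?V l y) \<longlonglongrightarrow> L y * par_pot \<alpha> h y"
      by (intro AE_I2 tendsto_mult tendsto_const ell_pot_cut_tendsto[OF \<alpha> n])
    show "AE y in lborel. norm (L y * ?V l y) \<le> \<bar>L y\<bar> * ?C" for l
    proof (rule AE_I2)
      fix y
      show "norm (L y * ?V l y) \<le> \<bar>L y\<bar> * ?C"
      proof (cases "norm y > R")
        case False
        have "\<bar>snd y\<bar> \<le> norm y" using norm_snd_le[of "snd y" "fst y"] by simp
        then have "\<bar>snd y + h\<bar> \<le> \<bar>R\<bar> + \<bar>h\<bar>" using False by linarith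
        then have "par_lin \<alpha> * \<bar>snd y + h\<bar> \<le> \<bar>par_lin \<alpha>\<bar> * (\<bar>R\<bar> + \<bar>h\<bar>)"
          by (intro mult_mono) auto
        then have "?V l y \<le> ?C"
          using ell_pot_cut_le[OF \<alpha> n, of "real (Suc l)" h y] by auto
        moreover have "?V l y \<ge> 0" by (intro ell_pot_nonneg cut_axes_pos[OF \<alpha>]) simp
        ultimately show ?thesis by (auto simp: abs_mult intro!: mult_left_mono)
      qed (simp add: L0)
    qed
  qed measurable
  have "(\<integral>y. indicator (par_set \<alpha> h) y * \<phi> y \<partial>lborel) = - (\<integral>y. L y * par_pot \<alpha> h y \<partial>lborel)"
    by (rule LIMSEQ_unique[OF lim1]) (unfold eq, intro tendsto_minus lim2)
  then show ?thesis by (simp only: L_def)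
qed

lemma frechet_derivative_zero_on_open:
  assumes "open U" "\<And>x. x \<in> U \<Longrightarrow> f x = 0" "x \<in> U"
  shows "frechet_derivative f (at x) v = 0"
proof -
  have "(f has_derivative (\<lambda>_. 0)) (at x)"
    by (rule has_derivative_transform_within_open[OF has_derivative_const assms(1,3)]) (simp add: assms(2))
  then have "(\<lambda>_. 0) = frechet_derivative f (at x)" by (rule frechet_derivative_at)
  then show ?thesis by metis
qed

lemma test_fun_C2_data:
  assumes "test_fun \<phi>"
  shows "C2_data \<phi> (\<lambda>i. dd [i] \<phi>) (\<lambda>i. dd [i, i] \<phi>)"
  unfolding C2_data_def
proof (intro conjI allI ballI)
  have dif: "dd vs \<phi> differentiable (at x)" for vs x using assms by (simp add: test_fun_def)
  fix x
  have d: "(\<phi> has_derivative frechet_derivative \<phi> (at x)) (at x)"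
    using dif[of "[]" x] by (simp add: frechet_derivative_works)
  then have lin: "linear (frechet_derivative \<phi> (at x))" by (rule has_derivative_linear)
  have "frechet_derivative \<phi> (at x) v = (\<Sum>i\<in>Basis. (v \<bullet> i) * dd [i] \<phi> x)" for v
  proof -
    have "frechet_derivative \<phi> (at x) v = frechet_derivative \<phi> (at x) (\<Sum>i\<in>Basis. (v \<bullet> i) *\<^sub>R i)"
      by (simp add: euclidean_representation)
    also have "\<dots> = (\<Sum>i\<in>Basis. (v \<bullet> i) * frechet_derivative \<phi> (at x) i)"
      unfolding linear_sum[OF lin] by (simp add: linear_scale[OF lin])
    finally show ?thesis by simp
  qed
  then show "(\<phi> has_derivative (\<lambda>v. \<Sum>i\<in>Basis. (v \<bullet> i) * dd [i] \<phi> x)) (at x)"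
    using d by presburger
  fix i :: 'a
  have "((\<lambda>t::real. x + t *\<^sub>R i) has_derivative (\<lambda>t. t *\<^sub>R i)) (at 0)"
    by (auto intro!: derivative_eq_intros)
  moreover have "(dd [i] \<phi> has_derivative frechet_derivative (dd [i] \<phi>) (at x)) (at (x + 0 *\<^sub>R i))"
    using dif[of "[i]" x] by (simp only: frechet_derivative_works scaleR_zero_left add_0_right)
  ultimately have *: "((\<lambda>t. dd [i] \<phi> (x + t *\<^sub>R i)) has_derivative (\<lambda>t. frechet_derivative (dd [i] \<phi>) (at x) (t *\<^sub>R i))) (at 0)"
    by (rule has_derivative_compose)
  have "linear (frechet_derivative (dd [i] \<phi>) (at x))"
    using dif[of "[i]" x] by (rule linear_frechet_derivative)
  then have eq: "frechet_derivative (dd [i] \<phi>) (at x) (t *\<^sub>R i) = dd [i, i] \<phi> x * t" for t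
    by (simp add: linear_scale)
  show "((\<lambda>t. dd [i] \<phi> (x + t *\<^sub>R i)) has_real_derivative dd [i, i] \<phi> x) (at 0)"
    using * unfolding has_field_derivative_def eq .
qed (use assms in \<open>auto simp only: test_fun_def\<close>)

text \<open>Vanishing on the open exterior of a ball is inherited by all derivatives there, so one
  radius serves every \<open>dd vs \<phi>\<close>.\<close>

lemma test_fun_support:
  assumes "test_fun \<phi>"
  obtains R where "\<And>vs x. norm x > R \<Longrightarrow> dd vs \<phi> x = 0"
proof -
  have "bounded (closure {x. \<phi> x \<noteq> 0})" using assms by (auto simp: test_fun_def compact_imp_bounded)
  then obtain R where R: "\<And>x. x \<in> closure {x. \<phi> x \<noteq> 0} \<Longrightarrow> norm x \<le> R" by (auto simp: bounded_iff)
  have \<phi>0: "\<phi> x = 0" if "norm x > R" for x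
  proof (rule ccontr)
    assume "\<phi> x \<noteq> 0"
    then have "x \<in> {x. \<phi> x \<noteq> 0}" by simp
    then have "norm x \<le> R" by (intro R subsetD[OF closure_subset])
    then show False using that by simp
  qed
  have o: "open {x::'a. norm x > R}" by (intro open_Collect_less continuous_intros)
  have "dd vs \<phi> x = 0" if "norm x > R" for vs x
    using that
  proof (induction vs arbitrary: x)
    case (Cons v vs)
    then show ?case
      using frechet_derivative_zero_on_open[OF o, of "dd vs \<phi>" x v] by simp
  qed (simp add: \<phi>0)
  then show ?thesis using that by blast
qed

lemma integral_by_parts_compact:
  fixes f \<rho> :: "'a::euclidean_space \<Rightarrow> real"
  assumes "continuous_on UNIV f" "continuous_on UNIV f'" "continuous_on UNIV \<rho>" "continuous_on UNIV \<rho>'"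
    and df: "\<And>x. ((\<lambda>t. f (x + t *\<^sub>R v)) has_real_derivative f' x) (at 0)"
    and d\<rho>: "\<And>x. ((\<lambda>t. \<rho> (x + t *\<^sub>R v)) has_real_derivative \<rho>' x) (at 0)"
    and supp: "\<And>x. norm x > R \<Longrightarrow> \<rho> x = 0" "\<And>x. norm x > R \<Longrightarrow> \<rho>' x = 0"
  shows "(\<integral>x. f' x * \<rho> x \<partial>lborel) = - (\<integral>x. f x * \<rho>' x \<partial>lborel)"
proof -
  obtain M where M: "\<And>x. \<bar>\<rho> x\<bar> \<le> M" using bounded_compact_support[OF assms(3) supp(1)] by blast
  obtain K where K: "\<And>x. \<bar>\<rho>' x\<bar> \<le> K" using bounded_compact_support[OF assms(4) supp(2)] by blast
  have lip: "\<bar>\<rho> (x + t *\<^sub>R v) - \<rho> x\<bar> \<le> K * \<bar>t\<bar>" for x t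
  proof -
    have "norm (\<rho> (x + t *\<^sub>R v) - \<rho> (x + 0 *\<^sub>R v)) \<le> K * norm (t - 0)"
      by (rule field_differentiable_bound[where S = UNIV and f' = "\<lambda>t. \<rho>' (x + t *\<^sub>R v)"])
        (use line_derivative_shift[OF d\<rho>] K in auto)
    then show ?thesis by simp
  qed
  show ?thesis
    by (rule integral_by_parts_direction[OF assms(1,2) line_derivative_shift[OF df] _ _ supp(1) M lip])
      (use assms(3,4) d\<rho> in \<open>auto intro: borel_measurable_continuous_onI\<close>)
qed

lemma C2_data_line_derivative:
  assumes "C2_data p g h" "i \<in> Basis"
  shows "((\<lambda>t. p (x + t *\<^sub>R i)) has_real_derivative g i x) (at 0)"
proof -
  have "((\<lambda>t::real. x + t *\<^sub>R i) has_derivative (\<lambda>t. t *\<^sub>R i)) (at 0)"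
    by (auto intro!: derivative_eq_intros)
  moreover have "(p has_derivative (\<lambda>v. \<Sum>j\<in>Basis. (v \<bullet> j) * g j x)) (at (x + 0 *\<^sub>R i))"
    using assms(1) by (simp add: C2_data_def)
  ultimately have "((\<lambda>t. p (x + t *\<^sub>R i)) has_derivative (\<lambda>t. \<Sum>j\<in>Basis. ((t *\<^sub>R i) \<bullet> j) * g j x)) (at 0)"
    by (rule has_derivative_compose)
  moreover have "(\<Sum>j\<in>Basis. ((t *\<^sub>R i) \<bullet> j) * g j x) = g i x * t" for t
  proof -
    have "(\<Sum>j\<in>Basis. ((t *\<^sub>R i) \<bullet> j) * g j x) = (\<Sum>j\<in>Basis. if j = i then t * g i x else 0)"
      using assms(2) by (intro sum.cong) (auto simp: inner_Basis)
    then show ?thesis using assms(2) by simp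
  qed
  ultimately show ?thesis unfolding has_field_derivative_def by simp
qed

text \<open>Two integrations by parts in each coordinate. All decay comes from the test function, so
  the polynomial part of u may grow.\<close>

lemma green_test_fun:
  fixes p :: "'a::euclidean_space \<Rightarrow> real"
  assumes p: "C2_data p g h" and \<phi>: "test_fun \<phi>"
  shows "(\<integral>x. p x * laplacian \<phi> x \<partial>lborel) = (\<integral>x. (\<Sum>i\<in>Basis. h i x) * \<phi> x \<partial>lborel)"
proof -
  obtain R where R: "\<And>vs x. norm x > R \<Longrightarrow> dd vs \<phi> x = 0" using test_fun_support[OF \<phi>] by blast
  have C\<phi>: "C2_data \<phi> (\<lambda>i. dd [i] \<phi>) (\<lambda>i. dd [i, i] \<phi>)" by (rule test_fun_C2_data[OF \<phi>])
  have cd: "continuous_on UNIV (dd vs \<phi>)" for vs using \<phi> by (simp add: test_fun_def)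
  have c\<phi>: "continuous_on UNIV \<phi>" using cd[of "[]"] by simp
  have cp: "continuous_on UNIV p" by (rule C2_data_continuous[OF p])
  have cg: "continuous_on UNIV (g i)" and ch: "continuous_on UNIV (h i)" if "i \<in> Basis" for i
    using p that by (auto simp: C2_data_def)
  have int: "integrable lborel (\<lambda>x. f x * dd vs \<phi> x)" if "continuous_on UNIV f" for f vs
    by (rule integrable_compact_support[where R = R]) (use R in \<open>auto intro!: continuous_intros that cd\<close>)
  have e: "(\<integral>x. p x * dd [i, i] \<phi> x \<partial>lborel) = (\<integral>x. h i x * \<phi> x \<partial>lborel)" if i: "i \<in> Basis" for i
  proof -
    have "(\<integral>x. g i x * dd [i] \<phi> x \<partial>lborel) = - (\<integral>x. p x * dd [i, i] \<phi> x \<partial>lborel)"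
      by (rule integral_by_parts_compact[OF cp cg[OF i] cd cd C2_data_line_derivative[OF p i] _ R R])
        (use C\<phi> i in \<open>simp only: C2_data_def\<close>)
    moreover have "(\<integral>x. h i x * dd [] \<phi> x \<partial>lborel) = - (\<integral>x. g i x * dd [i] \<phi> x \<partial>lborel)"
      by (rule integral_by_parts_compact[OF cg[OF i] ch[OF i] cd cd _ _ R R, where v = i])
        (use C2_data_line_derivative[OF C\<phi> i] p i in \<open>auto simp only: C2_data_def dd.simps(1)\<close>)
    ultimately show ?thesis by simp
  qed
  have "(\<integral>x. p x * laplacian \<phi> x \<partial>lborel) = (\<integral>x. (\<Sum>i\<in>Basis. p x * dd [i, i] \<phi> x) \<partial>lborel)"
    by (simp only: laplacian_def sum_distrib_left)
  also have "\<dots> = (\<Sum>i\<in>Basis. (\<integral>x. p x * dd [i, i] \<phi> x \<partial>lborel))"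
    by (rule Bochner_Integration.integral_sum) (rule int[OF cp])
  also have "\<dots> = (\<Sum>i\<in>Basis. (\<integral>x. h i x * \<phi> x \<partial>lborel))"
    by (intro sum.cong refl e)
  also have "\<dots> = (\<integral>x. (\<Sum>i\<in>Basis. h i x * \<phi> x) \<partial>lborel)"
    by (rule Bochner_Integration.integral_sum[symmetric]) (use int[OF ch, of _ "[]"] in simp)
  finally show ?thesis by (simp only: sum_distrib_right)
qed

lemma integrable_mult_par_pot:
  fixes \<alpha> :: "'n::finite \<Rightarrow> real"
  assumes \<alpha>: "\<forall>j. \<alpha> j > 0" and n: "CARD('n) \<ge> 5"
    and f: "continuous_on UNIV f" "\<And>x. norm x > R \<Longrightarrow> f x = 0"
  shows "integrable lborel (\<lambda>x. f x * par_pot \<alpha> h x)"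
proof -
  note [measurable] = par_pot_measurable[OF \<alpha> n]
  have [measurable]: "f \<in> borel_measurable borel" by (rule borel_measurable_continuous_onI[OF f(1)])
  have "integrable lborel (\<lambda>x. indicator (cball 0 R) x *\<^sub>R (f x * (par_const \<alpha> + par_lin \<alpha> * \<bar>snd x + h\<bar>)))"
    by (intro borel_integrable_compact continuous_intros continuous_on_subset[OF f(1)]) auto
  then show ?thesis
  proof (rule Bochner_Integration.integrable_bound)
    show "AE x in lborel. norm (f x * par_pot \<alpha> h x) \<le> norm (indicator (cball 0 R) x *\<^sub>R (f x * (par_const \<alpha> + par_lin \<alpha> * \<bar>snd x + h\<bar>)))"
    proof (rule AE_I2)
      fix x
      show "norm (f x * par_pot \<alpha> h x) \<le> norm (indicator (cball 0 R) x *\<^sub>R (f x * (par_const \<alpha> + par_lin \<alpha> * \<bar>snd x + h\<bar>)))"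
      proof (cases "norm x > R")
        case False
        have "\<bar>par_pot \<alpha> h x\<bar> \<le> \<bar>par_const \<alpha> + par_lin \<alpha> * \<bar>snd x + h\<bar>\<bar>"
          using par_pot_le[OF \<alpha> n, of h x] par_pot_nonneg[OF \<alpha> n, of h x] by linarith
        then show ?thesis using False by (simp add: abs_mult mult_left_mono)
      qed (simp add: f(2))
    qed
  qed measurable
qed

text \<open>The smooth part contributes the constant 1 and the potential contributes minus the
  indicator of the paraboloid; together they give the indicator of the complement.\<close>

lemma weak_laplace_par_pot:
  fixes \<alpha> :: "'n::finite \<Rightarrow> real"
  assumes \<alpha>: "\<forall>j. \<alpha> j > 0" and n: "CARD('n) \<ge> 5"
    and p: "C2_data p g k" and k: "\<And>x. (\<Sum>i\<in>Basis. k i x) = 1"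
  shows "weak_laplace_eq (\<lambda>x. p x + par_pot \<alpha> h x) (indicator (- par_set \<alpha> h))"
  unfolding weak_laplace_eq_def
proof (intro conjI allI impI)
  let ?V = "par_pot \<alpha> h" and ?S = "- par_set \<alpha> h :: ((real^'n) \<times> real) set"
  have cp: "continuous_on UNIV p" by (rule C2_data_continuous[OF p])
  have [measurable]: "p \<in> borel_measurable borel" by (rule borel_measurable_continuous_onI[OF cp])
  note [measurable] = par_pot_measurable[OF \<alpha> n]
  have [measurable]: "?S \<in> sets borel" by measurable
  fix K :: "((real^'n) \<times> real) set" assume K: "compact K"
  then have Km[measurable]: "K \<in> sets borel" by (simp add: compact_imp_closed)
  have fin: "emeasure lborel K < \<infinity>" using K by (intro emeasure_bounded_finite compact_imp_bounded)
  show "set_integrable lebesgue K (indicator ?S :: _ \<Rightarrow> real)"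
    unfolding set_integrable_def
  proof (subst integrable_completion)
    show "integrable lborel (\<lambda>x. indicator K x *\<^sub>R (indicator ?S x :: real))"
      by (rule Bochner_Integration.integrable_bound[OF integrable_real_indicator[OF _ fin]]) (auto simp: indicator_def)
  qed measurable
  obtain R where R: "\<And>x. x \<in> K \<Longrightarrow> norm x \<le> R" using compact_imp_bounded[OF K] by (auto simp: bounded_iff)
  have i1: "integrable lborel (\<lambda>x. indicator K x *\<^sub>R p x)"
    by (rule borel_integrable_compact[OF K continuous_on_subset[OF cp]]) simp
  \<comment> \<open>This hat function is continuous, compactly supported and at least 1 on K, so it
    stands in for the discontinuous indicator of K.\<close>
  have "integrable lborel (\<lambda>x. max 0 (R + 1 - norm x) * ?V x)"
    by (rule integrable_mult_par_pot[OF \<alpha> n, where R = "R + 1"]) (auto intro!: continuous_intros)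
  then have i2: "integrable lborel (\<lambda>x. indicator K x *\<^sub>R ?V x)"
  proof (rule Bochner_Integration.integrable_bound)
    show "AE x in lborel. norm (indicator K x *\<^sub>R ?V x) \<le> norm (max 0 (R + 1 - norm x) * ?V x)"
    proof (rule AE_I2)
      fix x
      show "norm (indicator K x *\<^sub>R ?V x) \<le> norm (max 0 (R + 1 - norm x) * ?V x)"
      proof (cases "x \<in> K")
        case True
        then have "max 0 (R + 1 - norm x) \<ge> 1" using R[OF True] by simp
        then have "1 * \<bar>?V x\<bar> \<le> \<bar>max 0 (R + 1 - norm x)\<bar> * \<bar>?V x\<bar>" by (intro mult_right_mono) auto
        then show ?thesis using True by (simp add: abs_mult)
      qed simp
    qed
  qed measurable
  show "set_integrable lebesgue K (\<lambda>x. p x + ?V x)"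
    unfolding set_integrable_def
  proof (subst integrable_completion)
    show "integrable lborel (\<lambda>x. indicator K x *\<^sub>R (p x + ?V x))"
      using Bochner_Integration.integrable_add[OF i1 i2] by (simp add: algebra_simps)
  qed measurable
next
  fix \<phi> :: "(real^'n) \<times> real \<Rightarrow> real" assume \<phi>: "test_fun \<phi>"
  let ?V = "par_pot \<alpha> h" and ?S = "- par_set \<alpha> h :: ((real^'n) \<times> real) set"
  note [measurable] = par_pot_measurable[OF \<alpha> n]
  have cp: "continuous_on UNIV p" by (rule C2_data_continuous[OF p])
  obtain R where R: "\<And>vs x. norm x > R \<Longrightarrow> dd vs \<phi> x = 0" using test_fun_support[OF \<phi>] by blast
  have C\<phi>: "C2_data \<phi> (\<lambda>i. dd [i] \<phi>) (\<lambda>i. dd [i, i] \<phi>)" by (rule test_fun_C2_data[OF \<phi>])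
  have cd: "continuous_on UNIV (dd vs \<phi>)" for vs using \<phi> by (simp add: test_fun_def)
  have c\<phi>: "continuous_on UNIV \<phi>" using cd[of "[]"] by simp
  have cL: "continuous_on UNIV (laplacian \<phi>)" unfolding laplacian_def[abs_def] by (intro continuous_on_sum cd)
  have L0: "laplacian \<phi> x = 0" if "norm x > R" for x
    unfolding laplacian_def by (intro sum.neutral ballI R that)
  have [measurable]: "p \<in> borel_measurable borel" "\<phi> \<in> borel_measurable borel" "laplacian \<phi> \<in> borel_measurable borel"
    using cp c\<phi> cL by (auto intro: borel_measurable_continuous_onI)
  note compact_int = integrable_compact_support[where R = R]
  have i1: "integrable lborel (\<lambda>x. p x * laplacian \<phi> x)"
    by (rule compact_int) (use L0 in \<open>auto intro!: continuous_intros cp cL\<close>)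
  have i2: "integrable lborel (\<lambda>x. ?V x * laplacian \<phi> x)"
    using integrable_mult_par_pot[OF \<alpha> n cL L0, where h = h] by (simp only: mult.commute)
  have i3: "integrable lborel \<phi>" using compact_int[OF c\<phi>] R[of _ "[]"] by simp
  have i4: "integrable lborel (\<lambda>x. indicator (par_set \<alpha> h) x * \<phi> x)"
    by (rule Bochner_Integration.integrable_bound[OF i3]) (auto simp: indicator_def)
  have "(\<integral>x. (p x + ?V x) * laplacian \<phi> x \<partial>lebesgue) = (\<integral>x. (p x + ?V x) * laplacian \<phi> x \<partial>lborel)"
    by (rule integral_completion) measurable
  also have "\<dots> = (\<integral>x. p x * laplacian \<phi> x \<partial>lborel) + (\<integral>x. ?V x * laplacian \<phi> x \<partial>lborel)"
    using Bochner_Integration.integral_add[OF i1 i2] by (simp add: distrib_right)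
  also have "(\<integral>x. p x * laplacian \<phi> x \<partial>lborel) = (\<integral>x. \<phi> x \<partial>lborel)"
    unfolding green_test_fun[OF p \<phi>] k by simp
  also have "(\<integral>x. ?V x * laplacian \<phi> x \<partial>lborel) = - (\<integral>x. indicator (par_set \<alpha> h) x * \<phi> x \<partial>lborel)"
    using par_green[OF \<alpha> n C\<phi>, where R = R and h = h] R[of _ "[]"] R
    by (simp add: laplacian_def mult.commute del: dd.simps(2))
  also have "(\<integral>x. \<phi> x \<partial>lborel) + - (\<integral>x. indicator (par_set \<alpha> h) x * \<phi> x \<partial>lborel) = (\<integral>x. \<phi> x - indicator (par_set \<alpha> h) x * \<phi> x \<partial>lborel)"
    using Bochner_Integration.integral_diff[OF i3 i4] by simp
  also have "\<dots> = (\<integral>x. indicator ?S x * \<phi> x \<partial>lborel)"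
    by (intro Bochner_Integration.integral_cong) (auto simp: indicator_def)
  also have "\<dots> = (\<integral>x. indicator ?S x * \<phi> x \<partial>lebesgue)"
    by (rule integral_completion[symmetric]) measurable
  finally show "(\<integral>x. (p x + ?V x) * laplacian \<phi> x \<partial>lebesgue) = (\<integral>x. indicator ?S x * \<phi> x \<partial>lebesgue)" .
qed

section \<open>Ellipsoids with prescribed coefficients\<close>

lemma wt_update:
  fixes \<alpha> :: "'n::finite \<Rightarrow> real"
  assumes \<alpha>: "\<forall>j. \<alpha> j > 0" and s: "s \<ge> 0"
  shows "wt UNIV (\<alpha>(j := v)) s = wt UNIV \<alpha> s * sqrt (\<alpha> j + s) * (1 / sqrt (v + s))"
proof -
  have U: "(UNIV :: 'n set) = insert j (UNIV - {j})" by auto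
  have "\<alpha> j + s > 0" using \<alpha> s by (simp add: add_pos_nonneg)
  then have nz: "sqrt (\<alpha> j + s) \<noteq> 0" by simp
  have 1: "wt UNIV (\<alpha>(j := v)) s = (1 / sqrt (v + s)) * wt (UNIV - {j}) \<alpha> s"
    unfolding wt_def by (subst U, subst prod.insert) (auto intro!: prod.cong)
  have 2: "wt UNIV \<alpha> s = (1 / sqrt (\<alpha> j + s)) * wt (UNIV - {j}) \<alpha> s"
    unfolding wt_def by (subst U, subst prod.insert) auto
  show ?thesis unfolding 1 2 using nz by simp
qed

text \<open>Rationalising removes the vanishing denominator t, so that both the limit -1 / (2 r) and
  an integrable majorant can be read off.\<close>

lemma inverse_sqrt_quotient:
  assumes "r > 0" "r + t > 0" "t \<noteq> 0"
  shows "sqrt r * (1 / sqrt (r + t) - 1 / sqrt r) / t = - 1 / ((sqrt r + sqrt (r + t)) * sqrt (r + t))"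
proof -
  let ?a = "sqrt r" and ?b = "sqrt (r + t)"
  have a: "?a > 0" "?b > 0" using assms by auto
  have t: "t = (?b - ?a) * (?a + ?b)" using assms by (simp add: algebra_simps)
  have ne: "?b - ?a \<noteq> 0" using t assms(3) by auto
  have "?a * (1 / ?b - 1 / ?a) = - ((?b - ?a) / ?b)" using a by (simp add: field_simps)
  then have "?a * (1 / ?b - 1 / ?a) / t = - ((?b - ?a) / ?b) / ((?b - ?a) * (?a + ?b))" using t by simp
  also have "\<dots> = - 1 / ((?a + ?b) * ?b)"
  proof -
    have "- (x / b) / (x * c) = - 1 / (c * b)" if "x \<noteq> 0" "b > 0" "c > 0" for x b c :: real
      using that by (simp add: field_simps)
    then show ?thesis using ne a by simp
  qed
  finally show ?thesis .
qed

definition wt_int :: "('n::finite \<Rightarrow> real) \<Rightarrow> real" where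
  "wt_int \<alpha> = (\<integral>s. indicator {0..} s * wt UNIV \<alpha> s \<partial>lborel)"

text \<open>Minus twice the partial derivative of \<open>wt_int\<close> in its j-th
  argument.\<close>

definition wt_div_int :: "('n::finite \<Rightarrow> real) \<Rightarrow> 'n \<Rightarrow> real" where
  "wt_div_int \<alpha> j = (\<integral>s. indicator {0..} s * (wt UNIV \<alpha> s / (\<alpha> j + s)) \<partial>lborel)"

text \<open>Differentiation under the integral sign. The condition that \<open>t k\<close> is at
  most half of \<alpha>_j in modulus keeps \<alpha>_j + s + t_k above (\<alpha>_j + s)/2 and so
  provides the majorant. Working along sequences of either sign yields the one-sided conditions at a
  minimiser on a closed cube.\<close>

lemma wt_int_quotient_tendsto:
  fixes \<alpha> :: "'n::finite \<Rightarrow> real"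
  assumes \<alpha>: "\<forall>j. \<alpha> j > 0" and n: "CARD('n) \<ge> 3"
    and t: "t \<longlonglongrightarrow> 0" "\<And>k. t k \<noteq> 0" "\<And>k. \<bar>t k\<bar> \<le> \<alpha> j / 2"
  shows "(\<lambda>k. (wt_int (\<alpha>(j := \<alpha> j + t k)) - wt_int \<alpha>) / t k) \<longlonglongrightarrow> - wt_div_int \<alpha> j / 2"
proof -
  have aj: "\<alpha> j > 0" using \<alpha> by simp
  have pos: "\<forall>i. (\<alpha>(j := \<alpha> j + t k)) i > 0" for k
  proof -
    have "\<alpha> j + t k > 0" using t(3)[of k] aj by linarith
    then show ?thesis using \<alpha> by simp
  qed
  let ?q = "\<lambda>k s. indicator {0..} s * (wt UNIV \<alpha> s * (- 1 / ((sqrt (\<alpha> j + s) + sqrt (\<alpha> j + s + t k)) * sqrt (\<alpha> j + s + t k))))"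
  have q: "(wt_int (\<alpha>(j := \<alpha> j + t k)) - wt_int \<alpha>) / t k = (\<integral>s. ?q k s \<partial>lborel)" for k
  proof -
    have "(wt_int (\<alpha>(j := \<alpha> j + t k)) - wt_int \<alpha>) / t k
      = (\<integral>s. (indicator {0..} s * wt UNIV (\<alpha>(j := \<alpha> j + t k)) s - indicator {0..} s * wt UNIV \<alpha> s) / t k \<partial>lborel)"
      unfolding wt_int_def using \<alpha> pos[of k] n integrable_wt[of UNIV \<alpha>] integrable_wt[of UNIV "\<alpha>(j := \<alpha> j + t k)"] by simp
    also have "\<dots> = (\<integral>s. ?q k s \<partial>lborel)"
    proof (rule Bochner_Integration.integral_cong[OF refl])
      fix s :: real
      show "(indicator {0..} s * wt UNIV (\<alpha>(j := \<alpha> j + t k)) s - indicator {0..} s * wt UNIV \<alpha> s) / t k = ?q k s"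
      proof (cases "s \<ge> 0")
        case True
        have r1: "\<alpha> j + s > 0" using aj True by linarith
        have r2: "\<alpha> j + s + t k > 0" using aj True t(3)[of k] by linarith
        note r = r1 r2
        have "wt UNIV (\<alpha>(j := \<alpha> j + t k)) s - wt UNIV \<alpha> s = wt UNIV \<alpha> s * (sqrt (\<alpha> j + s) * (1 / sqrt (\<alpha> j + s + t k) - 1 / sqrt (\<alpha> j + s)))"
          unfolding wt_update[OF \<alpha> True] using r by (simp add: right_diff_distrib add_ac)
        then have "(wt UNIV (\<alpha>(j := \<alpha> j + t k)) s - wt UNIV \<alpha> s) / t k = wt UNIV \<alpha> s * (sqrt (\<alpha> j + s) * (1 / sqrt (\<alpha> j + s + t k) - 1 / sqrt (\<alpha> j + s)) / t k)"
          by simp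
        then show ?thesis using True unfolding inverse_sqrt_quotient[OF r t(2)] by simp
      qed simp
    qed
    finally show ?thesis .
  qed
  have "(\<lambda>k. \<integral>s. ?q k s \<partial>lborel) \<longlonglongrightarrow> (\<integral>s. - 1 / 2 * (indicator {0..} s * (wt UNIV \<alpha> s / (\<alpha> j + s))) \<partial>lborel)"
  proof (rule integral_dominated_convergence[where w = "\<lambda>s. 2 * (indicator {0..} s * (wt UNIV \<alpha> s / (\<alpha> j + s)))"])
    show "integrable lborel (\<lambda>s. 2 * (indicator {0..} s * (wt UNIV \<alpha> s / (\<alpha> j + s))))"
      by (intro integrable_mult_right integrable_wt_div \<alpha> n)
    show "AE s in lborel. (\<lambda>k. ?q k s) \<longlonglongrightarrow> - 1 / 2 * (indicator {0..} s * (wt UNIV \<alpha> s / (\<alpha> j + s)))"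
    proof (rule AE_I2)
      fix s :: real
      show "(\<lambda>k. ?q k s) \<longlonglongrightarrow> - 1 / 2 * (indicator {0..} s * (wt UNIV \<alpha> s / (\<alpha> j + s)))"
      proof (cases "s \<ge> 0")
        case True
        have r: "\<alpha> j + s > 0" using aj True by simp
        have "(\<lambda>k. - 1 / ((sqrt (\<alpha> j + s) + sqrt (\<alpha> j + s + t k)) * sqrt (\<alpha> j + s + t k)))
            \<longlonglongrightarrow> - 1 / ((sqrt (\<alpha> j + s) + sqrt (\<alpha> j + s + 0)) * sqrt (\<alpha> j + s + 0))"
          using r by (intro tendsto_intros t(1)) auto
        then have "(\<lambda>k. ?q k s) \<longlonglongrightarrow> indicator {0..} s * (wt UNIV \<alpha> s * (- 1 / ((sqrt (\<alpha> j + s) + sqrt (\<alpha> j + s + 0)) * sqrt (\<alpha> j + s + 0))))"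
          by (intro tendsto_mult tendsto_const)
        moreover have "indicator {0..} s * (wt UNIV \<alpha> s * (- 1 / ((sqrt (\<alpha> j + s) + sqrt (\<alpha> j + s + 0)) * sqrt (\<alpha> j + s + 0))))
          = - 1 / 2 * (indicator {0..} s * (wt UNIV \<alpha> s / (\<alpha> j + s)))"
        proof -
          have "(sqrt (\<alpha> j + s) + sqrt (\<alpha> j + s + 0)) * sqrt (\<alpha> j + s + 0) = 2 * (\<alpha> j + s)"
            using r by (simp only: add_0_right distrib_right real_sqrt_mult_self) simp
          then show ?thesis by simp
        qed
        ultimately show ?thesis by (simp only:)
      qed simp
    qed
    fix k
    show "AE s in lborel. norm (?q k s) \<le> 2 * (indicator {0..} s * (wt UNIV \<alpha> s / (\<alpha> j + s)))"
    proof (rule AE_I2)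
      fix s :: real
      show "norm (?q k s) \<le> 2 * (indicator {0..} s * (wt UNIV \<alpha> s / (\<alpha> j + s)))"
      proof (cases "s \<ge> 0")
        case True
        let ?r = "\<alpha> j + s" and ?b = "sqrt (\<alpha> j + s + t k)"
        have r: "?r > 0" using aj True by linarith
        have "- (\<alpha> j / 2) \<le> t k" using t(3)[of k] by linarith
        then have r2: "?r / 2 \<le> ?r + t k" using True by (simp add: field_simps)
        then have b: "?b > 0" using r by auto
        have w: "wt UNIV \<alpha> s > 0" using \<alpha> True by (intro wt_pos) auto
        have "?r / 2 \<le> ?b * ?b" using r r2 by auto
        also have "\<dots> \<le> (sqrt ?r + ?b) * ?b" using r b by (intro mult_right_mono) auto
        finally have "1 / ((sqrt ?r + ?b) * ?b) \<le> 1 / (?r / 2)" using r by (intro divide_left_mono mult_pos_pos add_pos_pos b) auto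
        then have le: "1 / ((sqrt ?r + ?b) * ?b) \<le> 2 / ?r" by simp
        have "norm (?q k s) = wt UNIV \<alpha> s * (1 / ((sqrt ?r + ?b) * ?b))"
          using True w r b by (simp add: abs_mult)
        also have "\<dots> \<le> wt UNIV \<alpha> s * (2 / ?r)" using w le by (intro mult_left_mono) auto
        also have "\<dots> = 2 * (indicator {0..} s * (wt UNIV \<alpha> s / ?r))" using True by simp
        finally show ?thesis .
      qed simp
    qed
  qed measurable
  moreover have "(\<integral>s. - 1 / 2 * (indicator {0..} s * (wt UNIV \<alpha> s / (\<alpha> j + s))) \<partial>lborel) = - wt_div_int \<alpha> j / 2"
    unfolding wt_div_int_def by (subst integral_mult_right_zero) simp
  ultimately show ?thesis unfolding q by (simp only:)
qed

lemma wt_mono: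
  assumes "\<forall>i\<in>I. 0 < A i \<and> A i \<le> B i" "s \<ge> 0"
  shows "wt I B s \<le> wt I A s"
  unfolding wt_def
proof (rule prod_mono)
  fix i assume "i \<in> I"
  then have "0 < A i" "A i \<le> B i" using assms(1) by auto
  then have "0 < A i + s" "sqrt (A i + s) \<le> sqrt (B i + s)" using assms(2) by auto
  then show "0 \<le> 1 / sqrt (B i + s) \<and> 1 / sqrt (B i + s) \<le> 1 / sqrt (A i + s)"
    by (auto intro!: divide_left_mono mult_pos_pos)
qed

text \<open>Stated on \<open>real^'n\<close>, where cubes are compact and a minimiser can be
  obtained. The weight with all axes equal to \<delta> is the majorant.\<close>

lemma continuous_on_wt_int:
  assumes "\<delta> > 0" and n: "CARD('n::finite) \<ge> 3"
  shows "continuous_on {x :: real^'n. \<forall>j. \<delta> \<le> x $ j} (\<lambda>x. wt_int (($) x))"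
  unfolding continuous_on_sequentially o_def wt_int_def
proof (intro allI ballI impI)
  fix y :: "nat \<Rightarrow> real^'n" and x
  assume x: "x \<in> {x. \<forall>j. \<delta> \<le> x $ j}" and y: "(\<forall>n. y n \<in> {x. \<forall>j. \<delta> \<le> x $ j}) \<and> y \<longlonglongrightarrow> x"
  show "(\<lambda>k. \<integral>s. indicator {0..} s * wt UNIV (($) (y k)) s \<partial>lborel) \<longlonglongrightarrow> (\<integral>s. indicator {0..} s * wt UNIV (($) x) s \<partial>lborel)"
  proof (rule integral_dominated_convergence[where w = "\<lambda>s. indicator {0..} s * wt (UNIV :: 'n set) (\<lambda>_. \<delta>) s"])
    show "integrable lborel (\<lambda>s. indicator {0..} s * wt (UNIV :: 'n set) (\<lambda>_. \<delta>) s)"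
      using assms by (intro integrable_wt) auto
    show "AE s in lborel. (\<lambda>k. indicator {0..} s * wt UNIV (($) (y k)) s) \<longlonglongrightarrow> indicator {0..} s * wt UNIV (($) x) s"
    proof (rule AE_I2)
      fix s :: real
      show "(\<lambda>k. indicator {0..} s * wt UNIV (($) (y k)) s) \<longlonglongrightarrow> indicator {0..} s * wt UNIV (($) x) s"
      proof (cases "s \<ge> 0")
        case True
        have nz: "sqrt (x $ j + s) \<noteq> 0" for j
        proof -
          have "x $ j \<ge> \<delta>" using x by simp
          then show ?thesis using assms True by simp
        qed
        show ?thesis unfolding wt_def using y by (intro tendsto_intros nz) auto
      qed simp
    qed
    fix k
    show "AE s in lborel. norm (indicator {0..} s * wt UNIV (($) (y k)) s) \<le> indicator {0..} s * wt (UNIV :: 'n set) (\<lambda>_. \<delta>) s"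
    proof (rule AE_I2)
      fix s :: real
      have p: "0 < y k $ j" for j using y assms(1) by (auto intro: less_le_trans)
      show "norm (indicator {0..} s * wt UNIV (($) (y k)) s) \<le> indicator {0..} s * wt (UNIV :: 'n set) (\<lambda>_. \<delta>) s"
        using wt_mono[of UNIV "\<lambda>_. \<delta>" "($) (y k)" s] wt_pos[of UNIV "($) (y k)" s] y assms(1) p
        by (cases "s \<ge> 0") (auto simp: less_imp_le)
    qed
  qed measurable
qed

text \<open>The logarithmic derivative of w is -1/2 times the sum of the 1 / (\<alpha>_j + s), and w
  vanishes at infinity; integrate from 0. Equivalently the coefficients
  \<open>ell_coeff \<alpha> j\<close> add up to 1/2, the trace condition for a potential with
  Laplacian -1 inside.\<close>

lemma sum_wt_div_int:
  fixes \<alpha> :: "'n::finite \<Rightarrow> real"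
  assumes \<alpha>: "\<forall>j. \<alpha> j > 0" and n: "CARD('n) \<ge> 3"
  shows "(\<Sum>j\<in>UNIV. wt_div_int \<alpha> j) = 2 * wt UNIV \<alpha> 0"
proof -
  \<comment> \<open>This is -2 w written through logarithms, so that the derivative of the product
    becomes a sum.\<close>
  define F where "F s = - 2 * exp (- (\<Sum>j\<in>UNIV. ln (\<alpha> j + s)) / 2)" for s
  have wF: "wt UNIV \<alpha> s = exp (- (\<Sum>j\<in>UNIV. ln (\<alpha> j + s)) / 2)" if s: "s \<ge> 0" for s
  proof -
    have "1 / sqrt (\<alpha> j + s) = exp (- ln (\<alpha> j + s) / 2)" for j
    proof -
      have p: "\<alpha> j + s > 0" using \<alpha> s by (simp add: add_pos_nonneg)
      then have "sqrt (\<alpha> j + s) = exp (ln (\<alpha> j + s) / 2)" by (simp add: ln_sqrt[symmetric])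
      then show ?thesis by (simp add: exp_minus inverse_eq_divide)
    qed
    then have "wt UNIV \<alpha> s = exp (\<Sum>j\<in>UNIV. - ln (\<alpha> j + s) / 2)"
      unfolding wt_def by (simp add: exp_sum)
    then show ?thesis by (simp add: sum_divide_distrib sum_negf)
  qed
  let ?f = "\<lambda>s. wt UNIV \<alpha> s * (\<Sum>j\<in>UNIV. 1 / (\<alpha> j + s))"
  have fpos: "?f s \<ge> 0" if "s \<ge> 0" for s
    using wt_pos[of UNIV \<alpha> s] \<alpha> that by (intro mult_nonneg_nonneg sum_nonneg) (auto simp: add_nonneg_nonneg less_imp_le)
  have "(\<integral>\<^sup>+s. ennreal (?f s) * indicator {0..} s \<partial>lborel) = ennreal (0 - F 0)"
  proof (rule nn_integral_FTC_atLeast[where F = F and a = 0])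
    obtain C where C: "C > 0" "\<And>s. s \<ge> 0 \<Longrightarrow> wt UNIV \<alpha> s \<le> C * (1 / sqrt (1 + s)) ^ 1"
      using wt_le_power[of UNIV \<alpha> 1] \<alpha> n by auto
    have l: "((\<lambda>s. - 2 * (C * (1 / sqrt (1 + s)) ^ 1)) \<longlongrightarrow> 0) at_top" by real_asymp
    show "(F \<longlongrightarrow> 0) at_top"
    proof (rule tendsto_sandwich[OF _ _ l tendsto_const])
      show "eventually (\<lambda>s. - 2 * (C * (1 / sqrt (1 + s)) ^ 1) \<le> F s) at_top"
        using eventually_ge_at_top[of 0]
      proof eventually_elim
        case (elim s)
        have "F s = - 2 * wt UNIV \<alpha> s" by (simp only: F_def wF[OF elim])
        then show ?case using C(2)[OF elim] by linarith
      qed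
      show "eventually (\<lambda>s. F s \<le> 0) at_top" by (simp add: F_def)
    qed
    fix s :: real assume s: "0 \<le> s"
    have "\<alpha> j + s > 0" for j using \<alpha> s by (simp add: add_pos_nonneg)
    then have "(F has_real_derivative (- 2 * (exp (- (\<Sum>j\<in>UNIV. ln (\<alpha> j + s)) / 2) * (- (\<Sum>j\<in>UNIV. 1 / (\<alpha> j + s)) / 2)))) (at s)"
      unfolding F_def by (auto intro!: derivative_eq_intros)
    then show "(F has_real_derivative ?f s) (at s)" unfolding wF[OF s] by simp
    show "0 \<le> ?f s" by (rule fpos[OF s])
  qed measurable
  moreover have "0 - F 0 = 2 * wt UNIV \<alpha> 0" by (simp add: F_def wF)
  moreover have "(\<integral>s. indicator {0..} s * ?f s \<partial>lborel) = enn2real (\<integral>\<^sup>+s. ennreal (?f s) * indicator {0..} s \<partial>lborel)"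
  proof -
    have "(\<integral>s. indicator {0..} s * ?f s \<partial>lborel) = enn2real (\<integral>\<^sup>+s. ennreal (indicator {0..} s * ?f s) \<partial>lborel)"
      by (rule integral_eq_nn_integral) (use fpos in \<open>auto simp: indicator_def intro!: AE_I2\<close>)
    also have "(\<integral>\<^sup>+s. ennreal (indicator {0..} s * ?f s) \<partial>lborel) = (\<integral>\<^sup>+s. ennreal (?f s) * indicator {0..} s \<partial>lborel)"
      by (intro nn_integral_cong) (auto simp: indicator_def)
    finally show ?thesis .
  qed
  moreover have "(\<integral>s. indicator {0..} s * ?f s \<partial>lborel) = (\<Sum>j\<in>UNIV. wt_div_int \<alpha> j)"
  proof -
    have "indicator {0..} s * ?f s = (\<Sum>j\<in>UNIV. indicator {0..} s * (wt UNIV \<alpha> s / (\<alpha> j + s)))" for s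
      by (simp add: sum_distrib_left)
    then show ?thesis
      unfolding wt_div_int_def using integrable_wt_div[OF \<alpha> n] by (simp only: Bochner_Integration.integral_sum)
  qed
  ultimately show ?thesis using wt_pos[of UNIV \<alpha> 0] \<alpha> by simp
qed

text \<open>The prescribed coefficients are the Euler-Lagrange equations of the strictly positive functional
  \<open>wt_int \<alpha> + 2 * (\<Sum>j. b j * \<alpha> j)\<close>; since its derivative blows up at the faces \<open>\<alpha> j = 0\<close>,
  its minimum over a large cube is attained away from them.\<close>

lemma wt_div_int_lower:
  fixes \<alpha> :: "'n::finite \<Rightarrow> real"
  assumes d: "0 < \<delta>" "\<delta> \<le> 1" and \<alpha>: "\<forall>i. \<delta> \<le> \<alpha> i \<and> \<alpha> i \<le> R" and j: "\<alpha> j = \<delta>" and n: "CARD('n) \<ge> 3" and R: "R > 0"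
  shows "wt_div_int \<alpha> j \<ge> 1 / 2 * (1 / sqrt (2 * \<delta>)) * (1 / sqrt (R + 1)) ^ (CARD('n) - 1)"
proof -
  have \<alpha>p: "\<forall>i. \<alpha> i > 0" using \<alpha> d by (meson less_le_trans)
  \<comment> \<open>For s in [0, \<delta>] one has \<alpha>_j + s \<le> 2 \<delta>, and every other
    factor of the weight is at least 1 / sqrt (R + 1). The interval has length \<delta>, which
    leaves a bound of order \<delta>^(-1/2).\<close>
  let ?c = "(1 / sqrt (2 * \<delta>)) * (1 / sqrt (R + 1)) ^ (CARD('n) - 1) / (2 * \<delta>)"
  have fin: "emeasure lborel {0..\<delta>} < \<infinity>" using d by simp
  have "(\<integral>s. ?c * indicator {0..\<delta>} s \<partial>lborel) \<le> wt_div_int \<alpha> j"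
    unfolding wt_div_int_def
  proof (intro integral_mono integrable_wt_div \<alpha>p n integrable_mult_right integrable_real_indicator fin)
    fix s :: real
    show "?c * indicator {0..\<delta>} s \<le> indicator {0..} s * (wt UNIV \<alpha> s / (\<alpha> j + s))"
    proof (cases "s \<in> {0..\<delta>}")
      case True
      then have s: "0 \<le> s" "s \<le> \<delta>" by auto
      have U: "(UNIV :: 'n set) = insert j (UNIV - {j})" by auto
      have 1: "wt UNIV \<alpha> s = (1 / sqrt (\<alpha> j + s)) * wt (UNIV - {j}) \<alpha> s"
        unfolding wt_def by (subst U, subst prod.insert) auto
      have "(1 / sqrt (R + 1)) ^ (CARD('n) - 1) = (\<Prod>i\<in>UNIV - {j}. 1 / sqrt (R + 1))" by simp
      also have "\<dots> \<le> wt (UNIV - {j}) \<alpha> s"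
        unfolding wt_def
      proof (rule prod_mono)
        fix i
        have "0 < \<alpha> i + s" "\<alpha> i + s \<le> R + 1" using \<alpha>p \<alpha> s d by (auto simp: add_pos_nonneg intro!: add_mono)
        then show "0 \<le> 1 / sqrt (R + 1) \<and> 1 / sqrt (R + 1) \<le> 1 / sqrt (\<alpha> i + s)"
          using R by (auto intro!: divide_left_mono mult_pos_pos)
      qed
      finally have 2: "(1 / sqrt (R + 1)) ^ (CARD('n) - 1) \<le> wt (UNIV - {j}) \<alpha> s" .
      have 3: "1 / sqrt (2 * \<delta>) \<le> 1 / sqrt (\<alpha> j + s)"
        using j s d by (intro divide_left_mono mult_pos_pos) auto
      have "(1 / sqrt (2 * \<delta>)) * (1 / sqrt (R + 1)) ^ (CARD('n) - 1) \<le> wt UNIV \<alpha> s"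
        unfolding 1 using 2 3 d s j R by (intro mult_mono) auto
      then have "?c \<le> wt UNIV \<alpha> s / (\<alpha> j + s)"
        using j s d R wt_pos[of UNIV \<alpha> s] \<alpha>p by (intro frac_le) auto
      then show ?thesis using True by simp
    next
      case False
      then show ?thesis using wt_pos[of UNIV \<alpha> s] \<alpha>p by (cases "s \<ge> 0") (auto simp: less_imp_le add_nonneg_nonneg)
    qed
  qed auto
  also have "(\<integral>s. ?c * indicator {0..\<delta>} s \<partial>lborel) = ?c * \<delta>" using d by simp
  finally show ?thesis using d by simp
qed

lemma ell_coeff_eq: "ell_coeff \<alpha> j = wt_div_int \<alpha> j / (4 * wt UNIV \<alpha> 0)"
  by (simp add: ell_coeff_def wt_div_int_def)

lemma wt_int_nonneg:
  assumes "\<forall>j. \<alpha> j > 0"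
  shows "wt_int \<alpha> \<ge> 0"
  unfolding wt_int_def using wt_pos[of UNIV \<alpha>] assms
  by (intro integral_nonneg_AE AE_I2) (auto simp: indicator_def less_imp_le)

text \<open>Increasing one coordinate at the minimiser is possible even on the lower face and gives
  \<open>wt_div_int \<alpha> j \<le> 4 * b j\<close>. By the blow-up of \<open>wt_div_int\<close>
  this excludes the lower face; then the coordinate may also be decreased, which gives the reverse
  inequality.\<close>

lemma exists_ell_coeff:
  fixes b :: "'n::finite \<Rightarrow> real"
  assumes n: "CARD('n) \<ge> 3" and b: "\<forall>j. b j > 0" and sum: "(\<Sum>j\<in>UNIV. b j) = 1/2"
  shows "\<exists>\<alpha>. (\<forall>j. \<alpha> j > 0) \<and> (\<forall>j. ell_coeff \<alpha> j = b j)"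
proof -
  \<comment> \<open>The value of the functional at the point with all coordinates 1, since twice the
    sum of the b_j is 1.\<close>
  define M where "M = wt_int (\<lambda>_::'n. 1) + 1"
  have M: "M > 0" using wt_int_nonneg[of "\<lambda>_::'n. 1"] by (simp add: M_def)
  \<comment> \<open>A minimiser satisfies 2 b_j \<alpha>_j \<le> M; with R beyond all M / (2 b_j)
    the upper faces are out of reach.\<close>
  define R where "R = 1 + (\<Sum>j\<in>UNIV. M / (2 * b j))"
  have Rj: "M / (2 * b j) < R" for j
  proof -
    have "M / (2 * b j) \<le> (\<Sum>j\<in>UNIV. M / (2 * b j))"
      using M b by (intro member_le_sum) (auto simp: less_imp_le)
    then show ?thesis by (simp add: R_def)
  qed
  have R1: "R \<ge> 1" unfolding R_def using M b by (auto intro!: sum_nonneg simp: less_imp_le)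
  define c where "c = 1 / 2 * (1 / sqrt (R + 1)) ^ (CARD('n) - 1)"
  have c: "c > 0" "c \<le> 1 / 2" using R1 by (auto simp: c_def intro!: power_le_one)
  \<comment> \<open>Chosen so that sqrt (2 \<delta>) = c/3. The lower bound for
    \<open>wt_div_int\<close> on the face \<alpha>_j = \<delta> then equals 3, whereas 4 b_j is at
    most 2.\<close>
  define \<delta> where "\<delta> = c\<^sup>2 / 18"
  have \<delta>: "\<delta> > 0" using c by (simp add: \<delta>_def)
  have \<delta>1: "\<delta> \<le> 1"
  proof -
    have "c\<^sup>2 \<le> 1" using c by (intro power_le_one) auto
    then show ?thesis by (simp add: \<delta>_def)
  qed
  have sq: "sqrt (2 * \<delta>) = c / 3"
  proof -
    have "2 * \<delta> = (c / 3)\<^sup>2" by (simp add: \<delta>_def power_divide)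
    then show ?thesis using c by simp
  qed
  define K where "K = {x :: real^'n. \<forall>j. \<delta> \<le> x $ j \<and> x $ j \<le> R}"
  have K: "K = cbox (\<chi> j. \<delta>) (\<chi> j. R)" by (auto simp: K_def mem_box_cart)
  define \<Phi> where "\<Phi> x = wt_int (($) x) + 2 * (\<Sum>j\<in>UNIV. b j * x $ j)" for x :: "real^'n"
  have one: "(\<chi> j. 1) \<in> K" using \<delta>1 R1 by (simp add: K_def)
  have "continuous_on K \<Phi>"
    unfolding \<Phi>_def
    by (intro continuous_intros continuous_on_subset[OF continuous_on_wt_int[OF \<delta> n]]) (auto simp: K_def)
  then obtain x where x: "x \<in> K" "\<And>y. y \<in> K \<Longrightarrow> \<Phi> x \<le> \<Phi> y"
    using continuous_attains_inf[of K \<Phi>] one unfolding K by (metis compact_cbox empty_iff)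
  define \<alpha> where "\<alpha> = ($) x"
  have \<alpha>K: "\<forall>i. \<delta> \<le> \<alpha> i \<and> \<alpha> i \<le> R" using x(1) by (simp add: \<alpha>_def K_def)
  have \<alpha>p: "\<forall>j. \<alpha> j > 0" using \<alpha>K \<delta> by (meson less_le_trans)
  have "\<Phi> x \<le> M"
  proof -
    have "($) (\<chi> j. 1) = (\<lambda>_::'n. 1::real)" by (simp add: fun_eq_iff)
    then have "\<Phi> (\<chi> j. 1) = M" by (simp add: \<Phi>_def M_def sum)
    then show ?thesis using x(2)[OF one] by simp
  qed
  have \<alpha>R: "\<alpha> j < R" for j
  proof -
    have "b j * \<alpha> j \<le> (\<Sum>j\<in>UNIV. b j * \<alpha> j)"
      using b \<alpha>p by (intro member_le_sum) (auto simp: less_imp_le)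
    moreover have "wt_int \<alpha> + 2 * (\<Sum>j\<in>UNIV. b j * \<alpha> j) \<le> M" using \<open>\<Phi> x \<le> M\<close> by (simp add: \<Phi>_def \<alpha>_def)
    ultimately have "2 * b j * \<alpha> j \<le> M" using wt_int_nonneg[OF \<alpha>p] by linarith
    then have "\<alpha> j \<le> M / (2 * b j)" using b by (simp add: pos_le_divide_eq mult.commute)
    then show ?thesis using Rj[of j] by linarith
  qed
  have perturb: "wt_int (\<alpha>(j := \<alpha> j + t)) - wt_int \<alpha> + 2 * b j * t \<ge> 0" if t: "\<delta> \<le> \<alpha> j + t" "\<alpha> j + t \<le> R" for j t
  proof -
    let ?y = "\<chi> i. (\<alpha>(j := \<alpha> j + t)) i"
    have y: "($) ?y = \<alpha>(j := \<alpha> j + t)" by (rule ext) simp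
    have "?y \<in> K" using t \<alpha>K by (simp add: K_def)
    then have "\<Phi> x \<le> \<Phi> ?y" by (rule x(2))
    moreover have "(\<Sum>i\<in>UNIV. b i * (\<alpha>(j := \<alpha> j + t)) i) = (\<Sum>i\<in>UNIV. b i * \<alpha> i + (if i = j then b j * t else 0))"
      by (intro sum.cong) (auto simp: algebra_simps)
    then have "(\<Sum>i\<in>UNIV. b i * (\<alpha>(j := \<alpha> j + t)) i) = (\<Sum>i\<in>UNIV. b i * \<alpha> i) + b j * t"
      by (simp add: sum.distrib)
    ultimately show ?thesis unfolding \<Phi>_def y \<alpha>_def[symmetric] by (simp only: vec_lambda_beta) (simp add: \<alpha>_def algebra_simps)
  qed
  have seq: "(\<lambda>k. e * inverse (real (Suc k))) \<longlonglongrightarrow> 0" for e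
    using tendsto_mult_left[OF LIMSEQ_inverse_real_of_nat, of e] by simp
  have small: "e * inverse (real (Suc k)) \<le> e" "0 < e * inverse (real (Suc k))" if "e > 0" for e k
    using that by (auto simp: field_simps)
  have upper: "wt_div_int \<alpha> j \<le> 4 * b j" for j
  proof -
    \<comment> \<open>Half of \<alpha>_j for the derivative lemma, R - \<alpha>_j to remain in the
      cube.\<close>
    define e where "e = min (\<alpha> j / 2) (R - \<alpha> j)"
    have e: "e > 0" "e \<le> \<alpha> j / 2" "e \<le> R - \<alpha> j" using \<alpha>p \<alpha>R[of j] by (auto simp: e_def min_def)
    define t where "t k = e * inverse (real (Suc k))" for k
    have t: "0 < t k" "t k \<le> e" for k using small[OF e(1)] by (auto simp: t_def)
    have "(\<lambda>k. (wt_int (\<alpha>(j := \<alpha> j + t k)) - wt_int \<alpha>) / t k) \<longlonglongrightarrow> - wt_div_int \<alpha> j / 2"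
    proof (rule wt_int_quotient_tendsto[OF \<alpha>p n])
      show "t \<longlonglongrightarrow> 0" unfolding t_def by (rule seq)
      show "t k \<noteq> 0" "\<bar>t k\<bar> \<le> \<alpha> j / 2" for k using t[of k] e by auto
    qed
    moreover have "- 2 * b j \<le> (wt_int (\<alpha>(j := \<alpha> j + t k)) - wt_int \<alpha>) / t k" for k
    proof -
      have "\<delta> \<le> \<alpha> j + t k \<and> \<alpha> j + t k \<le> R" using \<alpha>K[rule_format, of j] t[of k] e by linarith
      then have "wt_int (\<alpha>(j := \<alpha> j + t k)) - wt_int \<alpha> + 2 * b j * t k \<ge> 0" by (intro perturb) auto
      then show ?thesis using t[of k] by (simp add: pos_le_divide_eq)
    qed
    ultimately have "- 2 * b j \<le> - wt_div_int \<alpha> j / 2" by (intro LIMSEQ_le_const) auto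
    then show ?thesis by simp
  qed
  have \<alpha>\<delta>: "\<delta> < \<alpha> j" for j
  proof (rule ccontr)
    assume "\<not> \<delta> < \<alpha> j"
    then have j: "\<alpha> j = \<delta>" using \<alpha>K by (meson antisym not_less)
    have "1 / 2 * (1 / sqrt (2 * \<delta>)) * (1 / sqrt (R + 1)) ^ (CARD('n) - 1) \<le> wt_div_int \<alpha> j"
      by (rule wt_div_int_lower[OF \<delta> \<delta>1 \<alpha>K j n]) (use R1 in simp)
    also have "1 / 2 * (1 / sqrt (2 * \<delta>)) * (1 / sqrt (R + 1)) ^ (CARD('n) - 1) = (1 / (c / 3)) * c"
      unfolding sq by (simp add: c_def)
    also have "\<dots> = 3" using c by simp
    finally have "3 \<le> 4 * b j" using upper[of j] by linarith
    moreover have "b j \<le> 1 / 2"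
      unfolding sum[symmetric] using b by (intro member_le_sum) (auto simp: less_imp_le)
    ultimately show False by linarith
  qed
  have lower: "4 * b j \<le> wt_div_int \<alpha> j" for j
  proof -
    define e where "e = min (\<alpha> j / 2) (\<alpha> j - \<delta>)"
    have e: "e > 0" "e \<le> \<alpha> j / 2" "e \<le> \<alpha> j - \<delta>" using \<alpha>p \<alpha>\<delta>[of j] by (auto simp: e_def min_def)
    define t where "t k = (- e) * inverse (real (Suc k))" for k
    have t: "t k < 0" "- e \<le> t k" for k using small[OF e(1)] by (auto simp: t_def)
    have "(\<lambda>k. (wt_int (\<alpha>(j := \<alpha> j + t k)) - wt_int \<alpha>) / t k) \<longlonglongrightarrow> - wt_div_int \<alpha> j / 2"
    proof (rule wt_int_quotient_tendsto[OF \<alpha>p n])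
      show "t \<longlonglongrightarrow> 0" unfolding t_def by (rule seq)
      show "t k \<noteq> 0" "\<bar>t k\<bar> \<le> \<alpha> j / 2" for k using t[of k] e by auto
    qed
    moreover have "(wt_int (\<alpha>(j := \<alpha> j + t k)) - wt_int \<alpha>) / t k \<le> - 2 * b j" for k
    proof -
      have "\<delta> \<le> \<alpha> j + t k \<and> \<alpha> j + t k \<le> R" using \<alpha>K[rule_format, of j] t[of k] e by linarith
      then have "wt_int (\<alpha>(j := \<alpha> j + t k)) - wt_int \<alpha> + 2 * b j * t k \<ge> 0" by (intro perturb) auto
      then show ?thesis using t(1)[of k] by (simp add: neg_divide_le_eq)
    qed
    ultimately have "- wt_div_int \<alpha> j / 2 \<le> - 2 * b j" by (intro LIMSEQ_le_const2) auto
    then show ?thesis by simp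
  qed
  have D: "wt_div_int \<alpha> j = 4 * b j" for j using upper[of j] lower[of j] by simp
  \<comment> \<open>The sum identity removes the remaining normalisation: w(0) = 1, so
    \<open>wt_div_int\<close> divided by 4 w(0) is b_j itself.\<close>
  have "2 * wt UNIV \<alpha> 0 = (\<Sum>j\<in>UNIV. 4 * b j)"
    using sum_wt_div_int[OF \<alpha>p n] by (simp add: D)
  also have "\<dots> = 4 * (\<Sum>j\<in>UNIV. b j)" by (simp only: sum_distrib_left)
  finally have "wt UNIV \<alpha> 0 = 1" using sum by simp
  then have "ell_coeff \<alpha> j = b j" for j by (simp add: ell_coeff_eq D)
  then show ?thesis using \<alpha>p by blast
qed

section \<open>Behaviour of the coefficients under dilation\<close>

lemma wt_scale:
  fixes \<alpha> :: "'n::finite \<Rightarrow> real"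
  shows "wt UNIV (\<lambda>j. t * \<alpha> j) (t * u) = (1 / sqrt t) ^ CARD('n) * wt UNIV \<alpha> u"
proof -
  have "1 / sqrt (t * \<alpha> j + t * u) = (1 / sqrt t) * (1 / sqrt (\<alpha> j + u))" for j
    by (simp only: distrib_left[symmetric] real_sqrt_mult) simp
  then show ?thesis unfolding wt_def by (simp only: prod.distrib prod_constant)
qed

text \<open>Substituting t u for u, the power of t in the weight cancels against the one in w(0).
  Degree 0 for the quadratic coefficients and degree 1 for the slope leave a dilation free to adjust
  b_N without disturbing the other b_j.\<close>

lemma
  fixes \<alpha> :: "'n::finite \<Rightarrow> real"
  assumes t: "t > 0"
  shows ell_coeff_scale: "ell_coeff (\<lambda>j. t * \<alpha> j) j = ell_coeff \<alpha> j"
    and par_lin_scale: "par_lin (\<lambda>j. t * \<alpha> j) = t * par_lin \<alpha>"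
proof -
  let ?K = "(1 / sqrt t) ^ CARD('n)"
  have K: "?K \<noteq> 0" using t by simp
  have i: "indicator {0..} (0 + t *\<^sub>R u) = (indicator {0..} u :: real)" for u :: real
    using t by (simp add: indicator_def zero_le_mult_iff)
  have w0: "wt UNIV (\<lambda>j. t * \<alpha> j) 0 = ?K * wt UNIV \<alpha> 0" using wt_scale[of t \<alpha> 0] by simp
  have wu: "wt UNIV (\<lambda>j. t * \<alpha> j) (0 + t *\<^sub>R u) = ?K * wt UNIV \<alpha> u" for u using wt_scale[of t \<alpha> u] by simp
  have "(\<integral>u. indicator {0..} u * (wt UNIV (\<lambda>j. t * \<alpha> j) u / (t * \<alpha> j + u)) \<partial>lborel)
     = t ^ DIM(real) * (\<integral>u. indicator {0..} u * (?K * wt UNIV \<alpha> u / (t * \<alpha> j + (0 + t *\<^sub>R u))) \<partial>lborel)"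
    by (subst lborel_integral_affine[OF t, where x = 0]) (simp_all only: i wu, measurable)
  also have "\<dots> = t * (\<integral>u. ?K / t * (indicator {0..} u * (wt UNIV \<alpha> u / (\<alpha> j + u))) \<partial>lborel)"
  proof -
    have "indicator {0..} u * (?K * wt UNIV \<alpha> u / (t * \<alpha> j + (0 + t *\<^sub>R u))) = ?K / t * (indicator {0..} u * (wt UNIV \<alpha> u / (\<alpha> j + u)))" for u
    proof -
      have "t * \<alpha> j + (0 + t *\<^sub>R u) = t * (\<alpha> j + u)" by (simp add: distrib_left)
      moreover have "i * (k * w / (t * a)) = k / t * (i * (w / a))" for i k w a :: real
        by (simp add: mult.left_commute)
      ultimately show ?thesis by (simp only:)
    qed
    then show ?thesis by (simp only: DIM_real power_one_right)
  qed
  also have "\<dots> = ?K * (\<integral>u. indicator {0..} u * (wt UNIV \<alpha> u / (\<alpha> j + u)) \<partial>lborel)"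
    using t by (subst integral_mult_right_zero) simp
  finally show "ell_coeff (\<lambda>j. t * \<alpha> j) j = ell_coeff \<alpha> j"
    unfolding ell_coeff_def w0 using K by simp
  have "(\<integral>u. indicator {0..} u * wt UNIV (\<lambda>j. t * \<alpha> j) u \<partial>lborel)
     = t ^ DIM(real) * (\<integral>u. indicator {0..} u * (?K * wt UNIV \<alpha> u) \<partial>lborel)"
    by (subst lborel_integral_affine[OF t, where x = 0]) (simp_all only: i wu, measurable)
  also have "\<dots> = t * (\<integral>u. ?K * (indicator {0..} u * wt UNIV \<alpha> u) \<partial>lborel)"
    by (simp add: mult_ac)
  also have "\<dots> = t * (?K * (\<integral>u. indicator {0..} u * wt UNIV \<alpha> u \<partial>lborel))"
    by (subst integral_mult_right_zero) (rule refl)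
  finally show "par_lin (\<lambda>j. t * \<alpha> j) = t * par_lin \<alpha>"
    unfolding par_lin_def w0 using K by simp
qed

text \<open>From \<alpha>_j / (\<alpha>_j + u) \<le> 1 under the integral. With positive quadratic
  coefficients it shows \<open>par_lin \<alpha> > 0\<close>, so that the dilation can be solved
  for.\<close>

lemma par_lin_ge:
  fixes \<alpha> :: "'n::finite \<Rightarrow> real"
  assumes \<alpha>: "\<forall>j. \<alpha> j > 0" and n: "CARD('n) \<ge> 3"
  shows "\<alpha> j * ell_coeff \<alpha> j \<le> par_lin \<alpha>"
proof -
  have w0: "wt UNIV \<alpha> 0 > 0" using \<alpha> by (intro wt_pos) auto
  have "\<alpha> j * (\<integral>u. indicator {0..} u * (wt UNIV \<alpha> u / (\<alpha> j + u)) \<partial>lborel) = (\<integral>u. \<alpha> j * (indicator {0..} u * (wt UNIV \<alpha> u / (\<alpha> j + u))) \<partial>lborel)"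
    by (rule integral_mult_right_zero[symmetric])
  also have "\<dots> \<le> (\<integral>u. indicator {0..} u * wt UNIV \<alpha> u \<partial>lborel)"
  proof (intro integral_mono integrable_mult_right integrable_wt_div \<alpha> n integrable_wt)
    fix u :: real
    show "\<alpha> j * (indicator {0..} u * (wt UNIV \<alpha> u / (\<alpha> j + u))) \<le> indicator {0..} u * wt UNIV \<alpha> u"
    proof (cases "u \<ge> 0")
      case True
      have "wt UNIV \<alpha> u > 0" using \<alpha> True by (intro wt_pos) auto
      moreover have "\<alpha> j + u > 0" using \<alpha> True by (simp add: add_pos_nonneg)
      ultimately show ?thesis using True by (simp add: pos_divide_le_eq algebra_simps)
    qed simp
  qed (use \<alpha> n in auto)
  finally show ?thesis
    unfolding ell_coeff_def par_lin_def times_divide_eq_right using w0 by (intro divide_right_mono) auto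
qed

section \<open>The obstacle problem\<close>

lemma Basis_vec_real: "(Basis :: (real^'n::finite) set) = range (\<lambda>j. axis j 1)"
  by (auto simp: Basis_vec_def)

lemma
  fixes f :: "real^'n::finite \<Rightarrow> real"
  shows sum_Basis_vec: "(\<Sum>v\<in>Basis. f v) = (\<Sum>j\<in>UNIV. f (axis j 1))"
    and prod_Basis_vec: "(\<Prod>v\<in>Basis. f v) = (\<Prod>j\<in>UNIV. f (axis j 1))"
proof -
  have i: "inj (\<lambda>j::'n. axis j (1::real))" by (auto simp: inj_on_def axis_eq_axis)
  show "(\<Sum>v\<in>Basis. f v) = (\<Sum>j\<in>UNIV. f (axis j 1))" "(\<Prod>v\<in>Basis. f v) = (\<Prod>j\<in>UNIV. f (axis j 1))"
    unfolding Basis_vec_real by (simp_all add: sum.reindex[OF i] prod.reindex[OF i])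
qed

text \<open>The same encoding as in \<open>cut_axes\<close>: a family over indices becomes a
  function on vectors with the prescribed values on the basis.\<close>

definition vec_axes :: "('n::finite \<Rightarrow> real) \<Rightarrow> real^'n \<Rightarrow> real" where
  "vec_axes \<beta> v = (\<Sum>j\<in>UNIV. \<beta> j * (v $ j))"

lemma vec_axes_axis[simp]:
  fixes \<beta> :: "'n::finite \<Rightarrow> real"
  shows "vec_axes \<beta> (axis j 1) = \<beta> j"
proof -
  have "vec_axes \<beta> (axis j 1) = (\<Sum>i\<in>UNIV. if i = j then \<beta> i else 0)"
    unfolding vec_axes_def by (intro sum.cong) (auto simp: axis_def)
  then show ?thesis by simp
qed

lemma wt_vec_axes: "wt Basis (vec_axes \<beta>) s = wt UNIV \<beta> s"
  unfolding wt_def prod_Basis_vec by simp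

lemma conf_quad_vec_axes: "conf_quad (vec_axes \<beta>) 0 x s = par_quad \<beta> x s"
  unfolding conf_quad_def sum_Basis_vec par_quad_def by (simp add: inner_axis)

lemma newton_pot_ellipsoid_inside:
  fixes \<beta> :: "'n::finite \<Rightarrow> real"
  assumes \<beta>: "\<forall>j. \<beta> j > 0" and n: "CARD('n) \<ge> 3" and x: "par_quad \<beta> x 0 \<le> 1"
  shows "0 \<le> par_lin \<beta> - (\<Sum>j\<in>UNIV. ell_coeff \<beta> j * (x $ j)\<^sup>2)"
    and "newton_pot {x. par_quad \<beta> x 0 \<le> 1} x = ennreal (par_lin \<beta> - (\<Sum>j\<in>UNIV. ell_coeff \<beta> j * (x $ j)\<^sup>2))"
proof -
  have A: "\<forall>v\<in>Basis. vec_axes \<beta> v > 0" unfolding Basis_vec_real using \<beta> by auto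
  have "newton_pot (ellip (vec_axes \<beta>) 0) x = ennreal (ell_pot (vec_axes \<beta>) 0 x)"
    by (rule newton_pot_ellip[OF A]) (use n in simp)
  moreover have "ellip (vec_axes \<beta>) 0 = {x. par_quad \<beta> x 0 \<le> 1}"
    by (simp add: ellip_def conf_quad_vec_axes)
  moreover have eq: "ell_pot (vec_axes \<beta>) 0 x = par_lin \<beta> - (\<Sum>j\<in>UNIV. ell_coeff \<beta> j * (x $ j)\<^sup>2)"
  proof -
    have "(\<integral>s. indicator {0..} s * (wt UNIV \<beta> s * max 0 (1 - par_quad \<beta> x s)) \<partial>lborel)
      = (\<integral>s. indicator {0..} s * wt UNIV \<beta> s - indicator {0..} s * (wt UNIV \<beta> s * par_quad \<beta> x s) \<partial>lborel)"
    proof (rule Bochner_Integration.integral_cong[OF refl])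
      fix s :: real
      show "indicator {0..} s * (wt UNIV \<beta> s * max 0 (1 - par_quad \<beta> x s)) = indicator {0..} s * wt UNIV \<beta> s - indicator {0..} s * (wt UNIV \<beta> s * par_quad \<beta> x s)"
      proof (cases "s \<ge> 0")
        case True
        then have "max 0 (1 - par_quad \<beta> x s) = 1 - par_quad \<beta> x s"
          using par_quad_antimono[OF \<beta> True, of x] x by simp
        then show ?thesis by (simp add: algebra_simps)
      qed simp
    qed
    also have "\<dots> = (\<integral>s. indicator {0..} s * wt UNIV \<beta> s \<partial>lborel) - (\<integral>s. indicator {0..} s * (wt UNIV \<beta> s * par_quad \<beta> x s) \<partial>lborel)"
      using \<beta> n by (intro Bochner_Integration.integral_diff integrable_wt integrable_par_quad(1)) auto
    finally show ?thesis
      unfolding ell_pot_def wt_vec_axes conf_quad_vec_axes par_lin_def integrable_par_quad(2)[OF \<beta> n, symmetric]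
      by (simp only: diff_divide_distrib)
  qed
  ultimately show "newton_pot {x. par_quad \<beta> x 0 \<le> 1} x = ennreal (par_lin \<beta> - (\<Sum>j\<in>UNIV. ell_coeff \<beta> j * (x $ j)\<^sup>2))"
    by simp
  show "0 \<le> par_lin \<beta> - (\<Sum>j\<in>UNIV. ell_coeff \<beta> j * (x $ j)\<^sup>2)"
    unfolding eq[symmetric] by (rule ell_pot_nonneg[OF A])
qed

section \<open>Translation of the sets and of the polynomial into the notation of the
  theorem\<close>

lemma scaled_ellE:
  fixes a :: "'n::finite \<Rightarrow> real"
  assumes "c > 0"
  shows "(\<lambda>y. c *\<^sub>R y) ` ellE a = {x. par_quad (\<lambda>j. c\<^sup>2 * (a j)\<^sup>2) x 0 \<le> 1}"
proof -
  have q: "par_quad (\<lambda>j. c\<^sup>2 * (a j)\<^sup>2) (c *\<^sub>R y) 0 = (\<Sum>j\<in>UNIV. (y $ j)\<^sup>2 / (a j)\<^sup>2)" for y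
    unfolding par_quad_def using assms by (intro sum.cong) (auto simp: power_mult_distrib)
  show ?thesis
  proof (intro equalityI subsetI)
    fix x assume "x \<in> (\<lambda>y. c *\<^sub>R y) ` ellE a"
    then show "x \<in> {x. par_quad (\<lambda>j. c\<^sup>2 * (a j)\<^sup>2) x 0 \<le> 1}" by (auto simp: q ellE_def)
  next
    fix x assume x: "x \<in> {x. par_quad (\<lambda>j. c\<^sup>2 * (a j)\<^sup>2) x 0 \<le> 1}"
    have e: "x = c *\<^sub>R ((1 / c) *\<^sub>R x)" using assms by simp
    have "(1 / c) *\<^sub>R x \<in> ellE a" using x unfolding ellE_def mem_Collect_eq q[symmetric] using e by simp
    then show "x \<in> (\<lambda>y. c *\<^sub>R y) ` ellE a" using e by blast
  qed
qed

lemma parabP_eq: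
  fixes a :: "'n::finite \<Rightarrow> real"
  assumes a: "\<forall>j. a j > 0"
  shows "parabP a h = par_set (\<lambda>j. (a j)\<^sup>2) h"
proof -
  let ?\<alpha> = "\<lambda>j. (a j)\<^sup>2"
  have \<alpha>: "\<forall>j. ?\<alpha> j > 0" using a zero_less_power by blast
  have "z \<ge> - h \<and> x \<in> (\<lambda>y. sqrt (z + h) *\<^sub>R y) ` ellE a \<longleftrightarrow> par_quad ?\<alpha> x 0 \<le> z + h" for x :: "real^'n" and z
  proof (cases "z + h > 0")
    case True
    then have c: "sqrt (z + h) > 0" by simp
    have "par_quad (\<lambda>j. (sqrt (z + h))\<^sup>2 * (a j)\<^sup>2) x 0 = par_quad ?\<alpha> x 0 / (z + h)"
      unfolding par_quad_def sum_divide_distrib using True by (intro sum.cong) (auto simp: mult.commute)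
    then show ?thesis using True unfolding scaled_ellE[OF c] by simp
  next
    \<comment> \<open>At the vertex height the dilation factor is 0 and the horizontal section
      shrinks to a point; below it both sides fail because the quadratic form is
      nonnegative.\<close>
    case False
    have q0: "par_quad ?\<alpha> x 0 \<ge> 0" by (rule par_quad_nonneg[OF \<alpha>]) simp
    have z: "par_quad ?\<alpha> x 0 \<le> 0 \<longleftrightarrow> x = 0"
    proof
      assume "par_quad ?\<alpha> x 0 \<le> 0"
      with q0 have "par_quad ?\<alpha> x 0 = 0" by simp
      then have "\<forall>j\<in>UNIV. (x $ j)\<^sup>2 / (?\<alpha> j + 0) = 0"
        unfolding par_quad_def by (subst (asm) sum_nonneg_eq_0_iff) auto
      moreover have "a j \<noteq> 0" for j using a by (metis less_irrefl)
      ultimately have "\<forall>j. x $ j = 0" by simp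
      then show "x = 0" by (simp add: vec_eq_iff)
    qed (simp add: par_quad_def)
    have E: "0 \<in> ellE a" by (simp add: ellE_def)
    show ?thesis
    proof (cases "z + h = 0")
      case True
      then have "(\<lambda>y. sqrt (z + h) *\<^sub>R y) ` ellE a = {0}" using E by (auto simp: image_iff)
      then show ?thesis using True z by auto
    next
      case neg: False
      then show ?thesis using False q0 by auto
    qed
  qed
  then show ?thesis by (auto simp: parabP_def par_set_def)
qed

text \<open>Derivatives are written as inner products with i and as quadratic forms in i, which
  covers horizontal and vertical basis vectors without a case distinction.\<close>

lemma C2_data_quadratic:
  fixes b :: "'n::finite \<Rightarrow> real"
  shows "C2_data (\<lambda>x. pb b (fst x) - bN * snd x - bN1)
    (\<lambda>i x. (\<chi> j. 2 * b j * fst x $ j, - bN) \<bullet> i) (\<lambda>i x. 2 * (\<Sum>j\<in>UNIV. b j * (fst i $ j)\<^sup>2))"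
  unfolding C2_data_def
proof (intro conjI allI ballI)
  fix x :: "(real^'n) \<times> real"
  let ?g = "(\<chi> j. 2 * b j * fst x $ j, - bN)"
  have c: "((\<lambda>x. fst x $ j) has_derivative (\<lambda>v. fst v $ j)) (at x)" for j
    by (intro bounded_linear_imp_has_derivative bounded_linear_compose[OF bounded_linear_vec_nth bounded_linear_fst])
  have "((\<lambda>x. b j * (fst x $ j)\<^sup>2) has_derivative (\<lambda>v. fst v $ j * (2 * b j * fst x $ j))) (at x)" for j
    by (auto intro!: derivative_eq_intros c)
  then have "((\<lambda>x. pb b (fst x)) has_derivative (\<lambda>v. \<Sum>j\<in>UNIV. fst v $ j * (2 * b j * fst x $ j))) (at x)"
    unfolding pb_def by (intro has_derivative_sum)
  then have "((\<lambda>x. pb b (fst x) - bN * snd x - bN1) has_derivative (\<lambda>v. v \<bullet> ?g)) (at x)"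
    unfolding inner_prod_def inner_vec_def by (auto intro!: derivative_eq_intros)
  moreover have "v \<bullet> ?g = (\<Sum>i\<in>Basis. (v \<bullet> i) * (?g \<bullet> i))" for v by (rule euclidean_inner)
  ultimately show "((\<lambda>x. pb b (fst x) - bN * snd x - bN1) has_derivative (\<lambda>v. \<Sum>i\<in>Basis. (v \<bullet> i) * (?g \<bullet> i))) (at x)"
    by (simp only:)
next
  fix i :: "(real^'n) \<times> real"
  show "continuous_on UNIV (\<lambda>x. (\<chi> j. 2 * b j * fst x $ j, - bN) \<bullet> i)"
    unfolding inner_prod_def inner_vec_def by (auto intro!: continuous_intros)
  show "continuous_on UNIV (\<lambda>x::(real^'n) \<times> real. 2 * (\<Sum>j\<in>UNIV. b j * (fst i $ j)\<^sup>2))" by simp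
  fix x :: "(real^'n) \<times> real"
  have "(\<chi> j. 2 * b j * fst (x + t *\<^sub>R i) $ j, - bN) \<bullet> i = (\<chi> j. 2 * b j * fst x $ j, - bN) \<bullet> i + 2 * (\<Sum>j\<in>UNIV. b j * (fst i $ j)\<^sup>2) * t" for t
    unfolding inner_prod_def inner_vec_def
    by (simp add: sum.distrib sum_distrib_left sum_distrib_right algebra_simps power2_eq_square)
  then show "((\<lambda>t. (\<chi> j. 2 * b j * fst (x + t *\<^sub>R i) $ j, - bN) \<bullet> i) has_real_derivative 2 * (\<Sum>j\<in>UNIV. b j * (fst i $ j)\<^sup>2)) (at 0)"
    by (simp only:) (auto intro!: derivative_eq_intros)
qed

lemma quadratic_laplacian:
  fixes b :: "'n::finite \<Rightarrow> real"
  shows "(\<Sum>i\<in>(Basis :: ((real^'n) \<times> real) set). 2 * (\<Sum>j\<in>UNIV. b j * (fst i $ j)\<^sup>2)) = 2 * (\<Sum>j\<in>UNIV. b j)"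
proof -
  have "(\<Sum>j\<in>UNIV. b j * ((axis k 1 :: real^'n) $ j)\<^sup>2) = b k" for k
  proof -
    have "(\<Sum>j\<in>UNIV. b j * ((axis k 1 :: real^'n) $ j)\<^sup>2) = (\<Sum>j\<in>UNIV. if j = k then b j else 0)"
      by (intro sum.cong) (auto simp: axis_def)
    then show ?thesis by simp
  qed
  then show ?thesis unfolding sum_Basis_vec_real by (simp add: sum_distrib_left)
qed

text \<open>Homogeneity reproduces q exactly at every radius r > 0, and the error on the unit sphere
  is at most (c + d r) / r^2.\<close>

lemma uniform_limit_linear_perturbation:
  fixes q :: "'a::real_normed_vector \<Rightarrow> real" and v :: "'a \<Rightarrow> real"
  assumes q: "\<And>r x. q (r *\<^sub>R x) = r\<^sup>2 * q x" and v: "\<And>x. \<bar>v x\<bar> \<le> c + d * norm x"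
  shows "uniform_limit (sphere 0 1) (\<lambda>r x. (q (r *\<^sub>R x) + v (r *\<^sub>R x)) / r\<^sup>2) q at_top"
  unfolding uniform_limit_iff
proof (intro allI impI)
  fix e :: real assume "e > 0"
  have "((\<lambda>r. (c + d * r) / r\<^sup>2) \<longlongrightarrow> 0) at_top" by real_asymp
  then have "eventually (\<lambda>r. (c + d * r) / r\<^sup>2 < e) at_top" using \<open>e > 0\<close> by (rule order_tendstoD(2))
  then show "eventually (\<lambda>r. \<forall>x\<in>sphere 0 1. dist ((q (r *\<^sub>R x) + v (r *\<^sub>R x)) / r\<^sup>2) (q x) < e) at_top"
    using eventually_gt_at_top[of 0]
  proof eventually_elim
    case (elim r)
    show ?case
    proof
      fix x :: 'a assume "x \<in> sphere 0 1"
      then have "\<bar>v (r *\<^sub>R x)\<bar> \<le> c + d * r" using v[of "r *\<^sub>R x"] elim by simp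
      then have "\<bar>v (r *\<^sub>R x)\<bar> / r\<^sup>2 \<le> (c + d * r) / r\<^sup>2" by (rule divide_right_mono) simp
      moreover have "(q (r *\<^sub>R x) + v (r *\<^sub>R x)) / r\<^sup>2 - q x = v (r *\<^sub>R x) / r\<^sup>2"
        using elim by (simp add: q add_divide_distrib)
      ultimately show "dist ((q (r *\<^sub>R x) + v (r *\<^sub>R x)) / r\<^sup>2) (q x) < e"
        using elim by (simp add: dist_real_def)
    qed
  qed
qed

theorem mainTheorem12:
  fixes b :: "'n::finite \<Rightarrow> real" and bN bN1 :: real
  assumes "CARD('n) \<ge> 5"
    and "\<forall>j. b j > 0" and "bN > 0"
    and "(\<Sum>j\<in>UNIV. b j) = 1/2"
  shows "\<exists>(a::'n \<Rightarrow> real) (aN::real). (\<forall>j. a j > 0) \<and>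
    (\<forall>x. newton_pot (parabP a aN) x < \<infinity>) \<and>
    (\<forall>x\<in>parabP a aN. enn2ereal (newton_pot (parabP a aN) x)
        = ereal (- pb b (fst x) + bN * snd x + bN1)) \<and>
    (let u = (\<lambda>x. pb b (fst x) - bN * snd x - bN1 + enn2real (newton_pot (parabP a aN) x)) in
       (\<forall>x. u x \<ge> 0) \<and>
       weak_laplace_eq u (\<lambda>x. indicator {y. u y > 0} x) \<and>
       {x. u x = 0} = parabP a aN \<and>
       uniform_limit (sphere 0 1) (\<lambda>r x. u (r *\<^sub>R x) / r\<^sup>2) (\<lambda>x. pb b (fst x)) at_top) \<and>
    (\<exists>c>0. \<forall>x'\<in>(\<lambda>y. c *\<^sub>R y) ` ellE a.
        enn2ereal (newton_pot ((\<lambda>y. c *\<^sub>R y) ` ellE a) x') = ereal (1 - pb b x'))"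
proof -
  note n = assms(1)
  have n3: "CARD('n) \<ge> 3" using n by simp
  obtain \<alpha>0 :: "'n \<Rightarrow> real" where \<alpha>0: "\<forall>j. \<alpha>0 j > 0" "\<And>j. ell_coeff \<alpha>0 j = b j"
    using exists_ell_coeff[OF n3 assms(2,4)] by blast
  have lin0: "par_lin \<alpha>0 > 0"
  proof -
    fix j :: 'n
    have "0 < \<alpha>0 j * ell_coeff \<alpha>0 j" using \<alpha>0 assms(2) by simp
    also have "\<dots> \<le> par_lin \<alpha>0" by (rule par_lin_ge[OF \<alpha>0(1) n3])
    finally show ?thesis .
  qed
  \<comment> \<open>The slope is homogeneous of degree one, so this dilation turns it into b_N;
    positivity of b_N makes it admissible.\<close>
  define t where "t = bN / par_lin \<alpha>0"
  have t: "t > 0" using lin0 assms(3) by (simp add: t_def)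
  define \<alpha> where "\<alpha> j = t * \<alpha>0 j" for j
  have \<alpha>: "\<forall>j. \<alpha> j > 0" using \<alpha>0(1) t by (simp add: \<alpha>_def)
  have coeff: "ell_coeff \<alpha> j = b j" for j
    unfolding \<alpha>_def[abs_def] ell_coeff_scale[OF t] by (rule \<alpha>0(2))
  have lin: "par_lin \<alpha> = bN"
    unfolding \<alpha>_def[abs_def] par_lin_scale[OF t] using lin0 by (simp add: t_def)
  define a where "a j = sqrt (\<alpha> j)" for j
  have a: "\<forall>j. a j > 0" using \<alpha> by (simp add: a_def)
  have a2: "(a j)\<^sup>2 = \<alpha> j" for j using \<alpha> by (simp add: a_def less_imp_le)
  \<comment> \<open>Moving the vertex changes the constant term at rate b_N > 0, so every real
    b_(N+1) is attained, possibly with negative h.\<close>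
  define h where "h = (bN1 - par_const \<alpha>) / bN"
  have h: "par_const \<alpha> + bN * h = bN1" using assms(3) by (simp add: h_def)
  have P: "parabP a h = par_set \<alpha> h" unfolding parabP_eq[OF a] a2 by simp
  have V: "newton_pot (parabP a h) x = ennreal (par_pot \<alpha> h x)" for x
    unfolding P by (rule newton_pot_par_set[OF \<alpha> n])
  have V0: "par_pot \<alpha> h x \<ge> 0" for x by (rule par_pot_nonneg[OF \<alpha> n])
  have Veq: "par_pot \<alpha> h x = - pb b (fst x) + bN * snd x + bN1 + par_defect \<alpha> h x" for x
    using par_pot_eq[OF \<alpha> n, of h x] h by (simp add: coeff lin pb_def algebra_simps)
  define u where "u x = pb b (fst x) - bN * snd x - bN1 + enn2real (newton_pot (parabP a h) x)" for x
  have u1: "u x = (pb b (fst x) - bN * snd x - bN1) + par_pot \<alpha> h x" for x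
    unfolding u_def V using V0 by simp
  have u2: "u x = par_defect \<alpha> h x" for x unfolding u1 Veq by simp
  have u0: "u x \<ge> 0" for x unfolding u2 by (rule par_defect_nonneg[OF \<alpha>])
  have uz: "u x = 0 \<longleftrightarrow> x \<in> parabP a h" for x unfolding u2 P by (rule par_defect_eq_0_iff[OF \<alpha> n])
  have "weak_laplace_eq (\<lambda>x. (pb b (fst x) - bN * snd x - bN1) + par_pot \<alpha> h x) (indicator (- par_set \<alpha> h))"
    by (rule weak_laplace_par_pot[OF \<alpha> n C2_data_quadratic]) (use quadratic_laplacian[of b] assms(4) in simp)
  moreover have "- par_set \<alpha> h = {y. u y > 0}"
    using u0 uz unfolding P by (auto simp: less_le)
  ultimately have weak: "weak_laplace_eq u (\<lambda>x. indicator {y. u y > 0} x)"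
    unfolding u1[abs_def, symmetric] by (simp add: u1[symmetric])
  have lim: "uniform_limit (sphere 0 1) (\<lambda>r x. u (r *\<^sub>R x) / r\<^sup>2) (\<lambda>x. pb b (fst x)) at_top"
  proof -
    let ?v = "\<lambda>x::(real^'n) \<times> real. - bN * snd x - bN1 + par_pot \<alpha> h x"
    have "uniform_limit (sphere 0 1) (\<lambda>r x. (pb b (fst (r *\<^sub>R x)) + ?v (r *\<^sub>R x)) / r\<^sup>2) (\<lambda>x. pb b (fst x)) at_top"
    \<comment> \<open>The slope is doubled because b_N |x| occurs twice: in the explicit linear term
      and in the growth bound of the potential.\<close>
    proof (rule uniform_limit_linear_perturbation[where c = "\<bar>bN1\<bar> + \<bar>par_const \<alpha>\<bar> + bN * \<bar>h\<bar>" and d = "2 * bN"])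
      fix r :: real and x :: "(real^'n) \<times> real"
      show "pb b (fst (r *\<^sub>R x)) = r\<^sup>2 * pb b (fst x)"
        by (simp add: pb_def sum_distrib_left power_mult_distrib mult_ac)
      have s: "\<bar>snd x\<bar> \<le> norm x" using norm_snd_le[of "snd x" "fst x"] by simp
      have "bN * \<bar>snd x + h\<bar> \<le> bN * (norm x + \<bar>h\<bar>)" using s assms(3) by (intro mult_left_mono) linarith+
      then have "par_pot \<alpha> h x \<le> \<bar>par_const \<alpha>\<bar> + bN * norm x + bN * \<bar>h\<bar>"
        using par_pot_le[OF \<alpha> n, of h x] unfolding lin by (simp add: distrib_left)
      moreover have "\<bar>bN * snd x\<bar> \<le> bN * norm x" using s assms(3) by (simp add: abs_mult)
      ultimately show "\<bar>?v x\<bar> \<le> \<bar>bN1\<bar> + \<bar>par_const \<alpha>\<bar> + bN * \<bar>h\<bar> + 2 * bN * norm x"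
        using V0[of x] by linarith
    qed
    moreover have "pb b (fst y) + ?v y = u y" for y by (simp add: u1)
    ultimately show ?thesis by (simp only:)
  qed
  have ell: "\<exists>c>0. \<forall>x'\<in>(\<lambda>y. c *\<^sub>R y) ` ellE a.
      enn2ereal (newton_pot ((\<lambda>y. c *\<^sub>R y) ` ellE a) x') = ereal (1 - pb b x')"
  \<comment> \<open>Dividing the squared semi-axes \<alpha>_j by b_N changes the central value
    \<open>par_lin \<alpha>\<close> from b_N to 1 and leaves the quadratic coefficients b_j
    unchanged.\<close>
  proof (intro exI[of _ "sqrt (1 / bN)"] conjI ballI)
    let ?c = "sqrt (1 / bN)" and ?\<beta> = "\<lambda>j. 1 / bN * \<alpha> j"
    show c: "?c > 0" using assms(3) by simp
    have s: "1 / bN > 0" using assms(3) by simp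
    have \<beta>: "\<forall>j. ?\<beta> j > 0" using \<alpha> assms(3) by simp
    have E: "(\<lambda>y. ?c *\<^sub>R y) ` ellE a = {x. par_quad ?\<beta> x 0 \<le> 1}"
      unfolding scaled_ellE[OF c] a2 using assms(3) by simp
    fix x' assume "x' \<in> (\<lambda>y. ?c *\<^sub>R y) ` ellE a"
    then have x': "par_quad ?\<beta> x' 0 \<le> 1" unfolding E by simp
    have pot: "newton_pot ((\<lambda>y. ?c *\<^sub>R y) ` ellE a) x' = ennreal (1 - pb b x')"
      unfolding E newton_pot_ellipsoid_inside(2)[OF \<beta> n3 x'] ell_coeff_scale[OF s] par_lin_scale[OF s] coeff lin
      using assms(3) by (simp add: pb_def)
    have "0 \<le> 1 - pb b x'"
      using newton_pot_ellipsoid_inside(1)[OF \<beta> n3 x'] assms(3)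
      unfolding ell_coeff_scale[OF s] par_lin_scale[OF s] coeff lin by (simp add: pb_def)
    then show "enn2ereal (newton_pot ((\<lambda>y. ?c *\<^sub>R y) ` ellE a) x') = ereal (1 - pb b x')"
      unfolding pot by simp
  qed
  have "\<forall>x. newton_pot (parabP a h) x < \<infinity>" unfolding V by simp
  moreover have "\<forall>x\<in>parabP a h. enn2ereal (newton_pot (parabP a h) x) = ereal (- pb b (fst x) + bN * snd x + bN1)"
  proof
    fix x assume "x \<in> parabP a h"
    then have "par_defect \<alpha> h x = 0" using uz u2 by simp
    then have "par_pot \<alpha> h x = - pb b (fst x) + bN * snd x + bN1" using Veq by simp
    then show "enn2ereal (newton_pot (parabP a h) x) = ereal (- pb b (fst x) + bN * snd x + bN1)"
      unfolding V using V0[of x] by simp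
  qed
  moreover have "{x. u x = 0} = parabP a h" using uz by blast
  ultimately show ?thesis
    using a u0 weak lim ell unfolding Let_def u_def[abs_def] by blast
qed

end
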